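(* The degrees of freedom (DoF) region of an interference network with general message demands is determined by the prime receivers. Adding non-prime receivers to the system will not affect the DoF region.
   Context: $\mathbb{R}^K_+=\{(x_1,\dots,x_K)\in\mathbb{R}^K : x_k\ge 0 \text{ for all } k\}$. Interference network with general message demands: a single hop network with $K$ transmitters and $J$ receivers, each having $M$ antennas. Each transmitter has one and only one independent message (message $k$ at transmitter $k$). Each receiver can request an arbitrary set of messages; $\mathcal{M}_j\subseteq\{1,\dots,K\}$ is the set of indices of the messages requested by receiver $j$. At time $t$ receiver $j$ observes $$\boldsymbol{y}_j(t)=\sum_{k=1}^K \boldsymbol{H}_{jk}(t)\boldsymbol{x}_k(t)+\boldsymbol{z}_j(t),$$ where $\boldsymbol{x}_k(t)\in\mathbb{C}^M$ is the transmitted signal of transmitter $k$, satisfying the power constraint $\mathrm{E}(\|\boldsymbol{x}_k(t)\|^2)\le P$; $\boldsymbol{H}_{jk}(t)\in\mathbb{C}^{M\times M}$ is the channel between transmitter $k$ and receiver $j$; and $\boldsymbol{z}_j(t)\in\mathbb{C}^M$ is independent circularly symmetric complex Gaussian noise with each entry $\mathcal{CN}(0,1)$ distributed. The elements of all the channel matrices at different time instants are independently drawn from some continuous distribution, and the channel gains are bounded between a positive minimum value and a finite maximum value. There is perfect channel state information at the receivers and global channel state information at the transmitters. $C(P)$ denotes the capacity region of this system, in the usual sense: rate tuples $(R_1,\dots,R_K)$, with $R_k$ the rate of message $k$, for which every receiver $j$ can reliably decode all messages in $\mathcal{M}_j$. The DoF region is defined as $$\mathcal{D}=\Big\{\boldsymbol{d}\in\mathbb{R}^K_+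 : \exists\,(R_1(P),\dots,R_K(P))\in C(P)\text{ such that } d_k=\lim_{P\to\infty}\frac{R_k(P)}{\log P},\ 1\le k\le K\Big\}.$$ Prime receivers: the collection of message request sets $\{\mathcal{M}_j:1\le j\le J\}$, with duplicates removed, is a poset under inclusion. Let $\bar{\mathcal{M}}_1,\dots,\bar{\mathcal{M}}_G$ be its maximal elements. Divide the receivers into $G$ groups: if $\mathcal{M}_j=\bar{\mathcal{M}}_g$ for some $g$, receiver $j$ is assigned to group $g$; otherwise receiver $j$ is assigned to any one group $g$ such that $\mathcal{M}_j\subset\bar{\mathcal{M}}_g$. Each group contains at least one receiver whose message request set is a superset of the message request set of every other receiver in the group; one such receiver per group is chosen and called the prime receiver of that group. All other receivers are non-prime. *)

theory Defs
  imports "HOL-Probability.Probability"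
begin

text \<open>
  Index types: \<open>'r\<close> for receivers, \<open>'k\<close> for transmitters (equivalently messages) and \<open>'m\<close> for
  the antennas of each node, so \<open>J = CARD('r)\<close>, \<open>K = CARD('k)\<close> and \<open>M = CARD('m)\<close>.
  The network with receiver set \<open>S\<close> involves only the channels and noises of the receivers
  in \<open>S\<close>; in particular its transmitters see only the channels into \<open>S\<close>.
\<close>

section \<open>Random quantities\<close>

text \<open>
  A continuous distribution is one without point masses. Gains may be real or
  complex, and no density is required.
\<close>

definition channel_distribution :: "complex measure \<Rightarrow> bool" where
  "channel_distribution \<mu> \<longleftrightarrow>
     prob_space \<mu> \<and> sets \<mu> = sets borel \<and>
     (\<forall>c. emeasure \<mu> {c} = 0) \<and>
     (\<exists>a b. 0 < a \<and> (AE c in \<mu>. a \<le> cmod c \<and> cmod c \<le> b))"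

definition std_complex_normal :: "complex measure" where
  "std_complex_normal =
     (let N = density lborel (\<lambda>x. ennreal (normal_density 0 (1 / sqrt 2) x))
      in distr (N \<Otimes>\<^sub>M N) borel (\<lambda>(u, v). Complex u v))"

text \<open>
  The entry at \<open>(t, j, k, a, b)\<close> is the gain at time \<open>t\<close> from antenna \<open>b\<close> of transmitter \<open>k\<close>
  to antenna \<open>a\<close> of receiver \<open>j\<close>.
\<close>

type_synonym ('r, 'k, 'm) csi = "nat \<times> 'r \<times> 'k \<times> 'm \<times> 'm \<Rightarrow> complex"

definition channel_law ::
  "complex measure \<Rightarrow> 'r set \<Rightarrow> nat \<Rightarrow> ('r::finite, 'k::finite, 'm::finite) csi measure" where
  "channel_law \<mu> S n = PiM ({..<n} \<times> S \<times> UNIV \<times> UNIV \<times> UNIV) (\<lambda>_. \<mu>)"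

definition noise_law :: "'r set \<Rightarrow> nat \<Rightarrow> (nat \<times> 'r::finite \<times> 'm::finite \<Rightarrow> complex) measure" where
  "noise_law S n = PiM ({..<n} \<times> S \<times> UNIV) (\<lambda>_. std_complex_normal)"

definition message_law :: "('k::finite \<Rightarrow> nat) \<Rightarrow> ('k \<Rightarrow> nat) measure" where
  "message_law W = measure_pmf (pmf_of_set {w. \<forall>k. w k < W k})"

section \<open>Codes\<close>

definition channel_matrix ::
  "('r, 'k, 'm::finite) csi \<Rightarrow> nat \<Rightarrow> 'r \<Rightarrow> 'k \<Rightarrow> complex ^ 'm ^ 'm" where
  "channel_matrix h t j k = (\<chi> a b. h (t, j, k, a, b))"

definition received ::
  "('k::finite \<Rightarrow> nat \<Rightarrow> complex ^ 'm) \<Rightarrow> ('r, 'k, 'm::finite) csi \<Rightarrow>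
   (nat \<times> 'r \<times> 'm \<Rightarrow> complex) \<Rightarrow> 'r \<Rightarrow> nat \<Rightarrow> complex ^ 'm" where
  "received x h z j t =
     (\<Sum>k\<in>UNIV. channel_matrix h t j k *v x k t) + (\<chi> a. z (t, j, a))"

text \<open>
  Channel knowledge is noncausal: every encoder and decoder is given the channel realization
  of the whole block.
\<close>

type_synonym ('r, 'k, 'm) encoders =
  "'k \<Rightarrow> nat \<Rightarrow> ('r, 'k, 'm) csi \<Rightarrow> nat \<Rightarrow> complex ^ 'm"

type_synonym ('r, 'k, 'm) decoders =
  "'r \<Rightarrow> ('r, 'k, 'm) csi \<Rightarrow> (nat \<Rightarrow> complex ^ 'm) \<Rightarrow> 'k \<Rightarrow> nat"

text \<open>
  Measurability is required for all \<open>w\<close>, including those outside the message set, because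
  the sigma-algebra of \<open>message_law\<close> lives on all of \<open>'k \<Rightarrow> nat\<close>. The power is a nonnegative
  integral, so that infinite power is not read as \<open>0\<close>.
\<close>

definition valid_encoders ::
  "complex measure \<Rightarrow> 'r set \<Rightarrow> real \<Rightarrow> nat \<Rightarrow> ('k \<Rightarrow> nat) \<Rightarrow>
   ('r::finite, 'k::finite, 'm::finite) encoders \<Rightarrow> bool" where
  "valid_encoders \<mu> S P n W enc \<longleftrightarrow>
     (\<forall>k w. \<forall>t<n. (\<lambda>h. enc k w h t) \<in> borel_measurable (channel_law \<mu> S n)) \<and>
     (\<forall>k. \<forall>t<n. (\<integral>\<^sup>+ (w, h). ennreal ((norm (enc k (w k) h t))\<^sup>2)
                  \<partial>(message_law W \<Otimes>\<^sub>M channel_law \<mu> S n)) \<le> ennreal P)"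

definition valid_decoders ::
  "complex measure \<Rightarrow> 'r set \<Rightarrow> nat \<Rightarrow> ('r::finite, 'k::finite, 'm::finite) decoders \<Rightarrow> bool" where
  "valid_decoders \<mu> S n dec \<longleftrightarrow>
     (\<forall>j\<in>S. \<forall>k. (\<lambda>(h, y). dec j h y k) \<in>
        measurable (channel_law \<mu> S n \<Otimes>\<^sub>M PiM {..<n} (\<lambda>_. borel)) (count_space UNIV))"

definition error_probability ::
  "complex measure \<Rightarrow> 'r set \<Rightarrow> ('r \<Rightarrow> 'k set) \<Rightarrow> nat \<Rightarrow> ('k \<Rightarrow> nat) \<Rightarrow>
   ('r::finite, 'k::finite, 'm::finite) encoders \<Rightarrow> ('r, 'k, 'm) decoders \<Rightarrow> real" where
  "error_probability \<mu> S demand n W enc dec =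
     (let \<Omega> = message_law W \<Otimes>\<^sub>M (channel_law \<mu> S n \<Otimes>\<^sub>M noise_law S n)
      in measure \<Omega> {(w, h, z) \<in> space \<Omega>. \<exists>j\<in>S. \<exists>k\<in>demand j.
           dec j h (\<lambda>t\<in>{..<n}. received (\<lambda>k. enc k (w k) h) h z j t) k \<noteq> w k})"

section \<open>Capacity and degrees-of-freedom regions\<close>

text \<open>Rates are in bits per channel use. The index \<open>n\<close> is the block length.\<close>

definition achievable ::
  "'m::finite itself \<Rightarrow> complex measure \<Rightarrow> 'r set \<Rightarrow> ('r::finite \<Rightarrow> 'k set) \<Rightarrow>
   real \<Rightarrow> real ^ 'k::finite \<Rightarrow> bool" where
  "achievable _ \<mu> S demand P R \<longleftrightarrow>
     (\<forall>k. 0 \<le> R $ k) \<and>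
     (\<exists>(enc :: nat \<Rightarrow> ('r, 'k, 'm) encoders) (dec :: nat \<Rightarrow> ('r, 'k, 'm) decoders).
        let W = (\<lambda>n k. nat \<lceil>2 powr (real n * R $ k)\<rceil>)
        in (\<forall>n. valid_encoders \<mu> S P n (W n) (enc n) \<and> valid_decoders \<mu> S n (dec n)) \<and>
           (\<lambda>n. error_probability \<mu> S demand n (W n) (enc n) (dec n)) \<longlonglongrightarrow> 0)"

definition capacity_region ::
  "'m::finite itself \<Rightarrow> complex measure \<Rightarrow> 'r set \<Rightarrow> ('r::finite \<Rightarrow> 'k set) \<Rightarrow>
   real \<Rightarrow> (real ^ 'k::finite) set" where
  "capacity_region m \<mu> S demand P = closure {R. achievable m \<mu> S demand P R}"

definition DoF_region ::
  "'m::finite itself \<Rightarrow> complex measure \<Rightarrow> 'r set \<Rightarrow> ('r::finite \<Rightarrow> 'k set) \<Rightarrow>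
   (real ^ 'k::finite) set" where
  "DoF_region m \<mu> S demand =
     {d. (\<forall>k. 0 \<le> d $ k) \<and>
         (\<exists>R :: real \<Rightarrow> real ^ 'k.
            (\<forall>P>0. R P \<in> capacity_region m \<mu> S demand P) \<and>
            (\<forall>k. ((\<lambda>P. R P $ k / log 2 P) \<longlongrightarrow> d $ k) at_top))}"

section \<open>Prime receivers\<close>

definition maximal_demands :: "('r \<Rightarrow> 'k set) \<Rightarrow> 'k set set" where
  "maximal_demands demand = {A \<in> range demand. \<forall>B \<in> range demand. \<not> A \<subset> B}"

text \<open>Groups are labelled by the maximal demand sets; \<open>grp j\<close> is the label of the group of \<open>j\<close>.\<close>

definition receiver_grouping :: "('r \<Rightarrow> 'k set) \<Rightarrow> ('r \<Rightarrow> 'k set) \<Rightarrow> bool" where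
  "receiver_grouping demand grp \<longleftrightarrow>
     (\<forall>j. grp j \<in> maximal_demands demand \<and>
          (if demand j \<in> maximal_demands demand then grp j = demand j
           else demand j \<subset> grp j))"

definition prime_choice ::
  "('r \<Rightarrow> 'k set) \<Rightarrow> ('r \<Rightarrow> 'k set) \<Rightarrow> ('k set \<Rightarrow> 'r) \<Rightarrow> bool" where
  "prime_choice demand grp p \<longleftrightarrow>
     (\<forall>A \<in> maximal_demands demand.
        grp (p A) = A \<and> (\<forall>j. grp j = A \<longrightarrow> demand j \<subseteq> demand (p A)))"

definition prime_receivers :: "('r \<Rightarrow> 'k set) \<Rightarrow> ('k set \<Rightarrow> 'r) \<Rightarrow> 'r set" where
  "prime_receivers demand p = p ` maximal_demands demand"

end

theory Submission
  imports Defs "HOL-Real_Asymp.Real_Asymp"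
begin

text \<open>
  The degrees of freedom region is computed for every set \<open>S\<close> of receivers: it is the polytope of
  all \<open>d \<ge> 0\<close> such that, for every receiver \<open>j\<close> in \<open>S\<close>, the requested \<open>d k\<close> plus the largest
  \<open>d i\<close> of any other message requested in \<open>S\<close> do not exceed the number of antennas. The constraint
  of a non-prime receiver follows from that of a prime receiver whose demand contains its own.

  Achievability is asymptotic interference alignment: the beams are monomials in the interfering
  gains, so that at every receiver the interference falls into few directions, while the desired
  directions stay independent of it almost surely. Zero forcing then yields parallel channels
  with noise of bounded size up to a small probability, on which an uncoded constellation of
  fixed spacing and about \<open>P\<close> points is protected by a Gilbert--Varshamov code across blocks.

  For the converse, a receiver that has decoded its messages knows one more signal up to noise,
  and can imitate the receiver requesting it, except in the rare slots with an ill-conditioned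
  channel. Counting the messages by Gaussian-weighted volumes in place of entropies bounds the
  sum rate.
\<close>

section \<open>Separately polynomial functions\<close>

text \<open>A code for the prime receivers cannot simply be handed to a larger system: interference
  that is aligned at a prime receiver is in general not aligned at a non-prime one, and the
  transmitters know only the channels into the chosen receivers. So codes of different systems are
  never compared; each region is evaluated by itself, and only the polytopes are compared. The gain
  law need not have a density. Genericity is therefore a statement about zeros of polynomials,
  certified by one explicit channel at which everything can be computed. Nor is there an explicit
  bound on filters and inverse channels. They are controlled in probability only: a small fraction
  of blocks or slots is given up, the code has to correct it in the direct part, and its cost is
  sent to 0 at the end of the converse. Time variation supplies the dimensions for alignment, many
  slots being precoded jointly. Imitation of one receiver by another works because all nodes have
  equally many antennas, so that the channel from one transmitter to one receiver is square and
  almost surely invertible.\<close>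

text \<open>
  Being a polynomial in each coordinate separately is all that Fubini's theorem needs to show
  that a function which is not identically zero is nonzero almost everywhere.
\<close>

definition sep_poly :: "'i set \<Rightarrow> (('i \<Rightarrow> complex) \<Rightarrow> complex) \<Rightarrow> bool" where
  "sep_poly I f \<longleftrightarrow> f \<in> borel_measurable (PiM I (\<lambda>_. borel)) \<and>
     (\<forall>x h. \<exists>p. \<forall>u. f (h(x := u)) = poly p u)"

lemma sep_poly_measurable: "sep_poly I f \<Longrightarrow> f \<in> borel_measurable (PiM I (\<lambda>_. borel))"
  by (simp add: sep_poly_def)

lemma sep_poly_const: "sep_poly I (\<lambda>_. c)"
  by (auto simp: sep_poly_def intro!: exI[of _ "[:c:]"])

lemma sep_poly_coord:
  assumes "i \<in> I" shows "sep_poly I (\<lambda>h. h i)"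
proof -
  have "\<exists>p. \<forall>u. (h(x := u)) i = poly p u" for x and h :: "'a \<Rightarrow> complex"
  proof (cases "x = i")
    case True then show ?thesis by (intro exI[of _ "[:0, 1:]"]) simp
  next
    case False then show ?thesis by (intro exI[of _ "[:h i:]"]) simp
  qed
  with assms show ?thesis by (simp add: sep_poly_def)
qed

lemma sep_poly_add:
  assumes "sep_poly I f" "sep_poly I g" shows "sep_poly I (\<lambda>h. f h + g h)"
  using assms unfolding sep_poly_def by (metis (mono_tags, lifting) borel_measurable_add poly_add)

lemma sep_poly_mult:
  assumes "sep_poly I f" "sep_poly I g" shows "sep_poly I (\<lambda>h. f h * g h)"
  using assms unfolding sep_poly_def by (metis (mono_tags, lifting) borel_measurable_times poly_mult)

lemma sep_poly_diff:
  assumes "sep_poly I f" "sep_poly I g" shows "sep_poly I (\<lambda>h. f h - g h)"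
  using assms unfolding sep_poly_def by (metis (mono_tags, lifting) borel_measurable_diff poly_diff)

lemma sep_poly_sum:
  assumes "\<And>i. i \<in> A \<Longrightarrow> sep_poly I (f i)" shows "sep_poly I (\<lambda>h. \<Sum>i\<in>A. f i h)"
  using assms by (induction A rule: infinite_finite_induct) (auto intro: sep_poly_const sep_poly_add)

lemma sep_poly_prod:
  assumes "\<And>i. i \<in> A \<Longrightarrow> sep_poly I (f i)" shows "sep_poly I (\<lambda>h. \<Prod>i\<in>A. f i h)"
  using assms by (induction A rule: infinite_finite_induct) (auto intro: sep_poly_const sep_poly_mult)

lemma sep_poly_power:
  assumes "sep_poly I f" shows "sep_poly I (\<lambda>h. f h ^ n)"
  using assms by (induction n) (auto intro: sep_poly_const sep_poly_mult)

text \<open>Induction on the coordinates. With the last coordinate frozen at \<open>h0 x\<close> the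
  function is nonzero almost everywhere by induction; wherever it is nonzero, the polynomial in the
  freed last coordinate is not the zero polynomial, and its finitely many roots have measure zero
  each. The test point is \<open>restrict h0 I\<close> because points of the product space are
  extensional.\<close>

lemma AE_sep_poly_nonzero:
  assumes "finite I" "prob_space \<mu>" and [measurable_cong]: "sets \<mu> = sets borel"
    and "\<And>c. emeasure \<mu> {c} = 0"
    and "sep_poly I f" "f (restrict h0 I) \<noteq> 0"
  shows "AE h in PiM I (\<lambda>_. \<mu>). f h \<noteq> 0"
  using assms(1,5,6)
proof (induction I arbitrary: f rule: finite_induct)
  case empty
  then show ?case by (auto simp: PiM_empty AE_count_space restrict_def)
next
  case (insert x I)
  interpret prob_space \<mu> by fact
  interpret product_sigma_finite "\<lambda>_. \<mu>" by unfold_locales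
  have [measurable]: "f \<in> borel_measurable (PiM (insert x I) (\<lambda>_. \<mu>))"
    using sep_poly_measurable[OF insert.prems(1)] by (simp cong: measurable_cong_sets sets_PiM_cong add: assms(3))
  have spf: "sep_poly I (\<lambda>h. f (h(x := h0 x)))"
    unfolding sep_poly_def
  proof (intro conjI allI)
    have "(\<lambda>h. h(x := h0 x)) \<in> measurable (PiM I (\<lambda>_. borel)) (PiM (insert x I) (\<lambda>_. borel :: complex measure))"
      using insert.hyps by measurable
    from measurable_compose[OF this sep_poly_measurable[OF insert.prems(1)]]
    show "(\<lambda>h. f (h(x := h0 x))) \<in> borel_measurable (PiM I (\<lambda>_. borel))" .
    fix y h
    show "\<exists>p. \<forall>u. f (h(y := u, x := h0 x)) = poly p u"
    proof (cases "y = x")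
      case True then show ?thesis by (intro exI[of _ "[:f (h(x := h0 x)):]"]) simp
    next
      case False then show ?thesis
        using insert.prems(1) unfolding sep_poly_def by (metis fun_upd_twist)
    qed
  qed
  have eq: "(restrict h0 I)(x := h0 x) = restrict h0 (insert x I)" by (auto simp: restrict_def)
  have IH: "AE h in PiM I (\<lambda>_. \<mu>). f (h(x := h0 x)) \<noteq> 0"
    using insert.IH[OF spf, unfolded eq, OF insert.prems(2)] .
  have inner: "(\<integral>\<^sup>+ y. indicator {h. f h = 0} (h(x := y)) \<partial>\<mu>) = 0" if nz: "f (h(x := h0 x)) \<noteq> 0" for h
  proof -
    obtain p where p: "\<And>u. f (h(x := u)) = poly p u"
      using insert.prems(1) unfolding sep_poly_def by metis
    have "p \<noteq> 0" using nz p by auto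
    then have fin: "finite {u. poly p u = 0}" by (rule poly_roots_finite)
    have "emeasure \<mu> {u. poly p u = 0} = (\<Sum>u\<in>{u. poly p u = 0}. emeasure \<mu> {u})"
      using fin by (intro emeasure_eq_sum_singleton) (auto simp: assms(3))
    also have "\<dots> = 0" by (simp add: assms(4))
    finally have z: "emeasure \<mu> {u. poly p u = 0} = 0" .
    have "(\<integral>\<^sup>+ y. indicator {h. f h = 0} (h(x := y)) \<partial>\<mu>) = (\<integral>\<^sup>+ y. indicator {u. poly p u = 0} y \<partial>\<mu>)"
      by (intro nn_integral_cong) (auto simp: p indicator_def)
    also have "\<dots> = emeasure \<mu> {u. poly p u = 0}"
      using fin by (intro nn_integral_indicator) (auto simp: assms(3) intro: borel_closed finite_imp_closed)
    finally show ?thesis using z by simp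
  qed
  have "(\<integral>\<^sup>+ h. indicator {h. f h = 0} h \<partial>PiM (insert x I) (\<lambda>_. \<mu>))
      = (\<integral>\<^sup>+ h. (\<integral>\<^sup>+ y. indicator {h. f h = 0} (h(x := y)) \<partial>\<mu>) \<partial>PiM I (\<lambda>_. \<mu>))"
    by (intro product_nn_integral_insert insert.hyps) measurable
  also have "\<dots> = (\<integral>\<^sup>+ h. 0 \<partial>PiM I (\<lambda>_. \<mu>))"
    using IH inner by (intro nn_integral_cong_AE) auto
  finally have z: "(\<integral>\<^sup>+ h. indicator {h. f h = 0} h \<partial>PiM (insert x I) (\<lambda>_. \<mu>)) = 0" by simp
  have "AE h in PiM (insert x I) (\<lambda>_. \<mu>). (indicator {h. f h = 0} h :: ennreal) = 0"
    using z by (subst nn_integral_0_iff_AE[symmetric]) measurable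
  then show ?case by (auto simp: indicator_def)
qed

text \<open>
  Fraction-free Gaussian elimination over the ring of separately polynomial functions.
  Independence is only assumed at the single point \<open>h0\<close>.
\<close>

lemma annihilating_row:
  assumes "finite C" "finite R"
    and "\<And>c r. c \<in> C \<Longrightarrow> r \<in> R \<Longrightarrow> sep_poly I (a c r)"
    and "\<And>r. r \<in> R \<Longrightarrow> sep_poly I (x r)"
    and "\<And>l. (\<And>r. r \<in> R \<Longrightarrow> (\<Sum>c\<in>C. l c * a c r h0) = 0) \<Longrightarrow> \<forall>c\<in>C. l c = 0"
    and "\<And>l. \<exists>r\<in>R. x r h0 \<noteq> (\<Sum>c\<in>C. l c * a c r h0)"
  obtains g where "\<And>r. r \<in> R \<Longrightarrow> sep_poly I (g r)"
    "\<And>c h. c \<in> C \<Longrightarrow> (\<Sum>r\<in>R. g r h * a c r h) = 0"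
    "(\<Sum>r\<in>R. g r h0 * x r h0) \<noteq> 0"
proof -
  have "\<exists>g. (\<forall>r\<in>R. sep_poly I (g r)) \<and> (\<forall>c\<in>C. \<forall>h. (\<Sum>r\<in>R. g r h * a c r h) = 0) \<and>
    (\<Sum>r\<in>R. g r h0 * x r h0) \<noteq> 0"
    using assms(1,3-6)
  proof (induction C arbitrary: x rule: finite_induct)
    case empty
    then obtain r where r: "r \<in> R" "x r h0 \<noteq> 0" by (metis sum.empty)
    define g where "g = (\<lambda>r' (h :: 'c \<Rightarrow> complex). if r' = r then 1 else (0::complex))"
    have "(\<Sum>r'\<in>R. g r' h0 * x r' h0) = (\<Sum>r'\<in>R. if r' = r then x r h0 else 0)"
      by (intro sum.cong) (auto simp: g_def)
    also have "\<dots> = x r h0" using r(1) assms(2) by simp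
    finally have "(\<Sum>r'\<in>R. g r' h0 * x r' h0) \<noteq> 0" using r by simp
    moreover have "\<forall>r'\<in>R. sep_poly I (g r')" by (auto simp: g_def intro: sep_poly_const)
    ultimately show ?case by blast
  next
    case (insert c1 C)
    note indep = insert.prems(3) and notspan = insert.prems(4)
    have indepC: "\<forall>c\<in>C. l c = 0" if "\<And>r. r \<in> R \<Longrightarrow> (\<Sum>c\<in>C. l c * a c r h0) = 0" for l
    proof -
      have eq: "(\<Sum>c\<in>C. (l(c1 := 0)) c * a c r h0) = (\<Sum>c\<in>C. l c * a c r h0)" for r
        using insert.hyps by (intro sum.cong) auto
      have "\<forall>c\<in>insert c1 C. (l(c1 := 0)) c = 0"
        using that eq insert.hyps by (intro indep) simp
      then show ?thesis using insert.hyps(2) by (metis fun_upd_other insertCI)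
    qed
    have notspan1: "\<exists>r\<in>R. a c1 r h0 \<noteq> (\<Sum>c\<in>C. l c * a c r h0)" for l
    proof (rule ccontr)
      assume "\<not> ?thesis"
      then have e: "\<And>r. r \<in> R \<Longrightarrow> a c1 r h0 = (\<Sum>c\<in>C. l c * a c r h0)" by blast
      have eq: "(\<Sum>c\<in>C. (l(c1 := -1)) c * a c r h0) = (\<Sum>c\<in>C. l c * a c r h0)" for r
        using insert.hyps by (intro sum.cong) auto
      have "\<forall>c\<in>insert c1 C. (l(c1 := -1)) c = 0"
        using e eq insert.hyps by (intro indep) simp
      then show False by (auto dest: bspec[of _ _ c1])
    qed
    obtain g1 where g1: "\<And>r. r \<in> R \<Longrightarrow> sep_poly I (g1 r)"
        "\<And>c h. c \<in> C \<Longrightarrow> (\<Sum>r\<in>R. g1 r h * a c r h) = 0" "(\<Sum>r\<in>R. g1 r h0 * a c1 r h0) \<noteq> 0"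
      using insert.IH[of "a c1", OF _ _ indepC notspan1] insert.prems(1) by blast
    define \<gamma> where "\<gamma> = (\<lambda>h. \<Sum>r\<in>R. g1 r h * a c1 r h)"
    define \<xi> where "\<xi> = (\<lambda>h. \<Sum>r\<in>R. g1 r h * x r h)"
    have sp: "sep_poly I \<gamma>" "sep_poly I \<xi>"
      unfolding \<gamma>_def \<xi>_def using g1(1) insert.prems(1,2)
      by (auto intro!: sep_poly_sum sep_poly_mult)
    \<comment> \<open>Elimination of column \<open>c1\<close> without division:
      \<open>\<xi> h0 / \<gamma> h0\<close> is the coefficient of \<open>c1\<close> that
      \<open>g1\<close> detects in \<open>x\<close>, and multiplying through by
      \<open>\<gamma>\<close> keeps all entries polynomial. Since \<open>\<gamma> h0\<close> is
      nonzero, a representation of \<open>x'\<close> by \<open>C\<close> at \<open>h0\<close> would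
      put \<open>x\<close> into the span of \<open>insert c1 C\<close>.\<close>
    define x' where "x' = (\<lambda>r h. x r h * \<gamma> h - a c1 r h * \<xi> h)"
    have spx': "sep_poly I (x' r)" if "r \<in> R" for r
      unfolding x'_def using sp that insert.prems(1,2) by (intro sep_poly_diff sep_poly_mult) auto
    have \<gamma>0: "\<gamma> h0 \<noteq> 0" using g1(3) by (simp add: \<gamma>_def)
    have notspan': "\<exists>r\<in>R. x' r h0 \<noteq> (\<Sum>c\<in>C. l c * a c r h0)" for l
    proof (rule ccontr)
      assume "\<not> ?thesis"
      then have e: "\<And>r. r \<in> R \<Longrightarrow> x' r h0 = (\<Sum>c\<in>C. l c * a c r h0)" by blast
      define l' where "l' = (\<lambda>c. if c = c1 then \<xi> h0 / \<gamma> h0 else l c / \<gamma> h0)"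
      have "x r h0 = (\<Sum>c\<in>insert c1 C. l' c * a c r h0)" if "r \<in> R" for r
      proof -
        have "(\<Sum>c\<in>C. l' c * a c r h0) = (\<Sum>c\<in>C. l c * a c r h0) / \<gamma> h0"
          unfolding sum_divide_distrib using insert.hyps(2) by (intro sum.cong) (auto simp: l'_def)
        also have "\<dots> = x r h0 - a c1 r h0 * \<xi> h0 / \<gamma> h0"
          using e[OF that, symmetric] \<gamma>0 by (simp add: x'_def field_simps)
        finally show ?thesis using insert.hyps by (simp add: l'_def)
      qed
      with notspan show False by blast
    qed
    obtain g where g: "\<And>r. r \<in> R \<Longrightarrow> sep_poly I (g r)"
        "\<And>c h. c \<in> C \<Longrightarrow> (\<Sum>r\<in>R. g r h * a c r h) = 0" "(\<Sum>r\<in>R. g r h0 * x' r h0) \<noteq> 0"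
      using insert.IH[of x', OF _ spx' indepC notspan'] insert.prems(1) by blast
    define \<eta> where "\<eta> = (\<lambda>h. \<Sum>r\<in>R. g r h * a c1 r h)"
    \<comment> \<open>The row \<open>g\<close> kills \<open>C\<close> but may still see
      \<open>c1\<close>. As \<open>g1\<close> kills \<open>C\<close> too, subtracting the right
      multiple of it removes \<open>c1\<close>; at \<open>h0\<close> the new row takes on
      \<open>x\<close> the value that \<open>g\<close> takes on \<open>x'\<close>.\<close>
    define g' where "g' = (\<lambda>r h. g r h * \<gamma> h - g1 r h * \<eta> h)"
    have lin: "(\<Sum>r\<in>R. g' r h * v r) = (\<Sum>r\<in>R. g r h * v r) * \<gamma> h - (\<Sum>r\<in>R. g1 r h * v r) * \<eta> h" for h v
      unfolding g'_def sum_distrib_right sum_subtractf[symmetric] by (intro sum.cong) (auto simp: algebra_simps)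
    have "sep_poly I \<eta>" unfolding \<eta>_def using g(1) insert.prems(1)
      by (auto intro!: sep_poly_sum sep_poly_mult)
    then have "\<forall>r\<in>R. sep_poly I (g' r)"
      unfolding g'_def using g(1) g1(1) sp by (auto intro!: sep_poly_diff sep_poly_mult)
    moreover have "\<forall>c\<in>insert c1 C. \<forall>h. (\<Sum>r\<in>R. g' r h * a c r h) = 0"
      unfolding lin using g(2) g1(2) by (auto simp: \<gamma>_def \<eta>_def)
    moreover have "(\<Sum>r\<in>R. g' r h0 * x r h0) = (\<Sum>r\<in>R. g r h0 * x' r h0)"
    proof -
      have "(\<Sum>r\<in>R. g r h0 * x' r h0) = (\<Sum>r\<in>R. g r h0 * x r h0) * \<gamma> h0 - \<xi> h0 * \<eta> h0"
        unfolding x'_def \<eta>_def sum_distrib_left sum_distrib_right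
          sum_subtractf[symmetric] by (intro sum.cong) (auto simp: algebra_simps)
      then show ?thesis by (simp add: lin \<xi>_def)
    qed
    ultimately show ?case using g(3) by metis
  qed
  then show ?thesis using that by metis
qed

section \<open>Exponent weights, Vandermonde systems and time windows\<close>

lemma weighted_sum_unique:
  fixes a a' s s' G :: nat
  assumes "a * G + s = a' * G + s'" "s < G" "s' < G"
  shows "a = a' \<and> s = s'"
proof -
  have "(a * G + s) div G = a" "(a' * G + s') div G = a'" using assms(2,3) by auto
  with assms(1) show ?thesis by auto
qed

text \<open>Positional notation with digits at most \<open>N\<close>: the weight of each new
  coordinate exceeds every sum that the earlier ones can reach. Distinct exponent vectors thus give
  distinct powers of 2 at the test channel of the independence argument.\<close>

lemma injective_weights:
  assumes "finite X"
  shows "\<exists>g :: 'x \<Rightarrow> nat. \<forall>f\<in>X \<rightarrow>\<^sub>E {..N}. \<forall>f'\<in>X \<rightarrow>\<^sub>E {..N}.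
    (\<Sum>x\<in>X. f x * g x) = (\<Sum>x\<in>X. f' x * g x) \<longrightarrow> f = f'"
  using assms
proof (induction X rule: finite_induct)
  case empty
  then show ?case by auto
next
  case (insert y X)
  from insert.IH obtain g :: "'x \<Rightarrow> nat" where "\<forall>f\<in>X \<rightarrow>\<^sub>E {..N}. \<forall>f'\<in>X \<rightarrow>\<^sub>E {..N}.
    (\<Sum>x\<in>X. f x * g x) = (\<Sum>x\<in>X. f' x * g x) \<longrightarrow> f = f'" ..
  then have g: "\<And>f f'. f \<in> X \<rightarrow>\<^sub>E {..N} \<Longrightarrow> f' \<in> X \<rightarrow>\<^sub>E {..N} \<Longrightarrow>
    (\<Sum>x\<in>X. f x * g x) = (\<Sum>x\<in>X. f' x * g x) \<Longrightarrow> f = f'" by simp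
  define G where "G = Suc (\<Sum>x\<in>X. N * g x)"
  define g' where "g' = g(y := G)"
  have sm: "(\<Sum>x\<in>insert y X. f x * g' x) = f y * G + (\<Sum>x\<in>X. (restrict f X) x * g x)" for f :: "'x \<Rightarrow> nat"
  proof -
    have "(\<Sum>x\<in>X. f x * g' x) = (\<Sum>x\<in>X. (restrict f X) x * g x)"
      using insert.hyps by (intro sum.cong) (auto simp: g'_def)
    then show ?thesis using insert.hyps by (simp add: g'_def)
  qed
  have lt: "(\<Sum>x\<in>X. (restrict f X) x * g x) < G" if "f \<in> insert y X \<rightarrow>\<^sub>E {..N}" for f
    unfolding G_def less_Suc_eq_le using that by (intro sum_mono mult_right_mono) (auto simp: PiE_def)
  have "f = f'" if f: "f \<in> insert y X \<rightarrow>\<^sub>E {..N}" "f' \<in> insert y X \<rightarrow>\<^sub>E {..N}"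
    and eq: "(\<Sum>x\<in>insert y X. f x * g' x) = (\<Sum>x\<in>insert y X. f' x * g' x)" for f f'
  proof -
    have *: "f y = f' y" "(\<Sum>x\<in>X. (restrict f X) x * g x) = (\<Sum>x\<in>X. (restrict f' X) x * g x)"
      using weighted_sum_unique[OF eq[unfolded sm] lt[OF f(1)] lt[OF f(2)]] by auto
    have "restrict f X = restrict f' X"
      using f by (intro g[OF _ _ *(2)]) (simp_all add: PiE_iff extensional_def)
    with *(1) show "f = f'" by (intro PiE_ext[OF f]) (metis insertE restrict_apply')
  qed
  then show ?case by blast
qed

text \<open>Combining the equations with the coefficients of a polynomial \<open>q\<close> that
  vanishes at all nodes but one isolates a single unknown; \<open>q\<close> has degree below
  \<open>card A\<close>, so a window of that length suffices. The window may start at any time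
  \<open>o1\<close>, because nonzero nodes only contribute the factor
  \<open>\<nu> s ^ o1\<close>.\<close>

lemma vandermonde:
  fixes \<nu> l :: "'s \<Rightarrow> complex"
  assumes "finite A" "inj_on \<nu> A" "\<And>s. s \<in> A \<Longrightarrow> \<nu> s \<noteq> 0"
    and z: "\<And>t. o1 \<le> t \<Longrightarrow> t < o1 + card A \<Longrightarrow> (\<Sum>s\<in>A. l s * \<nu> s ^ t) = 0"
    and "s \<in> A"
  shows "l s = 0"
proof -
  define q where "q = (\<Prod>s'\<in>A - {s}. [:- \<nu> s', 1:])"
  have "degree q \<le> sum (degree \<circ> (\<lambda>s'. [:- \<nu> s', 1:])) (A - {s})"
    unfolding q_def using assms(1) by (intro degree_prod_sum_le) auto
  also have "\<dots> = card A - 1" using assms(1,5) by (simp add: card_Diff_singleton)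
  finally have dq: "degree q < card A" using assms(1,5) card_gt_0_iff[of A] by auto
  have "(\<Sum>s'\<in>A. l s' * \<nu> s' ^ o1 * poly q (\<nu> s')) = (\<Sum>s'\<in>A. \<Sum>i\<le>degree q. coeff q i * (l s' * \<nu> s' ^ (o1 + i)))"
    unfolding poly_altdef sum_distrib_left by (intro sum.cong refl) (auto simp: algebra_simps power_add)
  also have "\<dots> = (\<Sum>i\<le>degree q. coeff q i * (\<Sum>s'\<in>A. l s' * \<nu> s' ^ (o1 + i)))"
    by (subst sum.swap) (simp add: sum_distrib_left)
  also have "\<dots> = 0" using dq by (intro sum.neutral) (auto intro!: z)
  finally have 0: "(\<Sum>s'\<in>A. l s' * \<nu> s' ^ o1 * poly q (\<nu> s')) = 0" .
  have "poly q (\<nu> s') = 0" if "s' \<in> A - {s}" for s'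
    using that assms(1) by (auto simp: q_def poly_prod)
  then have "(\<Sum>s'\<in>A. l s' * \<nu> s' ^ o1 * poly q (\<nu> s')) = l s * \<nu> s ^ o1 * poly q (\<nu> s)"
    using assms(1,5) by (simp add: sum.remove[of A s])
  moreover have "poly q (\<nu> s) \<noteq> 0"
    using assms(1,2,5) by (auto simp: q_def poly_prod inj_on_def)
  ultimately show ?thesis using 0 assms(3,5) by auto
qed

text \<open>The windows are laid end to end from \<open>s0\<close> on. They separate the desired
  transmitters in time at the test channel, and the slots before \<open>s0\<close> are left to the
  interference.\<close>

lemma disjoint_intervals:
  fixes n :: "'k \<Rightarrow> nat"
  assumes "finite D"
  shows "\<exists>o1. (\<forall>k\<in>D. s0 \<le> o1 k \<and> o1 k + n k \<le> s0 + sum n D) \<and>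
     disjoint_family_on (\<lambda>k. {o1 k..<o1 k + n k}) D"
  using assms
proof (induction D rule: finite_induct)
  case empty
  then show ?case by (auto simp: disjoint_family_on_def)
next
  case (insert k D)
  then obtain o1 where o1: "\<forall>k\<in>D. s0 \<le> o1 k \<and> o1 k + n k \<le> s0 + sum n D"
    "disjoint_family_on (\<lambda>k. {o1 k..<o1 k + n k}) D" by blast
  let ?o = "o1(k := s0 + sum n D)"
  have "disjoint_family_on (\<lambda>k. {?o k..<?o k + n k}) (insert k D)"
    using o1 insert.hyps(2) unfolding disjoint_family_on_def by (auto; fastforce)
  moreover have "\<forall>k'\<in>insert k D. s0 \<le> ?o k' \<and> ?o k' + n k' \<le> s0 + sum n (insert k D)"
    using o1(1) insert.hyps by (auto intro: trans_le_add2 order_trans)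
  ultimately show ?case by blast
qed

section \<open>Interference alignment\<close>

text \<open>Time is left out of the index: a beam uses the same exponents in every slot, with the
  gains of that slot.\<close>

definition interfering_links :: "'r set \<Rightarrow> ('r \<Rightarrow> 'k set) \<Rightarrow> ('r \<times> 'm \<times> 'k \<times> 'm) set" where
  "interfering_links S demand = {(j, a, i, b). j \<in> S \<and> i \<notin> demand j}"

lemma finite_interfering_links: "finite (interfering_links S demand :: ('r::finite \<times> 'm::finite \<times> 'k::finite \<times> 'm) set)"
  by (rule finite_subset[OF subset_UNIV]) simp

type_synonym ('r, 'k, 'm) beam_id = "nat \<times> ('r \<times> 'm \<times> 'k \<times> 'm \<Rightarrow> nat)"

text \<open>Streams are sent with exponents below \<open>N\<close>, and interference is received
  with exponents below \<open>Suc N\<close>. Both counts grow like \<open>N ^ card X\<close>, so for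
  large \<open>N\<close> all interferers together occupy hardly more room than the one with the most
  streams.\<close>

definition stream_index :: "'x set \<Rightarrow> nat \<Rightarrow> nat \<Rightarrow> (nat \<times> ('x \<Rightarrow> nat)) set" where
  "stream_index X c N = {..<c} \<times> (X \<rightarrow>\<^sub>E {..<N})"

lemma finite_stream_index: "finite X \<Longrightarrow> finite (stream_index X c N)"
  by (simp add: stream_index_def finite_PiE)

lemma card_stream_index: "finite X \<Longrightarrow> card (stream_index X c N) = c * N ^ card X"
  by (simp add: stream_index_def card_cartesian_product card_PiE)

text \<open>
  The time-dependent factor \<open>2 ^ (g0 * e * t)\<close> plays the role of one more monomial
  variable, which makes it possible to give different numbers of stream_index to the transmitters.
\<close>

definition beam :: "('r \<times> 'm \<times> 'k \<times> 'm) set \<Rightarrow> nat \<Rightarrow> ('r, 'k, 'm) beam_id \<Rightarrow> nat \<Rightarrow>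
    ('r::finite, 'k::finite, 'm::finite) csi \<Rightarrow> complex" where
  "beam X g0 s t h = 2 ^ (g0 * fst s * t) * (\<Prod>(j, a, i, b)\<in>X. h (t, j, i, a, b) ^ snd s (j, a, i, b))"

lemma sep_poly_beam:
  assumes "X \<subseteq> {(j, a, i, b). j \<in> S}" "t < T"
  shows "sep_poly ({..<T} \<times> S \<times> UNIV \<times> UNIV \<times> UNIV) (beam X g0 s t)"
  unfolding beam_def[abs_def] using assms
  by (intro sep_poly_mult sep_poly_const sep_poly_prod) (auto intro!: sep_poly_power sep_poly_coord)

text \<open>This is the alignment: an interfering link only raises its own exponent by one, so all
  interferers land in one common family of beams at each receive antenna.\<close>

lemma beam_shift:
  assumes "finite X" "(j, a, i, b) \<in> X"
  shows "h (t, j, i, a, b) * beam X g0 (e, f) t h = beam X g0 (e, f((j, a, i, b) := Suc (f (j, a, i, b)))) t h"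
proof -
  let ?y = "(j, a, i, b)"
  have "(\<Prod>(j', a', i', b')\<in>X - {?y}. h (t, j', i', a', b') ^ (f(?y := Suc (f ?y))) (j', a', i', b'))
      = (\<Prod>(j', a', i', b')\<in>X - {?y}. h (t, j', i', a', b') ^ f (j', a', i', b'))"
    by (intro prod.cong) (auto split: prod.splits)
  then show ?thesis
    using assms unfolding beam_def by (simp add: prod.remove[of X ?y] algebra_simps)
qed

text \<open>Independence of the full family provides both hypotheses of
  \<open>annihilating_row\<close>: giving \<open>c1\<close> the coefficient 0 or -1 turns a relation
  on \<open>C\<close>, or a representation of \<open>c1\<close> by \<open>C\<close>, into a relation
  of the full family.\<close>

lemma annihilating_row_insert:
  assumes "finite C" "finite R" "c1 \<notin> C"
    and "\<And>c r. c \<in> insert c1 C \<Longrightarrow> r \<in> R \<Longrightarrow> sep_poly I (a c r)"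
    and indep: "\<And>l. (\<And>r. r \<in> R \<Longrightarrow> (\<Sum>c\<in>insert c1 C. l c * a c r h0) = 0) \<Longrightarrow> \<forall>c\<in>insert c1 C. l c = 0"
  obtains g where "\<And>r. r \<in> R \<Longrightarrow> sep_poly I (g r)"
    "\<And>c h. c \<in> C \<Longrightarrow> (\<Sum>r\<in>R. g r h * a c r h) = 0"
    "(\<Sum>r\<in>R. g r h0 * a c1 r h0) \<noteq> 0"
proof -
  have upd: "(\<Sum>c\<in>C. (l(c1 := u)) c * a c r h0) = (\<Sum>c\<in>C. l c * a c r h0)" for r l u
    using assms(3) by (intro sum.cong) auto
  show ?thesis
  proof (rule annihilating_row[of C R I a "a c1" h0])
    show "\<forall>c\<in>C. l c = 0" if "\<And>r. r \<in> R \<Longrightarrow> (\<Sum>c\<in>C. l c * a c r h0) = 0" for l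
    proof -
      have "\<forall>c\<in>insert c1 C. (l(c1 := 0)) c = 0"
        using that upd assms(1,3) by (intro indep) simp
      then show ?thesis using assms(3) by (metis fun_upd_other insertCI)
    qed
    show "\<exists>r\<in>R. a c1 r h0 \<noteq> (\<Sum>c\<in>C. l c * a c r h0)" for l
    proof (rule ccontr)
      assume "\<not> ?thesis"
      then have "\<forall>c\<in>insert c1 C. (l(c1 := -1)) c = 0"
        using upd assms(1,3) by (intro indep) simp
      then show False by (auto dest: bspec[of _ _ c1])
    qed
  qed (use assms(1,2,4) that in blast)+
qed

text \<open>
  Independence of the received directions is checked at one point: the interfering gains are
  geometric in time, and every slot carries either no desired signal or, through an identity
  matrix, exactly one desired transmitter. Both kinds of slots give Vandermonde systems.
\<close>

lemma zero_forcing_filter: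
  fixes S :: "'r::finite set" and demand :: "'r \<Rightarrow> 'k::finite set" and c :: "'k \<Rightarrow> nat"
  defines "X \<equiv> interfering_links S demand :: ('r \<times> 'm::finite \<times> 'k \<times> 'm) set"
  defines "I T \<equiv> {..<T} \<times> S \<times> (UNIV :: 'k set) \<times> (UNIV :: 'm set) \<times> (UNIV :: 'm set)"
  assumes g0: "\<And>e f e' f'. f \<in> X \<rightarrow>\<^sub>E {..N} \<Longrightarrow> f' \<in> X \<rightarrow>\<^sub>E {..N} \<Longrightarrow>
      g0 * e + (\<Sum>x\<in>X. f x * gx x) = g0 * e' + (\<Sum>x\<in>X. f' x * gx x) \<Longrightarrow> e = e' \<and> f = f'"
    and j: "j \<in> S" and cm: "\<And>i. i \<notin> demand j \<Longrightarrow> c i \<le> cm"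
    and T: "(\<Sum>k\<in>demand j. card (stream_index X (c k) N)) + card (stream_index X cm (Suc N)) \<le> T"
    and k: "k \<in> demand j" and s: "s \<in> stream_index X (c k) N"
  obtains g d h0 where "\<And>t a. t < T \<Longrightarrow> sep_poly (I T) (g t a)" "sep_poly (I T) d" "d (restrict h0 (I T)) \<noteq> 0"
    "\<And>h sym. (\<Sum>t<T. \<Sum>a\<in>UNIV. g t a h * (\<Sum>k'\<in>UNIV. \<Sum>b'\<in>UNIV. h (t, j, k', a, b') *
        (\<Sum>s'\<in>stream_index X (c k') N. beam X g0 s' t h * sym k' b' s'))) = d h * sym k (b :: 'm) s"
proof -
  have finX: "finite X" unfolding X_def by (rule finite_interfering_links)
  note finS = finite_stream_index[OF finX]
  define nI where "nI = card (stream_index X cm (Suc N))"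
  obtain o1 where o1: "\<forall>k\<in>demand j. nI \<le> o1 k \<and> o1 k + card (stream_index X (c k) N) \<le> nI + (\<Sum>k\<in>demand j. card (stream_index X (c k) N))"
    "disjoint_family_on (\<lambda>k. {o1 k..<o1 k + card (stream_index X (c k) N)}) (demand j)"
    using disjoint_intervals[of "demand j" nI "\<lambda>k. card (stream_index X (c k) N)"] by auto
  \<comment> \<open>At the test channel the beam \<open>s\<close> at time \<open>t\<close> equals
    \<open>\<nu> s ^ t\<close>. By the hypothesis on \<open>g0\<close> and \<open>gx\<close>,
    distinct streams have distinct ratios.\<close>
  define \<nu> :: "('r, 'k, 'm) beam_id \<Rightarrow> complex"
    where "\<nu> s = 2 ^ (g0 * fst s + (\<Sum>x\<in>X. snd s x * gx x))" for s
  \<comment> \<open>The test channel: interfering links are geometric in time, and every other link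
    is an identity matrix inside the window given by \<open>o1\<close> and zero outside. The first
    \<open>nI\<close> slots precede the windows of all messages requested by
    \<open>j\<close>.\<close>
  define h1 :: "('r, 'k, 'm) csi" where
    "h1 = (\<lambda>(t, j', i, a, b). if (j', a, i, b) \<in> X then 2 ^ (gx (j', a, i, b) * t)
       else if a = b \<and> t \<in> {o1 i..<o1 i + card (stream_index X (c i) N)} then 1 else 0)"
  define h0 where "h0 = restrict h1 (I T)"
  have XS: "X \<subseteq> {(j, a, i, b). j \<in> S}" by (auto simp: X_def interfering_links_def)
  have \<nu>_inj: "inj_on \<nu> (stream_index X n (Suc N))" for n
  proof (rule inj_onI)
    fix s s' assume ss: "s \<in> stream_index X n (Suc N)" "s' \<in> stream_index X n (Suc N)" "\<nu> s = \<nu> s'"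
    have "g0 * fst s + (\<Sum>x\<in>X. snd s x * gx x) = g0 * fst s' + (\<Sum>x\<in>X. snd s' x * gx x)"
    proof -
      have "(2::complex) ^ m = 2 ^ n \<longleftrightarrow> m = n" for m n :: nat
      proof -
        have "(2::complex) ^ m = of_nat (2 ^ m)" "(2::complex) ^ n = of_nat (2 ^ n)" by simp_all
        then show ?thesis by (metis of_nat_eq_iff power_inject_exp one_less_numeral_iff semiring_norm(76))
      qed
      with ss(3) show ?thesis by (simp add: \<nu>_def)
    qed
    with ss(1,2) show "s = s'" using g0[of "snd s" "snd s'" "fst s" "fst s'"]
      by (auto simp: stream_index_def lessThan_Suc_atMost prod_eq_iff)
  qed
  have sub: "stream_index X n N \<subseteq> stream_index X n (Suc N)" for n unfolding stream_index_def by (intro Sigma_mono subset_refl PiE_mono) auto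
  have \<nu>0: "\<nu> s \<noteq> 0" for s by (simp add: \<nu>_def)
  have beam0: "beam X g0 s t h0 = \<nu> s ^ t" if "t < T" for s t
  proof -
    have "(\<Prod>(j, a, i, b)\<in>X. h0 (t, j, i, a, b) ^ snd s (j, a, i, b)) = (\<Prod>x\<in>X. 2 ^ (snd s x * gx x * t))"
      using that XS by (intro prod.cong)
        (auto simp: h0_def h1_def I_def power_mult[symmetric] mult.commute mult.left_commute)
    also have "\<dots> = 2 ^ ((\<Sum>x\<in>X. snd s x * gx x) * t)"
      by (simp add: power_sum sum_distrib_right)
    finally show ?thesis
      unfolding beam_def \<nu>_def by (simp add: power_mult[symmetric] power_add[symmetric] algebra_simps)
  qed
  define R where "R = {..<T} \<times> (UNIV :: 'm set)"
  define Des where "Des = Sigma (demand j) (\<lambda>k. (UNIV :: 'm set) \<times> stream_index X (c k) N)"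
  \<comment> \<open>Because interferers share their beams, one column per receive antenna and common
    beam covers all of them, whatever their number; this is what the bound on \<open>T\<close>
    counts.\<close>
  define Itf where "Itf = (UNIV :: 'm set) \<times> stream_index X cm (Suc N)"
  define col where "col = (\<lambda>(k, b, s) (t, a) (h :: ('r, 'k, 'm) csi). h (t, j, k, a, b) * beam X g0 s t h)"
  define A where "A = case_sum col (\<lambda>(a', s) (t, a) h. if a = a' then beam X g0 s t h else 0)"
  have fin: "finite Des" "finite Itf" "finite R"
    using finS by (auto simp: Des_def Itf_def R_def)
  have spbeam: "t < T \<Longrightarrow> sep_poly (I T) (beam X g0 s t)" for s t
    unfolding I_def by (rule sep_poly_beam[OF XS])
  have spcol: "sep_poly (I T) (col u r)" if "r \<in> R" for u r
  proof -
    obtain t a k b s where tu: "r = (t, a)" "u = (k, b, s)" by (cases r; cases u)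
    have t: "t < T" and "(t, j, k, a, b) \<in> I T" using that j by (auto simp: R_def tu I_def)
    then show ?thesis unfolding col_def tu by (auto intro!: sep_poly_mult spbeam sep_poly_coord)
  qed
  have spA: "sep_poly (I T) (A u r)" if "r \<in> R" for u r
  proof (cases u)
    case (Inl v) then show ?thesis using spcol[OF that] by (simp add: A_def)
  next
    case (Inr v)
    obtain t a a' s where tu: "r = (t, a)" "v = (a', s)" by (cases r; cases v)
    then have "t < T" using that by (simp add: R_def)
    then show ?thesis by (cases "a = a'") (simp_all add: A_def Inr tu spbeam sep_poly_const)
  qed
  have indep: "\<forall>u\<in>Des <+> Itf. l u = 0" if l: "\<And>r. r \<in> R \<Longrightarrow> (\<Sum>u\<in>Des <+> Itf. l u * A u r h0) = 0" for l
  proof -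
    have row: "(\<Sum>u\<in>Des. l (Inl u) * col u (t, a) h0) + (\<Sum>s\<in>stream_index X cm (Suc N). l (Inr (a, s)) * \<nu> s ^ t) = 0"
      if t: "t < T" for t a
    proof -
      have "(\<Sum>u\<in>Itf. l (Inr u) * A (Inr u) (t, a) h0) = (\<Sum>a'\<in>UNIV. if a = a' then \<Sum>s\<in>stream_index X cm (Suc N). l (Inr (a, s)) * \<nu> s ^ t else 0)"
        unfolding Itf_def sum.cartesian_product'
        by (intro sum.cong refl) (auto simp: A_def beam0[OF t] intro!: sum.neutral)
      also have "\<dots> = (\<Sum>s\<in>stream_index X cm (Suc N). l (Inr (a, s)) * \<nu> s ^ t)" by simp
      finally have 1: "(\<Sum>u\<in>Itf. l (Inr u) * A (Inr u) (t, a) h0) = \<dots>" .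
      have "0 = (\<Sum>u\<in>Des <+> Itf. l u * A u (t, a) h0)" using l[of "(t, a)"] t by (simp add: R_def)
      also have "\<dots> = (\<Sum>u\<in>Des. l (Inl u) * A (Inl u) (t, a) h0) + (\<Sum>u\<in>Itf. l (Inr u) * A (Inr u) (t, a) h0)"
        using fin by (simp add: sum.Plus comp_def)
      finally show ?thesis unfolding 1 by (simp add: A_def)
    qed
    have colz: "col (k', b', s') (t, a) h0 = (if a = b' \<and> t \<in> {o1 k'..<o1 k' + card (stream_index X (c k') N)} then \<nu> s' ^ t else 0)"
      if "k' \<in> demand j" "t < T" for k' b' s' t a
    proof -
      have "(j, a, k', b') \<notin> X" using that by (auto simp: X_def interfering_links_def)
      then have "h0 (t, j, k', a, b') = (if a = b' \<and> t \<in> {o1 k'..<o1 k' + card (stream_index X (c k') N)} then 1 else 0)"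
        using that(2) j by (simp add: h0_def h1_def I_def)
      then show ?thesis by (simp add: col_def beam0[OF that(2)])
    qed
    \<comment> \<open>Before the windows only interference is present, which leaves one Vandermonde
      system per receive antenna.\<close>
    have lint: "l (Inr (a, s)) = 0" if "s \<in> stream_index X cm (Suc N)" for a s
    proof (rule vandermonde[of "stream_index X cm (Suc N)" \<nu> 0 "\<lambda>s. l (Inr (a, s))", OF finS \<nu>_inj \<nu>0 _ that])
      fix t assume "t < 0 + card (stream_index X cm (Suc N))"
      then have t: "t < nI" "t < T" using T by (auto simp: nI_def)
      have "(\<Sum>u\<in>Des. l (Inl u) * col u (t, a) h0) = 0"
        using t o1(1) by (intro sum.neutral) (force simp: Des_def colz)
      with row[OF t(2), of a] show "(\<Sum>s\<in>stream_index X cm (Suc N). l (Inr (a, s)) * \<nu> s ^ t) = 0" by simp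
    qed
    \<comment> \<open>With the interference coefficients gone, a slot in the window of
      \<open>k'\<close> shows only transmitter \<open>k'\<close>, and receive antenna
      \<open>b'\<close> sees only its transmit antenna \<open>b'\<close>.\<close>
    have ldes: "l (Inl (k', b', s')) = 0" if k': "k' \<in> demand j" and s': "s' \<in> stream_index X (c k') N" for k' b' s'
    proof (rule vandermonde[of "stream_index X (c k') N" \<nu> "o1 k'" "\<lambda>s. l (Inl (k', b', s))", OF finS _ \<nu>0 _ s'])
      show "inj_on \<nu> (stream_index X (c k') N)" using \<nu>_inj sub by (rule inj_on_subset)
      fix t assume t: "o1 k' \<le> t" "t < o1 k' + card (stream_index X (c k') N)"
      have tT: "t < T" using t o1(1) k' T by (fastforce simp: nI_def)
      have other: "t \<notin> {o1 k2..<o1 k2 + card (stream_index X (c k2) N)}" if "k2 \<in> demand j" "k2 \<noteq> k'" for k2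
        using o1(2) that k' t unfolding disjoint_family_on_def by fastforce
      have "(\<Sum>u\<in>Des. l (Inl u) * col u (t, b') h0)
          = (\<Sum>k2\<in>demand j. \<Sum>u\<in>UNIV \<times> stream_index X (c k2) N. l (Inl (k2, u)) * col (k2, u) (t, b') h0)"
        unfolding Des_def using finS by (subst sum.Sigma) (auto simp: split_beta)
      also have "\<dots> = (\<Sum>k2\<in>demand j. if k2 = k' then \<Sum>s\<in>stream_index X (c k') N. l (Inl (k', b', s)) * \<nu> s ^ t else 0)"
      proof (intro sum.cong refl)
        fix k2 assume k2: "k2 \<in> demand j"
        show "(\<Sum>u\<in>UNIV \<times> stream_index X (c k2) N. l (Inl (k2, u)) * col (k2, u) (t, b') h0)
          = (if k2 = k' then \<Sum>s\<in>stream_index X (c k') N. l (Inl (k', b', s)) * \<nu> s ^ t else 0)"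
        proof (cases "k2 = k'")
          case False
          then show ?thesis using other[OF k2 False] by (auto simp: colz[OF k2 tT] intro!: sum.neutral)
        next
          case True
          have "(\<Sum>u\<in>UNIV \<times> stream_index X (c k') N. l (Inl (k', u)) * col (k', u) (t, b') h0)
            = (\<Sum>b2\<in>UNIV. if b' = b2 then \<Sum>s\<in>stream_index X (c k') N. l (Inl (k', b', s)) * \<nu> s ^ t else 0)"
            unfolding sum.cartesian_product' using t
            by (intro sum.cong refl) (auto simp: colz[OF k' tT] intro!: sum.neutral)
          then show ?thesis using True by simp
        qed
      qed
      also have "\<dots> = (\<Sum>s\<in>stream_index X (c k') N. l (Inl (k', b', s)) * \<nu> s ^ t)"
        using k' by simp
      finally show "(\<Sum>s\<in>stream_index X (c k') N. l (Inl (k', b', s)) * \<nu> s ^ t) = 0"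
        using row[OF tT, of b'] lint by simp
    qed
    show ?thesis using lint ldes by (auto simp: Des_def Itf_def)
  qed
  \<comment> \<open>The filter of one stream treats the other desired streams like interference; its
    value on its own column becomes the denominator \<open>d\<close>.\<close>
  define tgt where "tgt = (Inl (k, b, s) :: _ + 'm \<times> ('r, 'k, 'm) beam_id)"
  have tgt: "tgt \<in> Des <+> Itf" using k s by (auto simp: tgt_def Des_def)
  then have ins: "insert tgt (Des <+> Itf - {tgt}) = Des <+> Itf" by auto
  obtain g where g: "\<And>r. r \<in> R \<Longrightarrow> sep_poly (I T) (g r)"
    "\<And>u h. u \<in> Des <+> Itf - {tgt} \<Longrightarrow> (\<Sum>r\<in>R. g r h * A u r h) = 0"
    "(\<Sum>r\<in>R. g r h0 * A tgt r h0) \<noteq> 0"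
    by (rule annihilating_row_insert[of "Des <+> Itf - {tgt}" R tgt "I T" A h0])
       (use fin spA indep ins in auto)
  define d where "d h = (\<Sum>r\<in>R. g r h * A tgt r h)" for h
  have kill: "(\<Sum>r\<in>R. g r h * col (k', b', s') r h) = (if (k', b', s') = (k, b, s) then d h else 0)"
    if s': "s' \<in> stream_index X (c k') N" for k' b' s' h
  proof (cases "k' \<in> demand j")
    case True
    show ?thesis
    proof (cases "(k', b', s') = (k, b, s)")
      case True then show ?thesis by (simp add: d_def tgt_def A_def)
    next
      case False
      then have "Inl (k', b', s') \<in> Des <+> Itf - {tgt}" using True s' by (auto simp: Des_def tgt_def)
      from g(2)[OF this] False show ?thesis by (auto simp: A_def)
    qed
  next
    case False
    obtain e f where ef: "s' = (e, f)" by (cases s')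
    \<comment> \<open>The column of an undesired stream is not itself a column of \<open>A\<close>.
      On antenna \<open>a\<close> it is the common beam in which the exponent of the link into
      \<open>a\<close> is raised, so it is a sum over the antennas of columns that the filter
      kills.\<close>
    define sh where "sh a = (e, f((j, a, k', b') := Suc (f (j, a, k', b'))))" for a
    have inX: "(j, a, k', b') \<in> X" for a using False j by (simp add: X_def interfering_links_def)
    have shs: "sh a \<in> stream_index X cm (Suc N)" for a
      using s' cm[OF False] inX unfolding sh_def ef stream_index_def by (fastforce simp: PiE_iff extensional_def)
    have "(\<Sum>r\<in>R. g r h * col (k', b', s') r h) = (\<Sum>r\<in>R. \<Sum>a'\<in>UNIV. g r h * A (Inr (a', sh a')) r h)"
    proof (intro sum.cong refl)
      fix r assume "r \<in> R"
      obtain t a where r: "r = (t, a)" by (cases r)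
      have "A (Inr (a', sh a')) r h = (if a = a' then col (k', b', s') r h else 0)" for a'
        unfolding r A_def col_def ef sh_def using beam_shift[OF finX inX] by auto
      then have "(\<Sum>a'\<in>UNIV. g r h * A (Inr (a', sh a')) r h) = (\<Sum>a'\<in>UNIV. if a = a' then g r h * col (k', b', s') r h else 0)"
        by (intro sum.cong) auto
      also have "\<dots> = g r h * col (k', b', s') r h" by simp
      finally show "g r h * col (k', b', s') r h = (\<Sum>a'\<in>UNIV. g r h * A (Inr (a', sh a')) r h)" ..
    qed
    also have "\<dots> = (\<Sum>a'\<in>UNIV. \<Sum>r\<in>R. g r h * A (Inr (a', sh a')) r h)" by (rule sum.swap)
    also have "\<dots> = 0"
      using shs by (intro sum.neutral ballI g(2)) (auto simp: Itf_def tgt_def)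
    finally show ?thesis using False k by auto
  qed
  have tot: "(\<Sum>t<T. \<Sum>a\<in>UNIV. g (t, a) h * (\<Sum>k'\<in>UNIV. \<Sum>b'\<in>UNIV. h (t, j, k', a, b') *
        (\<Sum>s'\<in>stream_index X (c k') N. beam X g0 s' t h * sym k' b' s'))) = d h * sym k b s" for h sym
  proof -
    have "(\<Sum>t<T. \<Sum>a\<in>UNIV. g (t, a) h * (\<Sum>k'\<in>UNIV. \<Sum>b'\<in>UNIV. h (t, j, k', a, b') *
        (\<Sum>s'\<in>stream_index X (c k') N. beam X g0 s' t h * sym k' b' s')))
      = (\<Sum>r\<in>R. \<Sum>k'\<in>UNIV. \<Sum>b'\<in>UNIV. \<Sum>s'\<in>stream_index X (c k') N. sym k' b' s' * (g r h * col (k', b', s') r h))"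
      unfolding R_def sum.cartesian_product'
      by (intro sum.cong refl) (simp add: col_def sum_distrib_left algebra_simps)
    also have "\<dots> = (\<Sum>k'\<in>UNIV. \<Sum>b'\<in>UNIV. \<Sum>s'\<in>stream_index X (c k') N. \<Sum>r\<in>R. sym k' b' s' * (g r h * col (k', b', s') r h))"
    proof -
      have "(\<Sum>r\<in>R. \<Sum>k'\<in>UNIV. \<Sum>b'\<in>UNIV. \<Sum>s'\<in>stream_index X (c k') N. F r k' b' s') =
        (\<Sum>k'\<in>UNIV. \<Sum>b'\<in>UNIV. \<Sum>s'\<in>stream_index X (c k') N. \<Sum>r\<in>R. F r k' b' s')" for F :: "_ \<Rightarrow> 'k \<Rightarrow> 'm \<Rightarrow> _ \<Rightarrow> complex"
        by (subst sum.swap, intro sum.cong refl, subst sum.swap, intro sum.cong refl, rule sum.swap)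
      then show ?thesis .
    qed
    also have "\<dots> = (\<Sum>k'\<in>UNIV. \<Sum>b'\<in>UNIV. \<Sum>s'\<in>stream_index X (c k') N. sym k' b' s' * (if (k', b', s') = (k, b, s) then d h else 0))"
      by (intro sum.cong refl) (simp add: sum_distrib_left[symmetric] kill)
    also have "\<dots> = (\<Sum>k'\<in>UNIV. \<Sum>b'\<in>UNIV. if b' = b then if k' = k then sym k b s * d h else 0 else 0)"
    proof (intro sum.cong refl)
      fix k' b'
      show "(\<Sum>s'\<in>stream_index X (c k') N. sym k' b' s' * (if (k', b', s') = (k, b, s) then d h else 0))
        = (if b' = b then if k' = k then sym k b s * d h else 0 else 0)"
      proof (cases "k' = k \<and> b' = b")
        case True
        have "(\<Sum>s'\<in>stream_index X (c k) N. sym k b s' * (if s' = s then d h else 0)) =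
          (\<Sum>s'\<in>stream_index X (c k) N. if s' = s then sym k b s * d h else 0)" by (intro sum.cong) auto
        then show ?thesis using True s finS by simp
      qed auto
    qed
    also have "\<dots> = sym k b s * d h" by simp
    finally show ?thesis by (simp add: mult.commute)
  qed
  have spd: "sep_poly (I T) d"
    unfolding d_def[abs_def] using g(1) spA by (intro sep_poly_sum sep_poly_mult) auto
  show ?thesis
  proof (rule that[of "\<lambda>t a. g (t, a)" d h1])
    show "d (restrict h1 (I T)) \<noteq> 0" using g(3) by (simp add: d_def h0_def)
  qed (use g(1) spd tot in \<open>auto simp: R_def\<close>)
qed

section \<open>Independent blocks in product spaces\<close>

lemma prob_space_PiM_const: "prob_space \<mu> \<Longrightarrow> prob_space (PiM K (\<lambda>_. \<mu>))"
  by (simp add: prob_space_PiM)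

lemma product_sigma_finite_const: "prob_space \<mu> \<Longrightarrow> product_sigma_finite (\<lambda>_. \<mu>)"
  by (simp add: product_sigma_finite_def prob_space_imp_sigma_finite)

lemma distr_PiM_const_reindex:
  assumes "prob_space \<mu>" "inj_on f I" "f ` I \<subseteq> K"
  shows "distr (PiM K (\<lambda>_. \<mu>)) (PiM I (\<lambda>_. \<mu>)) (\<lambda>x. \<lambda>i\<in>I. x (f i)) = PiM I (\<lambda>_. \<mu>)"
  using distr_PiM_reindex[of K "\<lambda>_. \<mu>" f I] assms by auto

lemma measurable_reindex:
  assumes "f ` I \<subseteq> K"
  shows "(\<lambda>x. \<lambda>i\<in>I. x (f i)) \<in> measurable (PiM K (\<lambda>_. \<mu>)) (PiM I (\<lambda>_. \<mu>))"
  using assms by (intro measurable_restrict measurable_component_singleton) auto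

lemma nn_integral_reindex:
  assumes "prob_space \<mu>" "inj_on f I" "f ` I \<subseteq> K" "F \<in> borel_measurable (PiM I (\<lambda>_. \<mu>))"
  shows "(\<integral>\<^sup>+ x. F (\<lambda>i\<in>I. x (f i)) \<partial>PiM K (\<lambda>_. \<mu>)) = (\<integral>\<^sup>+ x. F x \<partial>PiM I (\<lambda>_. \<mu>))"
  using nn_integral_distr[OF measurable_reindex[OF assms(3), of \<mu>], of F] assms(4)
  by (simp add: distr_PiM_const_reindex[OF assms(1-3)])

text \<open>Disjoint blocks of an i.i.d. family are independent. Fubini splits off the coordinates
  of one block and the induction continues on the remaining index set, which is why \<open>K\<close>
  varies in it.\<close>

lemma nn_integral_prod_blocks:
  assumes \<mu>: "prob_space \<mu>" and "finite Bs" "finite K"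
    and "\<And>\<beta>. \<beta> \<in> Bs \<Longrightarrow> inj_on (\<sigma> \<beta>) Y" "\<And>\<beta>. \<beta> \<in> Bs \<Longrightarrow> \<sigma> \<beta> ` Y \<subseteq> K"
    and "disjoint_family_on (\<lambda>\<beta>. \<sigma> \<beta> ` Y) Bs"
    and f[measurable]: "f \<in> borel_measurable (PiM Y (\<lambda>_. \<mu>))"
  shows "(\<integral>\<^sup>+ x. (\<Prod>\<beta>\<in>Bs. f (\<lambda>y\<in>Y. x (\<sigma> \<beta> y))) \<partial>PiM K (\<lambda>_. \<mu>))
    = (\<integral>\<^sup>+ x. f x \<partial>PiM Y (\<lambda>_. \<mu>)) ^ card Bs"
  using assms(2-6)
proof (induction Bs arbitrary: K rule: finite_induct)
  case empty
  interpret prob_space "PiM K (\<lambda>_. \<mu>)" by (rule prob_space_PiM_const[OF \<mu>])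
  show ?case by (simp add: emeasure_space_1)
next
  case (insert b Bs)
  interpret product_sigma_finite "\<lambda>_. \<mu>" by (rule product_sigma_finite_const[OF \<mu>])
  define J where "J = \<sigma> b ` Y"
  have JK: "J \<subseteq> K" using insert.prems(3) by (auto simp: J_def)
  then have fJ: "finite J" using insert.prems(1) finite_subset by blast
  have dj: "\<sigma> \<beta> ` Y \<subseteq> K - J" if "\<beta> \<in> Bs" for \<beta>
  proof -
    have "\<sigma> \<beta> ` Y \<inter> \<sigma> b ` Y = {}"
      using insert.prems(4) insert.hyps(2) that unfolding disjoint_family_on_def by (metis insert_iff)
    then show ?thesis using insert.prems(3)[of \<beta>] that by (auto simp: J_def)
  qed
  have K: "(K - J) \<union> J = K" using JK by auto
  have m[measurable]: "(\<lambda>x. f (\<lambda>y\<in>Y. x (\<sigma> \<beta> y))) \<in> borel_measurable (PiM K' (\<lambda>_. \<mu>))" if "\<sigma> \<beta> ` Y \<subseteq> K'" for \<beta> K'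
    by (rule measurable_compose[OF measurable_reindex[OF that] f])
  have mp: "(\<lambda>x. \<Prod>\<beta>\<in>insert b Bs. f (\<lambda>y\<in>Y. x (\<sigma> \<beta> y))) \<in> borel_measurable (PiM K (\<lambda>_. \<mu>))"
    using insert.prems(3) by (intro borel_measurable_prod_ennreal m) auto
  have mp1: "(\<lambda>x. \<Prod>\<beta>\<in>Bs. f (\<lambda>y\<in>Y. x (\<sigma> \<beta> y))) \<in> borel_measurable (PiM (K - J) (\<lambda>_. \<mu>))"
    using dj by (intro borel_measurable_prod_ennreal m) auto
  have mg: "(\<lambda>y\<in>Y. merge (K - J) J (x, z) (\<sigma> \<beta> y)) = (\<lambda>y\<in>Y. x (\<sigma> \<beta> y))" if "\<beta> \<in> Bs" for x z \<beta>
    using dj[OF that] by (auto simp: merge_def restrict_def fun_eq_iff)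
  have mgb: "(\<lambda>y\<in>Y. merge (K - J) J (x, z) (\<sigma> b y)) = (\<lambda>y\<in>Y. z (\<sigma> b y))" for x z
    by (auto simp: merge_def restrict_def fun_eq_iff J_def)
  have "(\<integral>\<^sup>+ x. (\<Prod>\<beta>\<in>insert b Bs. f (\<lambda>y\<in>Y. x (\<sigma> \<beta> y))) \<partial>PiM K (\<lambda>_. \<mu>))
    = (\<integral>\<^sup>+ x. (\<integral>\<^sup>+ z. (\<Prod>\<beta>\<in>insert b Bs. f (\<lambda>y\<in>Y. merge (K - J) J (x, z) (\<sigma> \<beta> y))) \<partial>PiM J (\<lambda>_. \<mu>)) \<partial>PiM (K - J) (\<lambda>_. \<mu>))"
    using product_nn_integral_fold[of "K - J" J "\<lambda>x. \<Prod>\<beta>\<in>insert b Bs. f (\<lambda>y\<in>Y. x (\<sigma> \<beta> y))"]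
      fJ insert.prems(1) mp unfolding K by auto
  also have "\<dots> = (\<integral>\<^sup>+ x. (\<integral>\<^sup>+ z. f (\<lambda>y\<in>Y. z (\<sigma> b y)) * (\<Prod>\<beta>\<in>Bs. f (\<lambda>y\<in>Y. x (\<sigma> \<beta> y))) \<partial>PiM J (\<lambda>_. \<mu>)) \<partial>PiM (K - J) (\<lambda>_. \<mu>))"
    using insert.hyps by (intro nn_integral_cong) (simp add: mgb mg cong: prod.cong)
  also have "\<dots> = (\<integral>\<^sup>+ x. (\<integral>\<^sup>+ z. f (\<lambda>y\<in>Y. z (\<sigma> b y)) \<partial>PiM J (\<lambda>_. \<mu>)) * (\<Prod>\<beta>\<in>Bs. f (\<lambda>y\<in>Y. x (\<sigma> \<beta> y))) \<partial>PiM (K - J) (\<lambda>_. \<mu>))"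
    by (intro nn_integral_cong nn_integral_multc m) (simp add: J_def)
  also have "\<dots> = (\<integral>\<^sup>+ z. f (\<lambda>y\<in>Y. z (\<sigma> b y)) \<partial>PiM J (\<lambda>_. \<mu>)) * (\<integral>\<^sup>+ x. (\<Prod>\<beta>\<in>Bs. f (\<lambda>y\<in>Y. x (\<sigma> \<beta> y))) \<partial>PiM (K - J) (\<lambda>_. \<mu>))"
    by (intro nn_integral_cmult mp1)
  also have "(\<integral>\<^sup>+ z. f (\<lambda>y\<in>Y. z (\<sigma> b y)) \<partial>PiM J (\<lambda>_. \<mu>)) = (\<integral>\<^sup>+ x. f x \<partial>PiM Y (\<lambda>_. \<mu>))"
    using insert.prems(2) by (intro nn_integral_reindex[OF \<mu>] f) (auto simp: J_def)
  also have "(\<integral>\<^sup>+ x. (\<Prod>\<beta>\<in>Bs. f (\<lambda>y\<in>Y. x (\<sigma> \<beta> y))) \<partial>PiM (K - J) (\<lambda>_. \<mu>)) = (\<integral>\<^sup>+ x. f x \<partial>PiM Y (\<lambda>_. \<mu>)) ^ card Bs"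
    using insert.prems dj by (intro insert.IH) (auto simp: disjoint_family_on_def)
  finally show ?case using insert.hyps by simp
qed

text \<open>The exponential moment gives a bad block the weight \<open>4 powr (1 / \<theta>)\<close>.\<close>

lemma many_bad_blocks:
  fixes \<theta> :: real
  assumes \<mu>: "prob_space \<mu>" and "finite Bs" "finite K"
    and \<sigma>: "\<And>\<beta>. \<beta> \<in> Bs \<Longrightarrow> inj_on (\<sigma> \<beta>) Y" "\<And>\<beta>. \<beta> \<in> Bs \<Longrightarrow> \<sigma> \<beta> ` Y \<subseteq> K"
    "disjoint_family_on (\<lambda>\<beta>. \<sigma> \<beta> ` Y) Bs"
    and A[measurable]: "A \<in> sets (PiM Y (\<lambda>_. \<mu>))" and \<theta>: "0 < \<theta>"
    and small: "emeasure (PiM Y (\<lambda>_. \<mu>)) A \<le> ennreal (4 powr (- 1 / \<theta>))"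
  defines "bad x \<equiv> {\<beta> \<in> Bs. (\<lambda>y\<in>Y. x (\<sigma> \<beta> y)) \<in> A}"
  shows "{x \<in> space (PiM K (\<lambda>_. \<mu>)). \<theta> * card Bs \<le> card (bad x)} \<in> sets (PiM K (\<lambda>_. \<mu>))"
    and "emeasure (PiM K (\<lambda>_. \<mu>)) {x \<in> space (PiM K (\<lambda>_. \<mu>)). \<theta> * card Bs \<le> card (bad x)} \<le> ennreal ((1/2) ^ card Bs)"
proof -
  define \<Lambda> where "\<Lambda> = (4::real) powr (1 / \<theta>)"
  have \<Lambda>1: "\<Lambda> \<ge> 1" unfolding \<Lambda>_def using \<theta> by (intro ge_one_powr_ge_zero) auto
  have \<Lambda>i: "4 powr (- 1 / \<theta>) = 1 / \<Lambda>" by (simp add: \<Lambda>_def powr_minus_divide)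
  define f where "f y = (if y \<in> A then ennreal \<Lambda> else 1)" for y
  have fm[measurable]: "f \<in> borel_measurable (PiM Y (\<lambda>_. \<mu>))" unfolding f_def by measurable
  have card_sum: "real (card (bad x)) = (\<Sum>\<beta>\<in>Bs. indicator A (\<lambda>y\<in>Y. x (\<sigma> \<beta> y)))" for x
    using assms(2) by (simp add: bad_def indicator_def sum.If_cases Int_def)
  have mind: "(\<lambda>x. indicator A (\<lambda>y\<in>Y. x (\<sigma> \<beta> y)) :: real) \<in> borel_measurable (PiM K (\<lambda>_. \<mu>))" if "\<beta> \<in> Bs" for \<beta>
    by (rule measurable_compose[OF measurable_reindex[OF \<sigma>(2)[OF that]]]) measurable
  have mcard: "(\<lambda>x. real (card (bad x))) \<in> borel_measurable (PiM K (\<lambda>_. \<mu>))"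
    unfolding card_sum using mind by (intro borel_measurable_sum)
  show M: "{x \<in> space (PiM K (\<lambda>_. \<mu>)). \<theta> * card Bs \<le> card (bad x)} \<in> sets (PiM K (\<lambda>_. \<mu>))"
    using mcard by measurable
  have prodf: "(\<Prod>\<beta>\<in>Bs. f (\<lambda>y\<in>Y. x (\<sigma> \<beta> y))) = ennreal (\<Lambda> ^ card (bad x))" for x
  proof -
    have "(\<Prod>\<beta>\<in>Bs. f (\<lambda>y\<in>Y. x (\<sigma> \<beta> y))) = (\<Prod>\<beta>\<in>bad x. ennreal \<Lambda>)"
      unfolding bad_def f_def using assms(2) by (simp add: prod.If_cases Int_def)
    also have "\<dots> = ennreal (\<Lambda> ^ card (bad x))" using \<Lambda>1 by (simp add: ennreal_power)
    finally show ?thesis .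
  qed
  \<comment> \<open>Markov's inequality is prepared for \<open>\<Lambda>\<close> raised to the
    number of bad blocks: on the event this power is at least
    \<open>\<Lambda> powr (\<theta> * card Bs) = 4 ^ card Bs\<close>.\<close>
  have le: "ennreal (4 ^ card Bs) * indicator {x \<in> space (PiM K (\<lambda>_. \<mu>)). \<theta> * card Bs \<le> card (bad x)} x
      \<le> (\<Prod>\<beta>\<in>Bs. f (\<lambda>y\<in>Y. x (\<sigma> \<beta> y)))" for x
  proof (cases "\<theta> * card Bs \<le> card (bad x)")
    case True
    have "(4::real) ^ card Bs = \<Lambda> powr (\<theta> * card Bs)"
      unfolding \<Lambda>_def powr_powr using \<theta> by (simp add: powr_realpow)
    also have "\<dots> \<le> \<Lambda> powr (card (bad x))" using True \<Lambda>1 by (intro powr_mono) auto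
    also have "\<dots> = \<Lambda> ^ card (bad x)" using \<Lambda>1 by (simp add: powr_realpow)
    finally show ?thesis unfolding prodf by (auto simp: indicator_def intro: ennreal_leI)
  qed (auto simp: indicator_def)
  \<comment> \<open>The hypothesis \<open>small\<close> is made for this bound: good blocks
    contribute at most 1 to the mean and bad ones at most
    \<open>\<Lambda> * (1 / \<Lambda>)\<close>. A mean of 2 against a threshold of 4 leaves
    \<open>1 / 2\<close> per block.\<close>
  have intf: "(\<integral>\<^sup>+ y. f y \<partial>PiM Y (\<lambda>_. \<mu>)) \<le> 2"
  proof -
    interpret P: prob_space "PiM Y (\<lambda>_. \<mu>)" by (rule prob_space_PiM_const[OF \<mu>])
    have "(\<integral>\<^sup>+ y. f y \<partial>PiM Y (\<lambda>_. \<mu>)) \<le> (\<integral>\<^sup>+ y. 1 + ennreal \<Lambda> * indicator A y \<partial>PiM Y (\<lambda>_. \<mu>))"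
      by (intro nn_integral_mono) (auto simp: f_def indicator_def)
    also have "\<dots> = 1 + ennreal \<Lambda> * emeasure (PiM Y (\<lambda>_. \<mu>)) A"
      by (subst nn_integral_add) (auto simp: nn_integral_cmult P.emeasure_space_1)
    also have "\<dots> \<le> 1 + ennreal \<Lambda> * ennreal (1 / \<Lambda>)"
      using small unfolding \<Lambda>i by (intro add_left_mono mult_left_mono) auto
    also have "\<dots> = 2" using \<Lambda>1 by (simp add: ennreal_mult[symmetric])
    finally show ?thesis .
  qed
  have "ennreal (4 ^ card Bs) * emeasure (PiM K (\<lambda>_. \<mu>)) {x \<in> space (PiM K (\<lambda>_. \<mu>)). \<theta> * card Bs \<le> card (bad x)}
    = (\<integral>\<^sup>+ x. ennreal (4 ^ card Bs) * indicator {x \<in> space (PiM K (\<lambda>_. \<mu>)). \<theta> * card Bs \<le> card (bad x)} x \<partial>PiM K (\<lambda>_. \<mu>))"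
    using M by (subst nn_integral_cmult_indicator) auto
  also have "\<dots> \<le> (\<integral>\<^sup>+ x. (\<Prod>\<beta>\<in>Bs. f (\<lambda>y\<in>Y. x (\<sigma> \<beta> y))) \<partial>PiM K (\<lambda>_. \<mu>))"
    by (intro nn_integral_mono le)
  also have "\<dots> = (\<integral>\<^sup>+ x. f x \<partial>PiM Y (\<lambda>_. \<mu>)) ^ card Bs"
    using assms by (intro nn_integral_prod_blocks) auto
  also have "\<dots> \<le> 2 ^ card Bs" using intf by (intro power_mono) auto
  finally have *: "ennreal (4 ^ card Bs) * emeasure (PiM K (\<lambda>_. \<mu>)) {x \<in> space (PiM K (\<lambda>_. \<mu>)). \<theta> * card Bs \<le> card (bad x)}
    \<le> ennreal (2 ^ card Bs)" by (simp add: ennreal_power[symmetric])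
  interpret PK: prob_space "PiM K (\<lambda>_. \<mu>)" by (rule prob_space_PiM_const[OF \<mu>])
  have "4 ^ card Bs * PK.prob {x \<in> space (PiM K (\<lambda>_. \<mu>)). \<theta> * card Bs \<le> card (bad x)} \<le> 2 ^ card Bs"
    using * unfolding PK.emeasure_eq_measure by (simp add: ennreal_mult[symmetric])
  then have "PK.prob {x \<in> space (PiM K (\<lambda>_. \<mu>)). \<theta> * card Bs \<le> card (bad x)} \<le> 2 ^ card Bs / 4 ^ card Bs"
    by (simp add: field_simps)
  also have "\<dots> = (1/2) ^ card Bs" by (simp add: power_divide[symmetric])
  finally show "emeasure (PiM K (\<lambda>_. \<mu>)) {x \<in> space (PiM K (\<lambda>_. \<mu>)). \<theta> * card Bs \<le> card (bad x)} \<le> ennreal ((1/2) ^ card Bs)"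
    unfolding PK.emeasure_eq_measure by (rule ennreal_leI)
qed

section \<open>Laws of the channel and of the noise\<close>

lemma prob_space_std_complex_normal: "prob_space std_complex_normal"
proof -
  let ?N = "density lborel (\<lambda>x. ennreal (normal_density 0 (1 / sqrt 2) x))"
  interpret N: prob_space ?N by (rule prob_space_normal_density) simp
  interpret NN: pair_prob_space ?N ?N ..
  have "(\<lambda>(u, v). Complex u v) \<in> borel_measurable (?N \<Otimes>\<^sub>M ?N)"
    by (subst borel_measurable_complex_iff) (auto simp: split_beta')
  then show ?thesis unfolding std_complex_normal_def Let_def by (rule NN.prob_space_distr)
qed

lemma sets_std_complex_normal [simp, measurable_cong]: "sets std_complex_normal = sets borel"
  by (simp add: std_complex_normal_def Let_def)

lemma space_std_complex_normal [simp]: "space std_complex_normal = UNIV"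
  by (simp add: std_complex_normal_def Let_def)

lemma channel_distributionD:
  assumes "channel_distribution \<mu>"
  shows "prob_space \<mu>" "sets \<mu> = sets borel" "\<And>c. emeasure \<mu> {c} = 0"
  using assms by (auto simp: channel_distribution_def)

lemma prob_space_channel_law: "prob_space \<mu> \<Longrightarrow> prob_space (channel_law \<mu> S n)"
  by (simp add: channel_law_def prob_space_PiM)

lemma prob_space_noise_law: "prob_space (noise_law S n)"
  by (simp add: noise_law_def prob_space_PiM prob_space_std_complex_normal)

text \<open>Continuity from above along the superlevel sets, which decrease to the empty set. It
  serves for filter gains, noise sizes and the norms of inverse channels alike, since mere
  finiteness is enough.\<close>

lemma (in prob_space) exists_tail_bound:
  fixes f :: "'a \<Rightarrow> real"
  assumes [measurable]: "f \<in> borel_measurable M" and "0 < \<epsilon>"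
  obtains G where "0 < G" "emeasure M {x \<in> space M. G < f x} \<le> ennreal \<epsilon>"
proof -
  define A where "A n = {x \<in> space M. real n < f x}" for n :: nat
  have "(\<lambda>n. measure M (A n)) \<longlonglongrightarrow> measure M (\<Inter>n. A n)"
    unfolding A_def by (rule finite_Lim_measure_decseq) (auto simp: decseq_def A_def)
  moreover have "(\<Inter>n. A n) = {}"
  proof -
    have "\<exists>n. x \<notin> A n" for x
    proof -
      obtain n :: nat where "f x \<le> real n" using real_arch_simple by blast
      then show ?thesis by (auto simp: A_def not_less)
    qed
    then show ?thesis by blast
  qed
  ultimately have "(\<lambda>n. measure M (A n)) \<longlonglongrightarrow> 0" by simp
  then have "eventually (\<lambda>n. measure M (A n) < \<epsilon>) sequentially"
    using assms(2) by (simp add: order_tendstoD(2))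
  then have "eventually (\<lambda>n. measure M (A n) < \<epsilon> \<and> 0 < n) sequentially"
    using eventually_gt_at_top[of 0] by eventually_elim auto
  then obtain n where n: "measure M (A n) < \<epsilon>" "0 < n" by (auto simp: eventually_sequentially)
  show ?thesis
    by (rule that[of "real n"]) (use n assms(2) in \<open>auto simp: emeasure_eq_measure A_def intro!: ennreal_leI\<close>)
qed

section \<open>Gilbert--Varshamov codes\<close>

definition hdist :: "nat \<Rightarrow> (nat \<Rightarrow> 'l) \<Rightarrow> (nat \<Rightarrow> 'l) \<Rightarrow> nat" where
  "hdist B x y = card {\<beta>. \<beta> < B \<and> x \<beta> \<noteq> y \<beta>}"

lemma hdist_commute: "hdist B x y = hdist B y x"
  unfolding hdist_def by (rule arg_cong[of _ _ card]) auto

text \<open>A word of the ball is determined by the set of positions where it differs from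
  \<open>x\<close> and by its letters there. The crude count \<open>2 ^ B\<close> of position sets
  costs one bit per block, which is harmless because the alphabet grows with the power.\<close>

lemma card_hamming_ball:
  assumes "finite L" "1 \<le> card L"
  shows "card {y \<in> {..<B} \<rightarrow>\<^sub>E L. hdist B x y \<le> e} \<le> 2 ^ B * card L ^ e"
proof -
  let ?Ds = "{D. D \<subseteq> {..<B} \<and> card D \<le> e}"
  let ?T = "Sigma ?Ds (\<lambda>D. D \<rightarrow>\<^sub>E L)"
  let ?F = "\<lambda>y. ({\<beta>. \<beta> < B \<and> x \<beta> \<noteq> y \<beta>}, restrict y {\<beta>. \<beta> < B \<and> x \<beta> \<noteq> y \<beta>})"
  have finD: "finite ?Ds" by (rule finite_subset[of _ "Pow {..<B}"]) auto
  have finT: "finite ?T"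
    using finD assms(1) by (intro finite_SigmaI finite_PiE) (auto intro: finite_subset)
  have "inj_on ?F {y \<in> {..<B} \<rightarrow>\<^sub>E L. hdist B x y \<le> e}"
  proof (rule inj_onI)
    fix y y' assume y: "y \<in> {y \<in> {..<B} \<rightarrow>\<^sub>E L. hdist B x y \<le> e}" "y' \<in> {y \<in> {..<B} \<rightarrow>\<^sub>E L. hdist B x y \<le> e}"
      and eq: "?F y = ?F y'"
    have D: "(\<beta> < B \<and> x \<beta> \<noteq> y \<beta>) = (\<beta> < B \<and> x \<beta> \<noteq> y' \<beta>)" for \<beta> using eq by (auto simp: set_eq_iff)
    have "y \<beta> = y' \<beta>" if "\<beta> < B" for \<beta>
    proof (cases "x \<beta> = y \<beta>")
      case True then show ?thesis using D[of \<beta>] that by auto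
    next
      case False
      have "restrict y {\<beta>. \<beta> < B \<and> x \<beta> \<noteq> y \<beta>} = restrict y' {\<beta>. \<beta> < B \<and> x \<beta> \<noteq> y' \<beta>}"
        using eq by (rule Pair_inject)
      then have "restrict y {\<beta>. \<beta> < B \<and> x \<beta> \<noteq> y \<beta>} \<beta> = restrict y' {\<beta>. \<beta> < B \<and> x \<beta> \<noteq> y' \<beta>} \<beta>"
        by (rule fun_cong)
      then show ?thesis using False that D[of \<beta>] by simp
    qed
    then show "y = y'" using y by (intro PiE_ext[of y "{..<B}" "\<lambda>_. L"]) auto
  qed
  moreover have "?F ` {y \<in> {..<B} \<rightarrow>\<^sub>E L. hdist B x y \<le> e} \<subseteq> ?T"
  proof (rule image_subsetI)
    fix y assume "y \<in> {y \<in> {..<B} \<rightarrow>\<^sub>E L. hdist B x y \<le> e}"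
    then show "?F y \<in> ?T"
      by (intro SigmaI restrict_PiE_iff[THEN iffD2]) (auto simp: hdist_def)
  qed
  ultimately have "card {y \<in> {..<B} \<rightarrow>\<^sub>E L. hdist B x y \<le> e} \<le> card ?T"
    using finT by (rule card_inj_on_le)
  also have "\<dots> = (\<Sum>D\<in>?Ds. card (D \<rightarrow>\<^sub>E L))"
    using finD assms(1) by (intro card_SigmaI) (auto intro!: finite_PiE intro: finite_subset)
  also have "\<dots> \<le> (\<Sum>D\<in>?Ds. card L ^ e)"
  proof (rule sum_mono)
    fix D assume D: "D \<in> ?Ds"
    then have "finite D" using finite_subset by blast
    then show "card (D \<rightarrow>\<^sub>E L) \<le> card L ^ e"
      using D assms by (simp add: card_PiE power_increasing)
  qed
  also have "\<dots> \<le> card (Pow {..<B}) * card L ^ e"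
  proof -
    have "card ?Ds \<le> card (Pow {..<B})" by (intro card_mono) auto
    then show ?thesis by (simp only: sum_constant of_nat_id mult_right_mono le0)
  qed
  finally show ?thesis by (simp add: card_Pow)
qed

text \<open>The alternative \<open>w \<le> 1\<close> keeps rate zero available when the alphabet is
  too small for the inequality, for instance when it has a single letter.\<close>

abbreviation gv_bound :: "nat \<Rightarrow> nat \<Rightarrow> nat \<Rightarrow> nat \<Rightarrow> bool" where
  "gv_bound B e q w \<equiv> w \<le> 1 \<or> w * (2 ^ B * q ^ e) \<le> q ^ B"

text \<open>Greedy choice: as long as the balls around the chosen words do not exhaust all words, a
  word outside them can be added. Distance above \<open>2 * m\<close> then corrects any
  \<open>m\<close> wrong letters, whatever causes them.\<close>

lemma gilbert_varshamov:
  assumes "finite L" "1 \<le> card L" and "gv_bound B e (card L) w"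
  shows "\<exists>code. (\<forall>i<w. code i \<in> {..<B} \<rightarrow>\<^sub>E L) \<and>
    (\<forall>i<w. \<forall>i'<w. i \<noteq> i' \<longrightarrow> e < hdist B (code i) (code i'))"
  using assms(3)
proof (induction w)
  case 0
  then show ?case by simp
next
  case (Suc w)
  define V where "V = 2 ^ B * card L ^ e"
  have fin: "finite ({..<B} \<rightarrow>\<^sub>E L)" using assms(1) by (intro finite_PiE) auto
  have V: "w * V \<le> card L ^ B \<and> (w = 0 \<or> w * V < card L ^ B)"
  proof (cases "w = 0")
    case False
    have "0 < V" using assms(2) by (simp add: V_def)
    moreover have "Suc w * V \<le> card L ^ B" using Suc.prems False by (auto simp: V_def)
    ultimately show ?thesis by simp
  qed simp
  then obtain code where code: "\<forall>i<w. code i \<in> {..<B} \<rightarrow>\<^sub>E L"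
    "\<forall>i<w. \<forall>i'<w. i \<noteq> i' \<longrightarrow> e < hdist B (code i) (code i')"
    using Suc.IH by (auto simp: V_def)
  let ?U = "\<Union>i<w. {y \<in> {..<B} \<rightarrow>\<^sub>E L. hdist B (code i) y \<le> e}"
  have "card ?U \<le> (\<Sum>i<w. card {y \<in> {..<B} \<rightarrow>\<^sub>E L. hdist B (code i) y \<le> e})"
    by (intro card_UN_le) simp
  also have "\<dots> \<le> (\<Sum>i<w. V)" unfolding V_def by (intro sum_mono card_hamming_ball assms)
  finally have "card ?U \<le> w * V" by simp
  also have "w * V < card ({..<B} \<rightarrow>\<^sub>E L)"
    using V assms(1,2) by (cases "w = 0") (auto simp: card_PiE)
  finally have "card ?U < card ({..<B} \<rightarrow>\<^sub>E L)" .
  then have "\<not> ({..<B} \<rightarrow>\<^sub>E L) \<subseteq> ?U"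
  proof (rule contrapos_pn)
    assume "({..<B} \<rightarrow>\<^sub>E L) \<subseteq> ?U"
    moreover have "finite ?U" using fin by auto
    ultimately show "\<not> card ?U < card ({..<B} \<rightarrow>\<^sub>E L)" using card_mono leD by blast
  qed
  then obtain y where y: "y \<in> {..<B} \<rightarrow>\<^sub>E L" "\<And>i. i < w \<Longrightarrow> e < hdist B (code i) y"
    unfolding subset_iff by (auto simp: not_le)
  have "(\<forall>i<Suc w. (code(w := y)) i \<in> {..<B} \<rightarrow>\<^sub>E L) \<and>
    (\<forall>i<Suc w. \<forall>i'<Suc w. i \<noteq> i' \<longrightarrow> e < hdist B ((code(w := y)) i) ((code(w := y)) i'))"
    using code y by (auto simp: less_Suc_eq hdist_commute[of B y])
  then show ?case by blast
qed

section \<open>Block codes for an alignment scheme\<close>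

lemma AE_pair_fst:
  assumes "prob_space N" "AE x in M. P x"
  shows "AE z in M \<Otimes>\<^sub>M N. P (fst z)"
proof -
  interpret N: prob_space N by fact
  from assms(2) obtain A where A: "{x \<in> space M. \<not> P x} \<subseteq> A" "A \<in> null_sets M" by (rule AE_E3) auto
  have "A \<times> space N \<in> null_sets (M \<Otimes>\<^sub>M N)"
    using A(2) by (auto simp: null_sets_def N.emeasure_pair_measure_Times)
  then show ?thesis
    using A(1) by (intro AE_I'[of "A \<times> space N"]) (auto simp: space_pair_measure)
qed

lemma AE_pair_snd:
  assumes "prob_space N" "AE x in N. P x"
  shows "AE z in M \<Otimes>\<^sub>M N. P (snd z)"
proof -
  interpret N: prob_space N by fact
  from assms(2) obtain A where A: "{x \<in> space N. \<not> P x} \<subseteq> A" "A \<in> null_sets N" by (rule AE_E3) auto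
  have "space M \<times> A \<in> null_sets (M \<Otimes>\<^sub>M N)"
    using A(2) by (auto simp: null_sets_def N.emeasure_pair_measure_Times)
  then show ?thesis
    using A(1) by (intro AE_I'[of "space M \<times> A"]) (auto simp: space_pair_measure)
qed

lemma received_nth:
  "received x h z j t $ a = (\<Sum>k\<in>UNIV. \<Sum>b\<in>UNIV. h (t, j, k, a, b) * (x k t $ b)) + z (t, j, a)"
  by (simp add: received_def matrix_vector_mult_def channel_matrix_def)

lemma borel_measurable_vecI:
  fixes f :: "'a \<Rightarrow> complex ^ 'm"
  assumes "\<And>a. (\<lambda>x. f x $ a) \<in> borel_measurable M"
  shows "f \<in> borel_measurable M"
proof (subst borel_measurable_euclidean_space, intro ballI)
  fix i :: "complex ^ 'm" assume "i \<in> Basis"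
  then obtain a u where i: "i = axis a u" by (auto simp: Basis_vec_def)
  show "(\<lambda>x. f x \<bullet> i) \<in> borel_measurable M"
    unfolding i inner_axis using assms by (intro borel_measurable_inner) auto
qed

lemma borel_measurable_vec_nth':
  fixes f :: "'a \<Rightarrow> complex ^ 'm"
  assumes "f \<in> borel_measurable M"
  shows "(\<lambda>x. f x $ a) \<in> borel_measurable M"
  by (rule measurable_compose[OF assms borel_measurable_continuous_onI]) (intro continuous_intros)

lemma space_message_law [simp]: "space (message_law W) = UNIV"
  by (simp add: message_law_def)

lemma prob_space_message_law: "prob_space (message_law W)"
  by (simp add: message_law_def measure_pmf.prob_space_axioms)

lemma messages_finite: "finite {w :: 'k::finite \<Rightarrow> nat. \<forall>k. w k < W k}"
proof -
  have "{w. \<forall>k. w k < W k} \<subseteq> (UNIV \<rightarrow>\<^sub>E {..<Max (range W)})"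
    by (auto intro: less_le_trans[OF _ Max_ge[OF _ rangeI]])
  then show ?thesis by (rule finite_subset) (auto intro: finite_PiE)
qed

lemma messages_nonempty: "(\<And>k. 0 < W k) \<Longrightarrow> {w :: 'k::finite \<Rightarrow> nat. \<forall>k. w k < W k} \<noteq> {}"
  by (auto intro!: exI[of _ "\<lambda>_. 0"])

lemma AE_message_law:
  assumes "\<And>k :: 'k::finite. 0 < W k"
  shows "AE w in message_law W. \<forall>k. w k < W k"
  unfolding message_law_def AE_measure_pmf_iff
  using messages_finite[of W] messages_nonempty[of W] assms by simp

type_synonym ('r, 'm) noise = "nat \<times> 'r \<times> 'm \<Rightarrow> complex"

definition csi_index :: "'r set \<Rightarrow> nat \<Rightarrow> (nat \<times> 'r::finite \<times> 'k::finite \<times> 'm::finite \<times> 'm) set" where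
  "csi_index S n = {..<n} \<times> S \<times> UNIV \<times> UNIV \<times> UNIV"

definition noise_index :: "'r set \<Rightarrow> nat \<Rightarrow> (nat \<times> 'r::finite \<times> 'm::finite) set" where
  "noise_index S n = {..<n} \<times> S \<times> UNIV"

lemma channel_law_alt: "channel_law \<mu> S n = PiM (csi_index S n) (\<lambda>_. \<mu>)"
  by (simp add: channel_law_def csi_index_def)

lemma noise_law_alt: "noise_law S n = PiM (noise_index S n) (\<lambda>_. std_complex_normal)"
  by (simp add: noise_law_def noise_index_def)

lemma finite_index [simp]:
  "finite (csi_index S n :: (nat \<times> 'r::finite \<times> 'k::finite \<times> 'm::finite \<times> 'm) set)"
  "finite (noise_index S n :: (nat \<times> 'r \<times> 'm) set)"
  by (auto simp: csi_index_def noise_index_def)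

definition shift_time :: "nat \<Rightarrow> nat \<times> 'x \<Rightarrow> nat \<times> 'x" where
  "shift_time o1 i = (o1 + fst i, snd i)"

lemma inj_shift_time: "inj_on (shift_time o1) A"
  by (auto simp: inj_on_def shift_time_def prod_eq_iff)

text \<open>Dividing the time by \<open>T\<close> recovers the number of the block.\<close>

lemma disjoint_shift_time:
  assumes "\<And>i. i \<in> A \<Longrightarrow> fst i < T"
  shows "disjoint_family_on (\<lambda>\<beta>. shift_time (\<beta> * T) ` A) Bs"
proof -
  have "m = n" if i: "i \<in> A" "i' \<in> A" and eq: "shift_time (m * T) i = shift_time (n * T) i'" for m n i i'
  proof -
    have "m * T + fst i = n * T + fst i'" using eq by (simp add: shift_time_def)
    moreover have "(m * T + fst i) div T = m" "(n * T + fst i') div T = n"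
      using assms[OF i(1)] assms[OF i(2)] by simp_all
    ultimately show ?thesis by simp
  qed
  then show ?thesis unfolding disjoint_family_on_def by blast
qed

lemma shift_time_index:
  assumes "\<beta> < n div T"
  shows "shift_time (\<beta> * T) ` csi_index S T \<subseteq> csi_index S n"
    and "shift_time (\<beta> * T) ` noise_index S T \<subseteq> noise_index S n"
proof -
  have "\<beta> * T + t < n" if "t < T" for t
  proof -
    have "\<beta> * T + t < Suc \<beta> * T" using that by simp
    also have "\<dots> \<le> n div T * T" using assms by (intro mult_right_mono) auto
    also have "\<dots> \<le> n" by simp
    finally show ?thesis .
  qed
  then show "shift_time (\<beta> * T) ` csi_index S T \<subseteq> csi_index S n"
    "shift_time (\<beta> * T) ` noise_index S T \<subseteq> noise_index S n"
    by (auto simp: csi_index_def noise_index_def shift_time_def)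
qed

lemma round_exact:
  assumes "\<bar>x - real u\<bar> < 1/2"
  shows "nat \<lfloor>x + 1/2\<rfloor> = u"
proof -
  have "\<lfloor>x + 1/2\<rfloor> = int u" using assms by (intro floor_unique) (auto simp: abs_if split: if_splits)
  then show ?thesis by simp
qed

text \<open>The facts about alignment on which the coding argument rests. Filters and denominators
  are kept apart so that both stay polynomial in the gains; the division is left to the receiver,
  where \<open>den\<close> is nonzero almost surely.\<close>

locale alignment_scheme =
  fixes \<mu> :: "complex measure" and S :: "'r::finite set" and demand :: "'r \<Rightarrow> 'k::finite set"
    and c :: "'k \<Rightarrow> nat" and N T g0 :: nat
    and fil :: "'r \<Rightarrow> 'k \<Rightarrow> 'm::finite \<Rightarrow> ('r, 'k, 'm) beam_id \<Rightarrow> nat \<Rightarrow> 'm \<Rightarrow> ('r, 'k, 'm) csi \<Rightarrow> complex"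
    and den :: "'r \<Rightarrow> 'k \<Rightarrow> 'm \<Rightarrow> ('r, 'k, 'm) beam_id \<Rightarrow> ('r, 'k, 'm) csi \<Rightarrow> complex"
    and X :: "('r \<times> 'm \<times> 'k \<times> 'm) set"
  defines "X \<equiv> interfering_links S demand"
  assumes \<mu>: "channel_distribution \<mu>" and T: "0 < T"
    and fil: "\<And>j k b s t a. j \<in> S \<Longrightarrow> k \<in> demand j \<Longrightarrow> s \<in> stream_index X (c k) N \<Longrightarrow> t < T \<Longrightarrow>
        sep_poly (csi_index S T) (fil j k b s t a)"
    and den: "\<And>j k b s. j \<in> S \<Longrightarrow> k \<in> demand j \<Longrightarrow> s \<in> stream_index X (c k) N \<Longrightarrow>
        sep_poly (csi_index S T) (den j k b s)"
    and den_nz: "\<And>j k b s. j \<in> S \<Longrightarrow> k \<in> demand j \<Longrightarrow> s \<in> stream_index X (c k) N \<Longrightarrow>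
        AE h in channel_law \<mu> S T. den j k b s h \<noteq> 0"
    and zf: "\<And>j k b s h sym. j \<in> S \<Longrightarrow> k \<in> demand j \<Longrightarrow> s \<in> stream_index X (c k) N \<Longrightarrow>
        (\<Sum>t<T. \<Sum>a\<in>UNIV. fil j k b s t a h * (\<Sum>k'\<in>UNIV. \<Sum>b'\<in>UNIV. h (t, j, k', a, b') *
        (\<Sum>s'\<in>stream_index X (c k') N. beam X g0 s' t h * sym k' b' s'))) = den j k b s h * sym k b s"
begin

abbreviation "Str k \<equiv> stream_index X (c k) N"
abbreviation "Y \<equiv> csi_index S T :: (nat \<times> 'r \<times> 'k \<times> 'm \<times> 'm) set"
abbreviation "Z \<equiv> noise_index S T :: (nat \<times> 'r \<times> 'm) set"

definition blk :: "nat \<Rightarrow> ('r, 'k, 'm) csi \<Rightarrow> ('r, 'k, 'm) csi" where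
  "blk \<beta> h = (\<lambda>i\<in>Y. h (shift_time (\<beta> * T) i))"

definition nblk :: "nat \<Rightarrow> ('r, 'm) noise \<Rightarrow> nat \<times> 'r \<times> 'm \<Rightarrow> complex" where
  "nblk \<beta> z = (\<lambda>i\<in>Z. z (shift_time (\<beta> * T) i))"

text \<open>One letter holds the constellation points of all antennas and streams of a transmitter
  for a whole block, so a bad block damages at most one letter of a codeword.\<close>

definition letters :: "'k \<Rightarrow> nat \<Rightarrow> ('m \<times> ('r, 'k, 'm) beam_id \<Rightarrow> nat \<times> nat) set" where
  "letters k Q = (UNIV \<times> Str k) \<rightarrow>\<^sub>E ({..<Q} \<times> {..<Q})"

definition sym :: "real \<Rightarrow> nat \<times> nat \<Rightarrow> complex" where
  "sym \<Delta> u = of_real \<Delta> * Complex (real (fst u)) (real (snd u))"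

text \<open>The last \<open>n mod T\<close> slots do not fill a block and stay silent.\<close>

definition encoder :: "real \<Rightarrow> nat \<Rightarrow> ('k \<Rightarrow> nat \<Rightarrow> nat \<Rightarrow> 'm \<times> ('r, 'k, 'm) beam_id \<Rightarrow> nat \<times> nat) \<Rightarrow>
    ('r, 'k, 'm) encoders" where
  "encoder \<Delta> n code k w h t = (if t < n div T * T then
     (\<chi> b. \<Sum>s\<in>Str k. beam X g0 s (t mod T) (blk (t div T) h) * sym \<Delta> (code k w (t div T) (b, s))) else 0)"

definition est :: "real \<Rightarrow> 'r \<Rightarrow> 'k \<Rightarrow> ('r, 'k, 'm) csi \<Rightarrow> (nat \<Rightarrow> complex ^ 'm) \<Rightarrow> nat \<Rightarrow>
    'm \<times> ('r, 'k, 'm) beam_id \<Rightarrow> nat \<times> nat" where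
  "est \<Delta> j k h y \<beta> = (\<lambda>(b, s)\<in>UNIV \<times> Str k.
     let u = (\<Sum>t<T. \<Sum>a\<in>UNIV. fil j k b s t a (blk \<beta> h) * (y (\<beta> * T + t) $ a)) / (den j k b s (blk \<beta> h) * of_real \<Delta>)
     in (nat \<lfloor>Re u + 1/2\<rfloor>, nat \<lfloor>Im u + 1/2\<rfloor>))"

text \<open>The least index makes the decoder total. Its value matters only when a codeword lies
  within distance \<open>m\<close>, and the minimum distance then makes that codeword
  unique.\<close>

definition decoder :: "real \<Rightarrow> nat \<Rightarrow> nat \<Rightarrow> ('k \<Rightarrow> nat) \<Rightarrow>
    ('k \<Rightarrow> nat \<Rightarrow> nat \<Rightarrow> 'm \<times> ('r, 'k, 'm) beam_id \<Rightarrow> nat \<times> nat) \<Rightarrow> ('r, 'k, 'm) decoders" where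
  "decoder \<Delta> n m W code j h y k = (if k \<in> demand j then
     (LEAST w. w < W k \<and> hdist (n div T) (code k w) (est \<Delta> j k h y) \<le> m) else 0)"

text \<open>A single number that dominates the noise amplification of all filters at all receivers
  of \<open>S\<close>, so that one threshold serves every stream.\<close>

definition gain :: "('r, 'k, 'm) csi \<Rightarrow> real" where
  "gain h = (\<Sum>j\<in>S. \<Sum>k\<in>demand j. \<Sum>b\<in>UNIV. \<Sum>s\<in>Str k. \<Sum>t<T. \<Sum>a\<in>UNIV. cmod (fil j k b s t a h / den j k b s h))"

definition noise_size :: "('r, 'm) noise \<Rightarrow> real" where
  "noise_size z = (\<Sum>i\<in>Z. cmod (z i))"

text \<open>Vanishing denominators are listed separately because division by zero yields 0 and would
  make \<open>gain\<close> small instead of large.\<close>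

definition bad_csi :: "real \<Rightarrow> ('r, 'k, 'm) csi set" where
  "bad_csi G = {h \<in> space (PiM Y (\<lambda>_. \<mu>)). G < gain h \<or> (\<exists>j\<in>S. \<exists>k\<in>demand j. \<exists>b. \<exists>s\<in>Str k. den j k b s h = 0)}"

definition bad_noise :: "real \<Rightarrow> ('r, 'm) noise set" where
  "bad_noise G = {z \<in> space (PiM Z (\<lambda>_. std_complex_normal)). G < noise_size z}"

lemma finX: "finite X" unfolding X_def by (rule finite_interfering_links)

lemma finStr: "finite (Str k)" by (rule finite_stream_index[OF finX])

lemma card_letters: "card (letters k Q) = (Q * Q) ^ (CARD('m) * (c k * N ^ card X))"
  unfolding letters_def using finStr by (simp add: card_PiE card_cartesian_product card_stream_index[OF finX])

lemma finite_letters: "finite (letters k Q)"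
  unfolding letters_def using finStr by (intro finite_PiE) auto

lemmas \<mu>D = channel_distributionD[OF \<mu>]

lemma sep_poly_meas: "sep_poly Y f \<Longrightarrow> f \<in> borel_measurable (PiM Y (\<lambda>_. \<mu>))"
  using sep_poly_measurable[of Y f] by (simp add: \<mu>D(2) cong: measurable_cong_sets sets_PiM_cong)

lemma measurable_gain: "gain \<in> borel_measurable (PiM Y (\<lambda>_. \<mu>))"
  unfolding gain_def[abs_def] using fil den
  by (intro borel_measurable_sum borel_measurable_norm borel_measurable_divide sep_poly_meas
      measurable_compose[OF _ borel_measurable_norm]) auto

lemma measurable_noise_size: "noise_size \<in> borel_measurable (PiM Z (\<lambda>_. std_complex_normal))"
  unfolding noise_size_def[abs_def] by measurable

lemma sets_bad_csi: "bad_csi G \<in> sets (PiM Y (\<lambda>_. \<mu>))"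
proof -
  have 1: "{h \<in> space (PiM Y (\<lambda>_. \<mu>)). G < gain h} \<in> sets (PiM Y (\<lambda>_. \<mu>))"
    using measurable_gain by measurable
  have 2: "{h \<in> space (PiM Y (\<lambda>_. \<mu>)). den j k b s h = 0} \<in> sets (PiM Y (\<lambda>_. \<mu>))"
    if "j \<in> S" "k \<in> demand j" "s \<in> Str k" for j k b s
    using sep_poly_meas[OF den[OF that, of b]] by measurable
  have "bad_csi G = {h \<in> space (PiM Y (\<lambda>_. \<mu>)). G < gain h} \<union>
      (\<Union>j\<in>S. \<Union>k\<in>demand j. \<Union>b\<in>UNIV. \<Union>s\<in>Str k. {h \<in> space (PiM Y (\<lambda>_. \<mu>)). den j k b s h = 0})"
    by (auto simp: bad_csi_def)
  also have "\<dots> \<in> sets (PiM Y (\<lambda>_. \<mu>))"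
    using 1 2 finStr by (intro sets.Un sets.finite_UN) auto
  finally show ?thesis .
qed

lemma sets_bad_noise: "bad_noise G \<in> sets (PiM Z (\<lambda>_. std_complex_normal))"
  unfolding bad_noise_def using measurable_noise_size by measurable

lemma exists_small_bad:
  assumes "0 < \<epsilon>"
  obtains G where "0 < G" "emeasure (PiM Y (\<lambda>_. \<mu>)) (bad_csi G) \<le> ennreal \<epsilon>"
    "emeasure (PiM Z (\<lambda>_. std_complex_normal)) (bad_noise G) \<le> ennreal \<epsilon>"
proof -
  interpret PY: prob_space "PiM Y (\<lambda>_. \<mu>)" by (rule prob_space_PiM_const[OF \<mu>D(1)])
  interpret PZ: prob_space "PiM Z (\<lambda>_. std_complex_normal)"
    by (rule prob_space_PiM_const[OF prob_space_std_complex_normal])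
  obtain G1 where G1: "0 < G1" "emeasure (PiM Y (\<lambda>_. \<mu>)) {h \<in> space (PiM Y (\<lambda>_. \<mu>)). G1 < gain h} \<le> ennreal \<epsilon>"
    using PY.exists_tail_bound[OF measurable_gain assms] .
  obtain G2 where G2: "0 < G2" "emeasure (PiM Z (\<lambda>_. std_complex_normal)) (bad_noise G2) \<le> ennreal \<epsilon>"
    using PZ.exists_tail_bound[OF measurable_noise_size assms] unfolding bad_noise_def .
  have "AE h in PiM Y (\<lambda>_. \<mu>). \<forall>j\<in>S. \<forall>k\<in>demand j. \<forall>b\<in>UNIV. \<forall>s\<in>Str k. den j k b s h \<noteq> 0"
    using den_nz unfolding channel_law_alt
    by (intro AE_finite_allI finStr finite)
  then have "emeasure (PiM Y (\<lambda>_. \<mu>)) (bad_csi G1) = emeasure (PiM Y (\<lambda>_. \<mu>)) {h \<in> space (PiM Y (\<lambda>_. \<mu>)). G1 < gain h}"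
    using measurable_gain sets_bad_csi by (intro emeasure_eq_AE) (auto simp: bad_csi_def)
  with G1 have B1: "emeasure (PiM Y (\<lambda>_. \<mu>)) (bad_csi G1) \<le> ennreal \<epsilon>" by simp
  show ?thesis
  proof (rule that[of "max G1 G2"])
    show "0 < max G1 G2" using G1 by simp
    show "emeasure (PiM Y (\<lambda>_. \<mu>)) (bad_csi (max G1 G2)) \<le> ennreal \<epsilon>"
      by (rule order_trans[OF emeasure_mono B1]) (auto simp: bad_csi_def sets_bad_csi[unfolded bad_csi_def])
    show "emeasure (PiM Z (\<lambda>_. std_complex_normal)) (bad_noise (max G1 G2)) \<le> ennreal \<epsilon>"
      by (rule order_trans[OF emeasure_mono G2(2)]) (auto simp: bad_noise_def sets_bad_noise[unfolded bad_noise_def])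
  qed
qed

end

lemma AE_reindex:
  assumes "prob_space \<mu>" "inj_on f I" "f ` I \<subseteq> K" "AE x in PiM I (\<lambda>_. \<mu>). P x"
  shows "AE x in PiM K (\<lambda>_. \<mu>). P (\<lambda>i\<in>I. x (f i))"
  using AE_distrD[OF measurable_reindex[OF assms(3), of \<mu>], of P,
      unfolded distr_PiM_const_reindex[OF assms(1-3)], OF assms(4)] .

context alignment_scheme
begin

lemma measurable_blk:
  assumes "\<beta> < n div T"
  shows "blk \<beta> \<in> measurable (channel_law \<mu> S n) (PiM Y (\<lambda>_. \<mu>))"
  unfolding blk_def[abs_def] channel_law_alt by (rule measurable_reindex[OF shift_time_index(1)[OF assms]])

lemma measurable_sep_poly_blk:
  assumes "\<beta> < n div T" "sep_poly Y f"
  shows "(\<lambda>h. f (blk \<beta> h)) \<in> borel_measurable (channel_law \<mu> S n)"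
  by (rule measurable_compose[OF measurable_blk[OF assms(1)] sep_poly_meas[OF assms(2)]])

lemma sep_poly_beam': "t < T \<Longrightarrow> sep_poly Y (beam X g0 s t)"
  unfolding csi_index_def by (rule sep_poly_beam) (auto simp: X_def interfering_links_def)

text \<open>The almost sure upper bound on the gains bounds every monomial of bounded degree. It is
  enlarged to at least 1 so that its powers grow with the exponent.\<close>

lemma bounded_beam:
  obtains Kb where "0 < Kb" "AE h in PiM Y (\<lambda>_. \<mu>). \<forall>k\<in>UNIV. \<forall>s\<in>Str k. \<forall>t\<in>{..<T}. cmod (beam X g0 s t h) \<le> Kb"
proof -
  from \<mu> obtain b where b: "AE c in \<mu>. cmod c \<le> b" unfolding channel_distribution_def by auto
  define b' where "b' = max 1 b"
  have "AE h in PiM Y (\<lambda>_. \<mu>). \<forall>i\<in>Y. cmod (h i) \<le> b'"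
  proof (intro AE_finite_allI finite_index)
    fix i assume "i \<in> Y"
    from AE_PiM_component[of Y "\<lambda>_. \<mu>", OF \<mu>D(1) this b]
    show "AE h in PiM Y (\<lambda>_. \<mu>). cmod (h i) \<le> b'" by eventually_elim (simp add: b'_def)
  qed
  then have "AE h in PiM Y (\<lambda>_. \<mu>). \<forall>k\<in>UNIV. \<forall>s\<in>Str k. \<forall>t\<in>{..<T}. cmod (beam X g0 s t h) \<le> 2 ^ (g0 * sum c UNIV * T) * b' ^ (N * card X)"
  proof eventually_elim
    case (elim h)
    show ?case
    proof (intro ballI)
      fix k s t assume st: "s \<in> Str k" "t \<in> {..<T}"
      have "fst s \<le> sum c UNIV"
        using st(1) member_le_sum[of k UNIV c] by (auto simp: stream_index_def)
      then have "g0 * fst s * t \<le> g0 * sum c UNIV * T" using st(2) by (intro mult_le_mono) auto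
      then have 1: "(2::real) ^ (g0 * fst s * t) \<le> 2 ^ (g0 * sum c UNIV * T)" by (intro power_increasing) auto
      have "cmod (\<Prod>(j, a, i, b)\<in>X. h (t, j, i, a, b) ^ snd s (j, a, i, b)) \<le> (\<Prod>x\<in>X. b' ^ N)"
        unfolding prod_norm[symmetric]
      proof (rule prod_mono, safe)
        fix j a i b assume x: "(j, a, i, b) \<in> X"
        then have "(t, j, i, a, b) \<in> Y" using st(2) by (auto simp: X_def interfering_links_def csi_index_def)
        then have "cmod (h (t, j, i, a, b) ^ snd s (j, a, i, b)) \<le> b' ^ snd s (j, a, i, b)"
          using elim by (auto simp: norm_power intro: power_mono)
        also have "\<dots> \<le> b' ^ N"
          using st(1) x by (intro power_increasing) (auto simp: stream_index_def b'_def PiE_iff intro: less_imp_le)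
        finally show "cmod (h (t, j, i, a, b) ^ snd s (j, a, i, b)) \<le> b' ^ N" .
      qed auto
      also have "\<dots> = b' ^ (N * card X)" by (simp add: power_mult)
      finally have 2: "cmod (\<Prod>(j, a, i, b)\<in>X. h (t, j, i, a, b) ^ snd s (j, a, i, b)) \<le> b' ^ (N * card X)" .
      show "cmod (beam X g0 s t h) \<le> 2 ^ (g0 * sum c UNIV * T) * b' ^ (N * card X)"
        unfolding beam_def norm_mult using 1 2 by (intro mult_mono) (auto simp: norm_power)
    qed
  qed
  then show ?thesis by (rule that[rotated]) (simp add: b'_def)
qed

lemma encoder_measurable:
  "(\<lambda>h. encoder \<Delta> n code k w h t) \<in> borel_measurable (channel_law \<mu> S n)"
proof (cases "t < n div T * T")
  case True
  have "t div T < n div T" using True T by (simp add: div_less_iff_less_mult)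
  then have "(\<lambda>h. beam X g0 s (t mod T) (blk (t div T) h)) \<in> borel_measurable (channel_law \<mu> S n)" for s
    using T by (intro measurable_sep_poly_blk sep_poly_beam') auto
  then show ?thesis
    using True unfolding encoder_def
    by (auto intro!: borel_measurable_vecI borel_measurable_sum borel_measurable_times)
qed (simp add: encoder_def)

text \<open>Beams and constellation points are bounded, so the amplitude stays below
  \<open>sqrt P\<close> almost surely and not only on average. The constellation size
  \<open>Q\<close> may therefore be of order \<open>sqrt P\<close>.\<close>

lemma encoder_power:
  assumes Kb: "AE h in PiM Y (\<lambda>_. \<mu>). \<forall>k\<in>UNIV. \<forall>s\<in>Str k. \<forall>t\<in>{..<T}. cmod (beam X g0 s t h) \<le> Kb"
    and "0 < Kb" "0 < \<Delta>"
    and code: "\<And>w. w < W k \<Longrightarrow> code k w \<in> {..<n div T} \<rightarrow>\<^sub>E letters k Q"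
    and W: "\<And>k. 0 < W k"
    and P: "CARD('m) * (card (Str k) * (Kb * (\<Delta> * (2 * real Q)))) \<le> sqrt P" "0 \<le> P"
  shows "(\<integral>\<^sup>+ (w, h). ennreal ((norm (encoder \<Delta> n code k (w k) h t))\<^sup>2)
                  \<partial>(message_law W \<Otimes>\<^sub>M channel_law \<mu> S n)) \<le> ennreal P"
proof -
  interpret M: prob_space "message_law W" by (rule prob_space_message_law)
  interpret C: prob_space "channel_law \<mu> S n :: ('r, 'k, 'm) csi measure" by (rule prob_space_channel_law[OF \<mu>D(1)])
  interpret MC: pair_prob_space "message_law W" "channel_law \<mu> S n :: ('r, 'k, 'm) csi measure" ..
  have "AE h in channel_law \<mu> S n. \<forall>\<beta>\<in>{..<n div T}. \<forall>k\<in>UNIV. \<forall>s\<in>Str k. \<forall>t\<in>{..<T}. cmod (beam X g0 s t (blk \<beta> h)) \<le> Kb"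
    unfolding channel_law_alt blk_def
    by (intro AE_finite_allI finite_lessThan AE_reindex[OF \<mu>D(1) inj_shift_time shift_time_index(1) Kb]) auto
  then have b: "AE x in message_law W \<Otimes>\<^sub>M channel_law \<mu> S n. \<forall>\<beta>\<in>{..<n div T}. \<forall>k\<in>UNIV. \<forall>s\<in>Str k. \<forall>t\<in>{..<T}. cmod (beam X g0 s t (blk \<beta> (snd x))) \<le> Kb"
    by (rule AE_pair_snd[OF C.prob_space_axioms])
  have v: "AE x in message_law W \<Otimes>\<^sub>M (channel_law \<mu> S n :: ('r, 'k, 'm) csi measure). \<forall>k. fst x k < W k"
    by (rule AE_pair_fst[OF C.prob_space_axioms AE_message_law[OF W]])
  have "AE x in message_law W \<Otimes>\<^sub>M channel_law \<mu> S n. (norm (encoder \<Delta> n code k (fst x k) (snd x) t))\<^sup>2 \<le> P"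
    using b v
  proof eventually_elim
    case (elim x)
    define w h where "w = fst x k" and "h = snd x"
    have "norm (encoder \<Delta> n code k w h t) \<le> sqrt P"
    proof (cases "t < n div T * T")
      case True
      have \<beta>: "t div T < n div T" using True T by (simp add: div_less_iff_less_mult)
      have sy: "cmod (sym \<Delta> (code k w (t div T) (b, s))) \<le> \<Delta> * (2 * real Q)" if "s \<in> Str k" for b s
      proof -
        have "code k w (t div T) (b, s) \<in> {..<Q} \<times> {..<Q}"
          using code[of w] elim(2) \<beta> that unfolding w_def letters_def by (auto simp: PiE_iff)
        then have q: "fst (code k w (t div T) (b, s)) \<le> Q" "snd (code k w (t div T) (b, s)) \<le> Q" by auto
        have "cmod (Complex (real (fst (code k w (t div T) (b, s)))) (real (snd (code k w (t div T) (b, s)))))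
          \<le> \<bar>real (fst (code k w (t div T) (b, s)))\<bar> + \<bar>real (snd (code k w (t div T) (b, s)))\<bar>"
          using cmod_le[of "Complex (real (fst (code k w (t div T) (b, s)))) (real (snd (code k w (t div T) (b, s))))"] by simp
        also have "\<dots> \<le> 2 * real Q" using q by simp
        finally show ?thesis unfolding sym_def norm_mult using assms(3) by simp
      qed
      have comp: "cmod (\<Sum>s\<in>Str k. beam X g0 s (t mod T) (blk (t div T) h) * sym \<Delta> (code k w (t div T) (b, s)))
          \<le> card (Str k) * (Kb * (\<Delta> * (2 * real Q)))" for b
      proof -
        have "cmod (\<Sum>s\<in>Str k. beam X g0 s (t mod T) (blk (t div T) h) * sym \<Delta> (code k w (t div T) (b, s)))
          \<le> (\<Sum>s\<in>Str k. Kb * (\<Delta> * (2 * real Q)))"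
        proof (rule sum_norm_le)
          fix s assume s: "s \<in> Str k"
          have "t mod T < T" using T by simp
          then have "cmod (beam X g0 s (t mod T) (blk (t div T) h)) \<le> Kb"
            using elim(1) \<beta> s by (simp add: h_def)
          then show "cmod (beam X g0 s (t mod T) (blk (t div T) h) * sym \<Delta> (code k w (t div T) (b, s))) \<le> Kb * (\<Delta> * (2 * real Q))"
            unfolding norm_mult using sy[OF s] assms(2) by (intro mult_mono) auto
        qed
        then show ?thesis by simp
      qed
      have "norm (encoder \<Delta> n code k w h t) \<le> (\<Sum>b\<in>UNIV. cmod (encoder \<Delta> n code k w h t $ b))"
        unfolding norm_vec_def by (rule L2_set_le_sum) auto
      also have "\<dots> \<le> (\<Sum>b\<in>(UNIV::'m set). card (Str k) * (Kb * (\<Delta> * (2 * real Q))))"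
        using True comp by (intro sum_mono) (simp add: encoder_def)
      also have "\<dots> \<le> sqrt P" using P by simp
      finally show ?thesis .
    qed (simp add: encoder_def P)
    then have "(norm (encoder \<Delta> n code k w h t))\<^sup>2 \<le> (sqrt P)\<^sup>2" by (intro power_mono) auto
    then show ?case using P(2) by (simp add: w_def h_def)
  qed
  then have "(\<integral>\<^sup>+ x. ennreal ((norm (encoder \<Delta> n code k (fst x k) (snd x) t))\<^sup>2)
      \<partial>(message_law W \<Otimes>\<^sub>M channel_law \<mu> S n)) \<le> (\<integral>\<^sup>+ x. ennreal P \<partial>(message_law W \<Otimes>\<^sub>M (channel_law \<mu> S n :: ('r, 'k, 'm) csi measure)))"
    by - (rule nn_integral_mono_AE, auto elim!: eventually_mono intro: ennreal_leI)
  also have "\<dots> = ennreal P" by (simp add: MC.P.emeasure_space_1)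
  finally show ?thesis by (simp add: split_beta')
qed

text \<open>The estimate \<open>est\<close> is a function, and no sigma-algebra is fixed on its
  values. Events of the form \<open>est = v\<close> are enough: they reduce to finitely many
  coordinates, and they determine the Hamming distances, through which alone the decoder uses the
  estimate.\<close>

lemma decoder_measurable:
  assumes j: "j \<in> S"
  shows "(\<lambda>(h, y). decoder \<Delta> n m W code j h y k) \<in>
    measurable (channel_law \<mu> S n \<Otimes>\<^sub>M PiM {..<n} (\<lambda>_. borel)) (count_space UNIV)"
proof (cases "k \<in> demand j")
  case k: True
  let ?M = "channel_law \<mu> S n \<Otimes>\<^sub>M PiM {..<n} (\<lambda>_. borel) :: (('r, 'k, 'm) csi \<times> (nat \<Rightarrow> complex ^ 'm)) measure"
  define u where "u \<beta> b s x = (\<Sum>t<T. \<Sum>a\<in>UNIV. fil j k b s t a (blk \<beta> (fst x)) * (snd x (\<beta> * T + t) $ a)) /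
      (den j k b s (blk \<beta> (fst x)) * of_real \<Delta>)" for \<beta> b s and x :: "('r, 'k, 'm) csi \<times> (nat \<Rightarrow> complex ^ 'm)"
  have um: "u \<beta> b s \<in> borel_measurable ?M" if \<beta>: "\<beta> < n div T" and s: "s \<in> Str k" for \<beta> b s
  proof -
    have lt: "\<beta> * T + t < n" if "t < T" for t
    proof -
      have "\<beta> * T + t < Suc \<beta> * T" using that by simp
      also have "\<dots> \<le> n div T * T" using \<beta> by (intro mult_right_mono) auto
      also have "\<dots> \<le> n" by simp
      finally show ?thesis .
    qed
    have 1: "(\<lambda>x. f (blk \<beta> (fst x))) \<in> borel_measurable ?M" if "sep_poly Y f" for f
      by (rule measurable_compose[OF measurable_fst measurable_sep_poly_blk[OF \<beta> that]])
    have 2: "(\<lambda>x. snd x (\<beta> * T + t) $ a) \<in> borel_measurable ?M" if "t < T" for t a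
      by (intro borel_measurable_vec_nth' measurable_compose[OF measurable_snd measurable_component_singleton])
         (use lt[OF that] in simp)
    show ?thesis unfolding u_def[abs_def]
      by (intro borel_measurable_divide borel_measurable_sum borel_measurable_times 1 2 fil[OF j k s] den[OF j k s] sep_poly_const) auto
  qed
  have est_u: "est \<Delta> j k h y \<beta> = (\<lambda>(b, s)\<in>UNIV \<times> Str k. (nat \<lfloor>Re (u \<beta> b s (h, y)) + 1/2\<rfloor>, nat \<lfloor>Im (u \<beta> b s (h, y)) + 1/2\<rfloor>))" for h y \<beta>
    unfolding est_def u_def Let_def by simp
  have ev: "{x \<in> space ?M. est \<Delta> j k (fst x) (snd x) \<beta> = v} \<in> sets ?M" if \<beta>: "\<beta> < n div T" for \<beta> v
  proof (cases "v \<in> extensional (UNIV \<times> Str k)")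
    case True
    have "est \<Delta> j k (fst x) (snd x) \<beta> = v \<longleftrightarrow> (\<forall>b\<in>UNIV. \<forall>s\<in>Str k. nat \<lfloor>Re (u \<beta> b s x) + 1/2\<rfloor> = fst (v (b, s)) \<and> nat \<lfloor>Im (u \<beta> b s x) + 1/2\<rfloor> = snd (v (b, s)))" for x
    proof
      assume "est \<Delta> j k (fst x) (snd x) \<beta> = v"
      then show "\<forall>b\<in>UNIV. \<forall>s\<in>Str k. nat \<lfloor>Re (u \<beta> b s x) + 1/2\<rfloor> = fst (v (b, s)) \<and> nat \<lfloor>Im (u \<beta> b s x) + 1/2\<rfloor> = snd (v (b, s))"
        unfolding est_u by auto
    next
      assume a: "\<forall>b\<in>UNIV. \<forall>s\<in>Str k. nat \<lfloor>Re (u \<beta> b s x) + 1/2\<rfloor> = fst (v (b, s)) \<and> nat \<lfloor>Im (u \<beta> b s x) + 1/2\<rfloor> = snd (v (b, s))"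
      show "est \<Delta> j k (fst x) (snd x) \<beta> = v"
        unfolding est_u by (rule extensionalityI[OF _ True]) (use a in auto)
    qed
    then have eq: "{x \<in> space ?M. est \<Delta> j k (fst x) (snd x) \<beta> = v} = {x \<in> space ?M. \<forall>b\<in>UNIV. \<forall>s\<in>Str k. nat \<lfloor>Re (u \<beta> b s x) + 1/2\<rfloor> = fst (v (b, s)) \<and> nat \<lfloor>Im (u \<beta> b s x) + 1/2\<rfloor> = snd (v (b, s))}"
      by simp
    have "Measurable.pred ?M (\<lambda>x. nat \<lfloor>Re (u \<beta> b s x) + 1/2\<rfloor> = i)"
      "Measurable.pred ?M (\<lambda>x. nat \<lfloor>Im (u \<beta> b s x) + 1/2\<rfloor> = i)" if "s \<in> Str k" for b s i
      using um[OF \<beta> that, of b] by measurable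
    then show ?thesis unfolding eq
      by (intro predE pred_intros_finite pred_intros_logic finStr finite)
  next
    \<comment> \<open>Estimates are extensional, so for any other \<open>v\<close> the event is
      empty.\<close>
    case False
    have "est \<Delta> j k h y \<beta> \<in> extensional (UNIV \<times> Str k)" for h y unfolding est_def by simp
    then have "est \<Delta> j k h y \<beta> \<noteq> v" for h y using False by metis
    then show ?thesis by simp
  qed
  have hm: "(\<lambda>x. hdist (n div T) (code k w) (est \<Delta> j k (fst x) (snd x))) \<in> measurable ?M (count_space UNIV)" for w
    unfolding hdist_def
  proof (rule measurable_card)
    fix \<beta>
    show "{x \<in> space ?M. \<beta> \<in> {\<beta>. \<beta> < n div T \<and> code k w \<beta> \<noteq> est \<Delta> j k (fst x) (snd x) \<beta>}} \<in> sets ?M"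
    proof (cases "\<beta> < n div T")
      case True
      have "{x \<in> space ?M. \<beta> \<in> {\<beta>. \<beta> < n div T \<and> code k w \<beta> \<noteq> est \<Delta> j k (fst x) (snd x) \<beta>}} =
        space ?M - {x \<in> space ?M. est \<Delta> j k (fst x) (snd x) \<beta> = code k w \<beta>}" using True by auto
      then show ?thesis using ev[OF True] by auto
    qed simp
  qed
  have "(\<lambda>x. LEAST w. w < W k \<and> hdist (n div T) (code k w) (est \<Delta> j k (fst x) (snd x)) \<le> m) \<in> measurable ?M (count_space UNIV)"
  proof (rule measurable_Least)
    show "Measurable.pred ?M (\<lambda>x. w < W k \<and> hdist (n div T) (code k w) (est \<Delta> j k (fst x) (snd x)) \<le> m)" for w
      by (rule measurable_compose[OF hm[of w], of "\<lambda>i. w < W k \<and> i \<le> m"]) simp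
  qed
  moreover have "(\<lambda>(h, y). decoder \<Delta> n m W code j h y k) =
      (\<lambda>x. LEAST w. w < W k \<and> hdist (n div T) (code k w) (est \<Delta> j k (fst x) (snd x)) \<le> m)"
    by (rule ext) (simp only: decoder_def k if_True case_prod_beta)
  ultimately show ?thesis by (simp only:)
qed (simp add: decoder_def split_beta')

lemma hdist_triangle: "hdist B x z \<le> hdist B x y + hdist B y z"
proof -
  have "hdist B x z \<le> card ({\<beta>. \<beta> < B \<and> x \<beta> \<noteq> y \<beta>} \<union> {\<beta>. \<beta> < B \<and> y \<beta> \<noteq> z \<beta>})"
    unfolding hdist_def by (intro card_mono) auto
  also have "\<dots> \<le> hdist B x y + hdist B y z" unfolding hdist_def by (rule card_Un_le)
  finally show ?thesis .
qed

text \<open>In a block with good channel and good noise the filtered noise has modulus at most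
  \<open>G * G\<close>, less than half the spacing \<open>\<Delta>\<close>, so rounding is exact. At
  most \<open>m\<close> letters are then wrong, and balls of radius \<open>m\<close> around
  codewords at distance above \<open>2 * m\<close> do not meet.\<close>

lemma decoder_correct:
  assumes G: "0 < G" and \<Delta>: "\<Delta> = 2 * G\<^sup>2 + 1"
    and h: "h \<in> space (channel_law \<mu> S n)" and z: "z \<in> space (noise_law S n)"
    and few: "card {\<beta>\<in>{..<n div T}. blk \<beta> h \<in> bad_csi G} + card {\<beta>\<in>{..<n div T}. nblk \<beta> z \<in> bad_noise G} \<le> m"
    and w: "\<And>k. w k < W k"
    and code: "\<And>k i. k \<in> (\<Union>j\<in>S. demand j) \<Longrightarrow> i < W k \<Longrightarrow> code k i \<in> {..<n div T} \<rightarrow>\<^sub>E letters k Q"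
      "\<And>k i i'. k \<in> (\<Union>j\<in>S. demand j) \<Longrightarrow> i < W k \<Longrightarrow> i' < W k \<Longrightarrow> i \<noteq> i' \<Longrightarrow> 2 * m < hdist (n div T) (code k i) (code k i')"
    and j: "j \<in> S" and k: "k \<in> demand j"
  shows "decoder \<Delta> n m W code j h (\<lambda>t\<in>{..<n}. received (\<lambda>k. encoder \<Delta> n code k (w k) h) h z j t) k = w k"
proof -
  define y where "y = (\<lambda>t\<in>{..<n}. received (\<lambda>k. encoder \<Delta> n code k (w k) h) h z j t)"
  have kU: "k \<in> (\<Union>j\<in>S. demand j)" using j k by blast
  have good: "est \<Delta> j k h y \<beta> = code k (w k) \<beta>"
    if \<beta>: "\<beta> < n div T" and gh: "blk \<beta> h \<notin> bad_csi G" and gz: "nblk \<beta> z \<notin> bad_noise G" for \<beta>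
  proof -
    have lt: "\<beta> * T + t < n div T * T" if "t < T" for t
    proof -
      have "\<beta> * T + t < Suc \<beta> * T" using that by simp
      also have "\<dots> \<le> n div T * T" using \<beta> by (intro mult_right_mono) auto
      finally show ?thesis .
    qed
    have ltn: "\<beta> * T + t < n" if "t < T" for t using lt[OF that] by (meson div_times_less_eq_dividend less_le_trans)
    have bs: "blk \<beta> h \<in> space (PiM Y (\<lambda>_. \<mu>))" by (rule measurable_space[OF measurable_blk[OF \<beta>] h])
    have ns: "nblk \<beta> z \<in> space (PiM Z (\<lambda>_. std_complex_normal))" by (auto simp: nblk_def space_PiM)
    have gain: "gain (blk \<beta> h) \<le> G" and nz: "\<And>b s. s \<in> Str k \<Longrightarrow> den j k b s (blk \<beta> h) \<noteq> 0"
      using gh bs j k by (auto simp: bad_csi_def not_less)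
    have noise: "noise_size (nblk \<beta> z) \<le> G" using gz ns by (auto simp: bad_noise_def not_less)
    have blk: "blk \<beta> h (t, j, k', a, b) = h (\<beta> * T + t, j, k', a, b)" if "t < T" for t k' a b
      using that j by (simp add: blk_def csi_index_def shift_time_def)
    have nblk: "nblk \<beta> z (t, j, a) = z (\<beta> * T + t, j, a)" if "t < T" for t a
      using that j by (simp add: nblk_def noise_index_def shift_time_def)
    show ?thesis
    proof (rule extensionalityI[where A = "(UNIV :: 'm set) \<times> Str k"])
      show "est \<Delta> j k h y \<beta> \<in> extensional (UNIV \<times> Str k)" by (simp add: est_def)
      show "code k (w k) \<beta> \<in> extensional (UNIV \<times> Str k)"
        using code(1)[OF kU w] \<beta> by (auto simp: letters_def PiE_iff)
      fix bs assume "bs \<in> (UNIV :: 'm set) \<times> Str k"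
      then obtain b s where bs: "bs = (b, s)" and s: "s \<in> Str k" by auto
      define D where "D = den j k b s (blk \<beta> h)"
      define v where "v = (\<Sum>t<T. \<Sum>a\<in>UNIV. fil j k b s t a (blk \<beta> h) * nblk \<beta> z (t, j, a))"
      define l where "l = code k (w k) \<beta> (b, s)"
      have D0: "D \<noteq> 0" using nz[OF s] by (simp add: D_def)
      have "(\<Sum>t<T. \<Sum>a\<in>UNIV. fil j k b s t a (blk \<beta> h) * (y (\<beta> * T + t) $ a)) =
        (\<Sum>t<T. \<Sum>a\<in>UNIV. fil j k b s t a (blk \<beta> h) * (\<Sum>k'\<in>UNIV. \<Sum>b'\<in>UNIV. blk \<beta> h (t, j, k', a, b') *
          (\<Sum>s'\<in>Str k'. beam X g0 s' t (blk \<beta> h) * sym \<Delta> (code k' (w k') \<beta> (b', s')))) + fil j k b s t a (blk \<beta> h) * nblk \<beta> z (t, j, a))"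
        using lt ltn T
        by (intro sum.cong refl) (simp add: y_def received_nth encoder_def blk nblk distrib_left)
      also have "\<dots> = D * sym \<Delta> l + v"
        unfolding sum.distrib v_def D_def l_def
        using zf[OF j k s, of b "blk \<beta> h" "\<lambda>k' b' s'. sym \<Delta> (code k' (w k') \<beta> (b', s'))"] by simp
      finally have u: "(\<Sum>t<T. \<Sum>a\<in>UNIV. fil j k b s t a (blk \<beta> h) * (y (\<beta> * T + t) $ a)) / (D * of_real \<Delta>)
          = sym \<Delta> l / of_real \<Delta> + v / (D * of_real \<Delta>)"
        using D0 \<Delta> by (simp add: add_divide_distrib)
      have \<Delta>0: "0 < \<Delta>" unfolding \<Delta> using zero_le_power2[of G] by linarith
      have vb: "cmod (v / D) \<le> G * G"
      proof -
        have "v / D = (\<Sum>t<T. \<Sum>a\<in>UNIV. fil j k b s t a (blk \<beta> h) / D * nblk \<beta> z (t, j, a))"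
          unfolding v_def by (simp add: sum_divide_distrib)
        then have "cmod (v / D) \<le> (\<Sum>t<T. \<Sum>a\<in>UNIV. cmod (fil j k b s t a (blk \<beta> h) / D) * noise_size (nblk \<beta> z))"
        proof (simp only:, intro sum_norm_le)
          fix t a assume t: "t \<in> {..<T}"
          have "cmod (nblk \<beta> z (t, j, a)) \<le> noise_size (nblk \<beta> z)"
            unfolding noise_size_def using t j by (intro member_le_sum) (auto simp: noise_index_def)
          then show "cmod (fil j k b s t a (blk \<beta> h) / D * nblk \<beta> z (t, j, a)) \<le> cmod (fil j k b s t a (blk \<beta> h) / D) * noise_size (nblk \<beta> z)"
            unfolding norm_mult by (intro mult_left_mono) auto
        qed
        also have "\<dots> = (\<Sum>t<T. \<Sum>a\<in>UNIV. cmod (fil j k b s t a (blk \<beta> h) / D)) * noise_size (nblk \<beta> z)"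
          by (simp add: sum_distrib_right)
        also have "\<dots> \<le> gain (blk \<beta> h) * noise_size (nblk \<beta> z)"
        proof (rule mult_right_mono)
          let ?f = "\<lambda>j k b s. \<Sum>t<T. \<Sum>a\<in>UNIV. cmod (fil j k b s t a (blk \<beta> h) / den j k b s (blk \<beta> h))"
          have "?f j k b s \<le> (\<Sum>s\<in>Str k. ?f j k b s)" using s finStr by (intro member_le_sum) (auto intro!: sum_nonneg)
          also have "\<dots> \<le> (\<Sum>b\<in>UNIV. \<Sum>s\<in>Str k. ?f j k b s)"
            by (rule member_le_sum[where f = "\<lambda>b. \<Sum>s\<in>Str k. ?f j k b s"]) (auto intro!: sum_nonneg)
          also have "\<dots> \<le> (\<Sum>k\<in>demand j. \<Sum>b\<in>UNIV. \<Sum>s\<in>Str k. ?f j k b s)"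
            by (rule member_le_sum[where f = "\<lambda>k. \<Sum>b\<in>UNIV. \<Sum>s\<in>Str k. ?f j k b s"]) (use k in \<open>auto intro!: sum_nonneg\<close>)
          also have "\<dots> \<le> gain (blk \<beta> h)" unfolding gain_def
            by (rule member_le_sum[where f = "\<lambda>j. \<Sum>k\<in>demand j. \<Sum>b\<in>UNIV. \<Sum>s\<in>Str k. ?f j k b s"]) (use j in \<open>auto intro!: sum_nonneg\<close>)
          finally show "(\<Sum>t<T. \<Sum>a\<in>UNIV. cmod (fil j k b s t a (blk \<beta> h) / D)) \<le> gain (blk \<beta> h)" by (simp add: D_def)
        qed (simp add: noise_size_def sum_nonneg)
        also have "\<dots> \<le> G * G" using gain noise G by (intro mult_mono) (auto simp: noise_size_def sum_nonneg)
        finally show ?thesis .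
      qed
      have "cmod (v / (D * of_real \<Delta>)) = cmod (v / D) / \<Delta>" using \<Delta>0 by (simp add: norm_divide norm_mult)
      also have "\<dots> \<le> G * G / \<Delta>" using vb \<Delta>0 by (intro divide_right_mono) auto
      also have "\<dots> < 1/2" using \<Delta>0 unfolding \<Delta> by (simp add: field_simps power2_eq_square)
      finally have small: "cmod (v / (D * of_real \<Delta>)) < 1/2" .
      have sy: "sym \<Delta> l / of_real \<Delta> = Complex (real (fst l)) (real (snd l))" using \<Delta>0 by (simp add: sym_def)
      have re: "\<bar>Re (sym \<Delta> l / of_real \<Delta> + v / (D * of_real \<Delta>)) - real (fst l)\<bar> < 1/2"
        unfolding sy using abs_Re_le_cmod[of "v / (D * of_real \<Delta>)"] small by (simp del: Re_divide_of_real)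
      have im: "\<bar>Im (sym \<Delta> l / of_real \<Delta> + v / (D * of_real \<Delta>)) - real (snd l)\<bar> < 1/2"
        unfolding sy using abs_Im_le_cmod[of "v / (D * of_real \<Delta>)"] small by (simp del: Im_divide_of_real)
      have "est \<Delta> j k h y \<beta> (b, s) = (fst l, snd l)"
        unfolding est_def Let_def using s by (simp only: restrict_apply mem_Times_iff UNIV_I fst_conv snd_conv
          simp_thms if_True prod.case u[unfolded D_def] round_exact[OF re[unfolded D_def]] round_exact[OF im[unfolded D_def]])
      then show "est \<Delta> j k h y \<beta> bs = code k (w k) \<beta> bs" by (simp add: l_def bs)
    qed
  qed
  have "hdist (n div T) (code k (w k)) (est \<Delta> j k h y) \<le>
      card ({\<beta>\<in>{..<n div T}. blk \<beta> h \<in> bad_csi G} \<union> {\<beta>\<in>{..<n div T}. nblk \<beta> z \<in> bad_noise G})"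
    unfolding hdist_def using good by (intro card_mono) force+
  also have "\<dots> \<le> m" using few card_Un_le order_trans by blast
  finally have d1: "hdist (n div T) (code k (w k)) (est \<Delta> j k h y) \<le> m" .
  have "(LEAST w. w < W k \<and> hdist (n div T) (code k w) (est \<Delta> j k h y) \<le> m) = w k"
  proof (rule Least_equality)
    show "w k < W k \<and> hdist (n div T) (code k (w k)) (est \<Delta> j k h y) \<le> m" using w d1 by simp
    fix i assume i: "i < W k \<and> hdist (n div T) (code k i) (est \<Delta> j k h y) \<le> m"
    have "hdist (n div T) (code k i) (code k (w k)) \<le> 2 * m"
      using hdist_triangle[of "n div T" "code k i" "code k (w k)" "est \<Delta> j k h y"] i d1
      by (simp add: hdist_commute)
    then have "i = w k" using code(2)[OF kU _ w] i by (meson not_le)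
    then show "w k \<le> i" by simp
  qed
  then show ?thesis using k by (simp add: decoder_def y_def[symmetric])
qed

end

section \<open>Error probability and rates of the block code\<close>

lemma trivial_code:
  assumes "0 \<le> P"
  shows "valid_encoders \<mu> S P n W (\<lambda>_ _ _ _. 0)" "valid_decoders \<mu> S n (\<lambda>_ _ _ _. 0)"
  using assms by (auto simp: valid_encoders_def valid_decoders_def split_beta')

text \<open>Union bound over three exceptional sets: messages out of range, which have probability
  zero, bad channels and bad noises. Measurability is asked of the covering set, not of the error
  event itself.\<close>

lemma error_probability_le:
  fixes enc :: "('r::finite, 'k::finite, 'm::finite) encoders" and dec :: "('r, 'k, 'm) decoders"
  assumes "prob_space \<mu>"
    and W: "\<And>k. 0 < W k"
    and A: "A \<in> sets (channel_law \<mu> S n)" and B: "B \<in> sets (noise_law S n)"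
    and correct: "\<And>w h z j k. (\<And>k. w k < W k) \<Longrightarrow> h \<in> space (channel_law \<mu> S n) - A \<Longrightarrow>
       z \<in> space (noise_law S n) - B \<Longrightarrow> j \<in> S \<Longrightarrow> k \<in> demand j \<Longrightarrow>
       dec j h (\<lambda>t\<in>{..<n}. received (\<lambda>k. enc k (w k) h) h z j t) k = w k"
  shows "ennreal (error_probability \<mu> S demand n W enc dec) \<le> emeasure (channel_law \<mu> S n) A + emeasure (noise_law S n) B"
proof -
  interpret C: prob_space "channel_law \<mu> S n :: ('r, 'k, 'm) csi measure" by (rule prob_space_channel_law[OF assms(1)])
  interpret Z: prob_space "noise_law S n :: ('r, 'm) noise measure" by (rule prob_space_noise_law)
  interpret M: prob_space "message_law W" by (rule prob_space_message_law)
  interpret CZ: pair_prob_space "channel_law \<mu> S n :: ('r, 'k, 'm) csi measure" "noise_law S n :: ('r, 'm) noise measure" ..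
  let ?CZ = "(channel_law \<mu> S n :: ('r, 'k, 'm) csi measure) \<Otimes>\<^sub>M (noise_law S n :: ('r, 'm) noise measure)"
  interpret \<Omega>: pair_prob_space "message_law W" ?CZ ..
  let ?E = "{(w, h, z) \<in> space (message_law W \<Otimes>\<^sub>M ?CZ). \<exists>j\<in>S. \<exists>k\<in>demand j.
           dec j h (\<lambda>t\<in>{..<n}. received (\<lambda>k. enc k (w k) h) h z j t) k \<noteq> w k}"
  let ?V = "{w. \<not> (\<forall>k. w k < W k)}"
  let ?F = "(?V \<times> space ?CZ) \<union> (UNIV \<times> ((A \<times> space (noise_law S n)) \<union> (space (channel_law \<mu> S n) \<times> B)))"
  have V: "?V \<in> sets (message_law W)" by (simp add: message_law_def)
  have V0: "emeasure (message_law W) ?V = 0"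
    using AE_message_law[of W] W V by (subst (asm) AE_iff_measurable[of ?V]) auto
  have AB: "(A \<times> space (noise_law S n)) \<union> (space (channel_law \<mu> S n) \<times> B) \<in> sets ?CZ"
    using A B by auto
  have U: "UNIV \<in> sets (message_law W)" by (simp add: message_law_def)
  have "?E \<subseteq> ?F"
  proof (rule subsetI, rule ccontr)
    fix x assume x: "x \<in> ?E" "x \<notin> ?F"
    obtain w h z where x_def: "x = (w, h, z)" by (cases x) auto
    from x(1) obtain j k where jk: "j \<in> S" "k \<in> demand j" "dec j h (\<lambda>t\<in>{..<n}. received (\<lambda>k. enc k (w k) h) h z j t) k \<noteq> w k"
      by (auto simp: x_def)
    have sp: "h \<in> space (channel_law \<mu> S n)" "z \<in> space (noise_law S n)"
      using x(1) by (auto simp: x_def space_pair_measure)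
    have "\<And>k. w k < W k" "h \<notin> A" "z \<notin> B"
      using x(2) sp by (auto simp: x_def space_pair_measure)
    then show False using correct[of w h z j k] sp jk by blast
  qed
  then have "emeasure (message_law W \<Otimes>\<^sub>M ?CZ) ?E \<le> emeasure (message_law W \<Otimes>\<^sub>M ?CZ) ?F"
    using V AB U by (intro emeasure_mono) auto
  also have "\<dots> \<le> emeasure (message_law W \<Otimes>\<^sub>M ?CZ) (?V \<times> space ?CZ) +
      emeasure (message_law W \<Otimes>\<^sub>M ?CZ) (UNIV \<times> ((A \<times> space (noise_law S n)) \<union> (space (channel_law \<mu> S n) \<times> B)))"
    using V AB U by (intro emeasure_subadditive) auto
  also have "\<dots> = emeasure ?CZ ((A \<times> space (noise_law S n)) \<union> (space (channel_law \<mu> S n) \<times> B))"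
    using V V0 AB U M.emeasure_space_1 by (simp add: CZ.P.emeasure_pair_measure_Times)
  also have "\<dots> \<le> emeasure ?CZ (A \<times> space (noise_law S n)) + emeasure ?CZ (space (channel_law \<mu> S n) \<times> B)"
    using A B by (intro emeasure_subadditive) auto
  also have "\<dots> = emeasure (channel_law \<mu> S n) A + emeasure (noise_law S n) B"
    using A B by (simp add: Z.emeasure_pair_measure_Times Z.emeasure_space_1 C.emeasure_space_1)
  finally show ?thesis
    unfolding error_probability_def Let_def by (simp add: \<Omega>.P.emeasure_eq_measure)
qed

context alignment_scheme
begin

lemma block_code:
  assumes \<theta>: "0 < \<theta>"
  obtains \<kappa> where "0 < \<kappa>"
    "\<And>P Q n (W :: 'k \<Rightarrow> nat). \<kappa> * real Q \<le> sqrt P \<Longrightarrow> 0 \<le> P \<Longrightarrow> 1 \<le> Q \<Longrightarrow> (\<And>k. 0 < W k) \<Longrightarrow>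
      (\<And>k. k \<in> (\<Union>j\<in>S. demand j) \<Longrightarrow> gv_bound (n div T) (2 * nat \<lfloor>2 * \<theta> * real (n div T)\<rfloor>) (card (letters k Q)) (W k)) \<Longrightarrow>
      \<exists>(enc :: ('r, 'k, 'm) encoders) (dec :: ('r, 'k, 'm) decoders).
        valid_encoders \<mu> S P n W enc \<and> valid_decoders \<mu> S n dec \<and>
        error_probability \<mu> S demand n W enc dec \<le> 2 * (1/2) ^ (n div T)"
proof -
  \<comment> \<open>The level \<open>4 powr (- 1 / \<theta>)\<close> is the one
    \<open>many_bad_blocks\<close> asks for. Channel and noise may each spoil a fraction \<theta> of
    the blocks, hence \<open>2 * \<theta>\<close> in the number of correctable letters.\<close>
  obtain G where G: "0 < G" "emeasure (PiM Y (\<lambda>_. \<mu>)) (bad_csi G) \<le> ennreal (4 powr (- 1 / \<theta>))"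
    "emeasure (PiM Z (\<lambda>_. std_complex_normal)) (bad_noise G) \<le> ennreal (4 powr (- 1 / \<theta>))"
    by (rule exists_small_bad[of "4 powr (- 1 / \<theta>)"]) auto
  obtain Kb where Kb: "0 < Kb" "AE h in PiM Y (\<lambda>_. \<mu>). \<forall>k\<in>UNIV. \<forall>s\<in>Str k. \<forall>t\<in>{..<T}. cmod (beam X g0 s t h) \<le> Kb"
    by (rule bounded_beam)
  \<comment> \<open>Half the spacing must exceed the filtered noise bound \<open>G * G\<close>; the
    1 makes this strict.\<close>
  define \<Delta> where "\<Delta> = 2 * G\<^sup>2 + 1"
  have \<Delta>0: "0 < \<Delta>" unfolding \<Delta>_def using zero_le_power2[of G] by linarith
  \<comment> \<open>Amplitude per unit of \<open>Q\<close>: a factor for the antennas, one for the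
    streams, the beam bound, the spacing, and 2 for the real and imaginary parts. Adding 1 keeps it
    positive even without streams.\<close>
  define \<kappa> where "\<kappa> = CARD('m) * ((\<Sum>k\<in>UNIV. card (Str k)) * (Kb * (\<Delta> * 2))) + 1"
  have \<kappa>0: "0 < \<kappa>" unfolding \<kappa>_def using Kb(1) \<Delta>0
    by (intro add_nonneg_pos mult_nonneg_nonneg) (auto intro: sum_nonneg)
  show ?thesis
  proof (rule that[OF \<kappa>0])
    fix P :: real and Q n :: nat and W :: "'k \<Rightarrow> nat"
    assume P: "\<kappa> * real Q \<le> sqrt P" "0 \<le> P" and Q: "1 \<le> Q" and W: "\<And>k. 0 < W k"
      and ex: "\<And>k. k \<in> (\<Union>j\<in>S. demand j) \<Longrightarrow> gv_bound (n div T) (2 * nat \<lfloor>2 * \<theta> * real (n div T)\<rfloor>) (card (letters k Q)) (W k)"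
    define m where "m = nat \<lfloor>2 * \<theta> * real (n div T)\<rfloor>"
    have cl: "1 \<le> card (letters k Q)" for k unfolding card_letters using Q by simp
    have "\<exists>code. (\<forall>i<W k. code i \<in> {..<n div T} \<rightarrow>\<^sub>E letters k Q) \<and> (k \<in> (\<Union>j\<in>S. demand j) \<longrightarrow>
      (\<forall>i<W k. \<forall>i'<W k. i \<noteq> i' \<longrightarrow> 2 * m < hdist (n div T) (code i) (code i')))" for k
    proof (cases "k \<in> (\<Union>j\<in>S. demand j)")
      case True
      show ?thesis using gilbert_varshamov[OF finite_letters cl ex[OF True]] True unfolding m_def by blast
    next
      \<comment> \<open>Nobody decodes this message, so one constant word of valid letters serves
        all its values.\<close>
      case False
      have "letters k Q \<noteq> {}" using cl[of k] by auto
      then obtain l where "l \<in> letters k Q" by blast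
      then have "(\<lambda>\<beta>\<in>{..<n div T}. l) \<in> {..<n div T} \<rightarrow>\<^sub>E letters k Q" by auto
      with False show ?thesis by (intro exI[of _ "\<lambda>_. \<lambda>\<beta>\<in>{..<n div T}. l"]) simp
    qed
    then obtain code where code: "\<And>k i. i < W k \<Longrightarrow> code k i \<in> {..<n div T} \<rightarrow>\<^sub>E letters k Q"
      "\<And>k i i'. k \<in> (\<Union>j\<in>S. demand j) \<Longrightarrow> i < W k \<Longrightarrow> i' < W k \<Longrightarrow> i \<noteq> i' \<Longrightarrow> 2 * m < hdist (n div T) (code k i) (code k i')"
      by metis
    have "valid_encoders \<mu> S P n W (encoder \<Delta> n code)"
      unfolding valid_encoders_def
    proof (intro conjI allI impI)
      show "(\<lambda>h. encoder \<Delta> n code k w h t) \<in> borel_measurable (channel_law \<mu> S n)" for k w t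
        by (rule encoder_measurable)
      fix k t
      have "card (Str k) \<le> (\<Sum>k\<in>UNIV. card (Str k))" by (rule member_le_sum) auto
      then have "CARD('m) * (card (Str k) * (Kb * (\<Delta> * (2 * real Q)))) \<le> CARD('m) * ((\<Sum>k\<in>UNIV. card (Str k)) * (Kb * (\<Delta> * (2 * real Q))))"
        using Kb(1) \<Delta>0 by (intro mult_left_mono mult_right_mono) (auto simp del: of_nat_sum)
      also have "\<dots> \<le> \<kappa> * real Q" by (simp add: \<kappa>_def algebra_simps)
      also note P(1)
      finally show "(\<integral>\<^sup>+ (w, h). ennreal ((norm (encoder \<Delta> n code k (w k) h t))\<^sup>2)
                  \<partial>(message_law W \<Otimes>\<^sub>M channel_law \<mu> S n)) \<le> ennreal P"
        by (intro encoder_power[where Q = Q and Kb = Kb] Kb \<Delta>0 code(1) W P(2))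
    qed
    moreover have "valid_decoders \<mu> S n (decoder \<Delta> n m W code)"
      unfolding valid_decoders_def by (auto intro: decoder_measurable)
    moreover have "error_probability \<mu> S demand n W (encoder \<Delta> n code) (decoder \<Delta> n m W code) \<le> 2 * (1/2) ^ (n div T)"
    proof -
      let ?A = "{h \<in> space (channel_law \<mu> S n). \<theta> * card {..<n div T} \<le> card {\<beta>\<in>{..<n div T}. blk \<beta> h \<in> bad_csi G}}"
      let ?B = "{z \<in> space (noise_law S n). \<theta> * card {..<n div T} \<le> card {\<beta>\<in>{..<n div T}. nblk \<beta> z \<in> bad_noise G}}"
      have dY: "disjoint_family_on (\<lambda>\<beta>. shift_time (\<beta> * T) ` Y) {..<n div T}"
        "disjoint_family_on (\<lambda>\<beta>. shift_time (\<beta> * T) ` Z) {..<n div T}"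
        by (intro disjoint_shift_time, auto simp: csi_index_def noise_index_def)+
      note mbY = many_bad_blocks[where Bs = "{..<n div T}" and \<sigma> = "\<lambda>\<beta>. shift_time (\<beta> * T)" and K = "csi_index S n",
          OF \<mu>D(1) finite_lessThan finite_index(1) inj_shift_time
          shift_time_index(1)[OF lessThan_iff[THEN iffD1]] dY(1) sets_bad_csi \<theta> G(2)]
      note mbZ = many_bad_blocks[where Bs = "{..<n div T}" and \<sigma> = "\<lambda>\<beta>. shift_time (\<beta> * T)" and K = "noise_index S n",
          OF prob_space_std_complex_normal finite_lessThan finite_index(2) inj_shift_time
          shift_time_index(2)[OF lessThan_iff[THEN iffD1]] dY(2) sets_bad_noise \<theta> G(3)]
      have A: "?A \<in> sets (channel_law \<mu> S n)" "emeasure (channel_law \<mu> S n) ?A \<le> ennreal ((1/2) ^ (n div T))"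
        unfolding channel_law_alt blk_def using mbY[unfolded card_lessThan] unfolding card_lessThan by blast+
      have B: "?B \<in> sets (noise_law S n)" "emeasure (noise_law S n) ?B \<le> ennreal ((1/2) ^ (n div T))"
        unfolding noise_law_alt nblk_def using mbZ[unfolded card_lessThan] unfolding card_lessThan by blast+
      have "ennreal (error_probability \<mu> S demand n W (encoder \<Delta> n code) (decoder \<Delta> n m W code))
        \<le> emeasure (channel_law \<mu> S n) ?A + emeasure (noise_law S n) ?B"
      proof (rule error_probability_le[OF \<mu>D(1) W A(1) B(1)])
        fix w h z j k assume w: "\<And>k. w k < W k" and h: "h \<in> space (channel_law \<mu> S n) - ?A"
          and z: "z \<in> space (noise_law S n) - ?B" and jk: "j \<in> S" "k \<in> demand j"
        have "real (card {\<beta>\<in>{..<n div T}. blk \<beta> h \<in> bad_csi G} + card {\<beta>\<in>{..<n div T}. nblk \<beta> z \<in> bad_noise G}) \<le> 2 * \<theta> * real (n div T)"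
        proof -
          have "real (card {\<beta>\<in>{..<n div T}. blk \<beta> h \<in> bad_csi G}) < \<theta> * real (n div T)"
            using h by (simp only: Diff_iff mem_Collect_eq card_lessThan) linarith
          moreover have "real (card {\<beta>\<in>{..<n div T}. nblk \<beta> z \<in> bad_noise G}) < \<theta> * real (n div T)"
            using z by (simp only: Diff_iff mem_Collect_eq card_lessThan) linarith
          ultimately show ?thesis unfolding of_nat_add by linarith
        qed
        then have few: "card {\<beta>\<in>{..<n div T}. blk \<beta> h \<in> bad_csi G} + card {\<beta>\<in>{..<n div T}. nblk \<beta> z \<in> bad_noise G} \<le> m"
          unfolding m_def by (simp only: le_nat_floor)
        show "decoder \<Delta> n m W code j h (\<lambda>t\<in>{..<n}. received (\<lambda>k. encoder \<Delta> n code k (w k) h) h z j t) k = w k"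
          by (rule decoder_correct[OF G(1) \<Delta>_def _ _ few w code(1) code(2) jk]) (use h z in auto)
      qed
      also have "\<dots> \<le> ennreal ((1/2) ^ (n div T)) + ennreal ((1/2) ^ (n div T))" by (intro add_mono A B)
      also have "\<dots> = ennreal (2 * (1/2) ^ (n div T))" by (simp add: ennreal_plus[symmetric] del: ennreal_plus)
      finally show ?thesis by (simp add: ennreal_le_iff)
    qed
    ultimately show "\<exists>(enc :: ('r, 'k, 'm) encoders) (dec :: ('r, 'k, 'm) decoders).
        valid_encoders \<mu> S P n W enc \<and> valid_decoders \<mu> S n dec \<and>
        error_probability \<mu> S demand n W enc dec \<le> 2 * (1/2) ^ (n div T)" by blast
  qed
qed

text \<open>This is the logarithm of the Gilbert--Varshamov count per block: the messages use
  \<open>T * R $ k\<close>, the position sets 1, and the excluded radius \<open>2 * m\<close>, at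
  most \<open>4 * \<theta>\<close> times the number of blocks, uses the fraction
  \<open>4 * \<theta>\<close> of \<open>log 2 (card (letters k Q))\<close>.\<close>

lemma achievable_rates:
  assumes \<theta>: "0 < \<theta>"
  obtains \<kappa> where "0 < \<kappa>"
    "\<And>P Q (R :: real ^ 'k). \<kappa> * real Q \<le> sqrt P \<Longrightarrow> 0 \<le> P \<Longrightarrow> 1 \<le> Q \<Longrightarrow> (\<And>k. 0 \<le> R $ k) \<Longrightarrow>
      (\<And>k. k \<in> (\<Union>j\<in>S. demand j) \<Longrightarrow> R $ k = 0 \<or> T * R $ k < (1 - 4 * \<theta>) * log 2 (card (letters k Q)) - 1) \<Longrightarrow>
      achievable TYPE('m) \<mu> S demand P R"
proof -
  obtain \<kappa> where \<kappa>: "0 < \<kappa>" and bc: "\<And>P Q n (W :: 'k \<Rightarrow> nat). \<kappa> * real Q \<le> sqrt P \<Longrightarrow> 0 \<le> P \<Longrightarrow> 1 \<le> Q \<Longrightarrow> (\<And>k. 0 < W k) \<Longrightarrow>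
      (\<And>k. k \<in> (\<Union>j\<in>S. demand j) \<Longrightarrow> gv_bound (n div T) (2 * nat \<lfloor>2 * \<theta> * real (n div T)\<rfloor>) (card (letters k Q)) (W k)) \<Longrightarrow>
      \<exists>(enc :: ('r, 'k, 'm) encoders) (dec :: ('r, 'k, 'm) decoders).
        valid_encoders \<mu> S P n W enc \<and> valid_decoders \<mu> S n dec \<and>
        error_probability \<mu> S demand n W enc dec \<le> 2 * (1/2) ^ (n div T)"
    using block_code[OF \<theta>] by metis
  have div_lim: "filterlim (\<lambda>n. n div T) at_top sequentially"
    unfolding filterlim_at_top
  proof
    fix z
    have "z \<le> n div T" if "z * T \<le> n" for n using T that by (simp add: less_eq_div_iff_mult_less_eq)
    then show "\<forall>\<^sub>F n in sequentially. z \<le> n div T" using eventually_ge_at_top[of "z * T"] by (rule eventually_mono[rotated])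
  qed
  show ?thesis
  proof (rule that[OF \<kappa>])
    fix P :: real and Q :: nat and R :: "real ^ 'k"
    assume P: "\<kappa> * real Q \<le> sqrt P" "0 \<le> P" and Q: "1 \<le> Q" and R0: "\<And>k. 0 \<le> R $ k"
      and R: "\<And>k. k \<in> (\<Union>j\<in>S. demand j) \<Longrightarrow> R $ k = 0 \<or> T * R $ k < (1 - 4 * \<theta>) * log 2 (card (letters k Q)) - 1"
    define W where "W = (\<lambda>n k. nat \<lceil>2 powr (real n * R $ k)\<rceil>)"
    have W1: "0 < W n k" for n k by (simp add: W_def)
    have ev: "\<forall>\<^sub>F n in sequentially. gv_bound (n div T) (2 * nat \<lfloor>2 * \<theta> * real (n div T)\<rfloor>) (card (letters k Q)) (W n k)"
      if k: "k \<in> (\<Union>j\<in>S. demand j)" for k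
    proof (cases "R $ k = 0")
      case True then show ?thesis by (simp add: W_def)
    next
      case False
      define q where "q = card (letters k Q)"
      define lq where "lq = log 2 (real q)"
      have q1: "1 \<le> q" unfolding q_def card_letters using Q by simp
      have q: "real q = 2 powr lq" using q1 by (simp add: lq_def)
      have lq0: "0 \<le> lq" using q1 by (simp add: lq_def)
      \<comment> \<open>The slack per block. After enough blocks it outweighs the incomplete last
        block, which costs \<open>T * R $ k\<close>, and the rounding of the number of messages,
        which costs one bit.\<close>
      define \<delta> where "\<delta> = (1 - 4 * \<theta>) * lq - 1 - T * R $ k"
      have \<delta>: "0 < \<delta>" using R[OF k] False by (simp add: \<delta>_def lq_def q_def)
      have "\<forall>\<^sub>F n in sequentially. (T * R $ k + 1) / \<delta> \<le> real (n div T)"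
        using filterlim_compose[OF filterlim_real_sequentially div_lim] unfolding filterlim_at_top by simp
      then show ?thesis
      proof eventually_elim
        case (elim n)
        define B where "B = n div T"
        define m where "m = nat \<lfloor>2 * \<theta> * real B\<rfloor>"
        have m: "real m \<le> 2 * \<theta> * B" unfolding m_def using \<theta> by simp
        have n: "real n \<le> (real B + 1) * T"
        proof -
          have "n = B * T + n mod T" by (simp add: B_def)
          also have "\<dots> \<le> B * T + T" using T by (simp add: less_imp_le)
          finally have "real n \<le> real (B * T + T)" by (rule of_nat_mono)
          then show ?thesis by (simp add: algebra_simps)
        qed
        have "real (W n k) \<le> 2 powr (n * R $ k) + 1" unfolding W_def by (simp add: of_nat_nat)
        also have "\<dots> \<le> 2 powr (n * R $ k) + 2 powr (n * R $ k)"
          using R0[of k] by (intro add_left_mono ge_one_powr_ge_zero) auto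
        also have "\<dots> = 2 powr (n * R $ k + 1)" by (simp add: powr_add)
        finally have Wn: "real (W n k) \<le> 2 powr (n * R $ k + 1)" .
        have nR: "n * R $ k \<le> (real B + 1) * T * R $ k" using n R0[of k] by (intro mult_right_mono) auto
        have mq: "real (2 * m) * lq \<le> 4 * \<theta> * B * lq" using m lq0 by (intro mult_right_mono) auto
        have "T * R $ k + 1 \<le> B * \<delta>" using elim \<delta> by (simp add: B_def field_simps)
        then have exps: "n * R $ k + 1 + B + real (2 * m) * lq \<le> B * lq"
          using nR mq unfolding \<delta>_def by (simp add: algebra_simps)
        have "real (W n k * (2 ^ B * q ^ (2 * m))) = real (W n k) * (2 powr B * 2 powr (real (2 * m) * lq))"
          using q1 by (simp add: q powr_realpow[symmetric] powr_powr mult.commute)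
        also have "\<dots> \<le> 2 powr (n * R $ k + 1) * (2 powr B * 2 powr (real (2 * m) * lq))"
          using Wn by (intro mult_right_mono) auto
        also have "\<dots> = 2 powr (n * R $ k + 1 + B + real (2 * m) * lq)" by (simp add: powr_add)
        also have "\<dots> \<le> 2 powr (B * lq)" using exps by (intro powr_mono) auto
        also have "\<dots> = real (q ^ B)" using q1 by (simp add: q powr_realpow[symmetric] powr_powr mult.commute)
        finally have "W n k * (2 ^ B * q ^ (2 * m)) \<le> q ^ B" by (simp only: of_nat_le_iff)
        then show ?case by (simp add: B_def m_def q_def)
      qed
    qed
    have "\<forall>\<^sub>F n in sequentially. \<forall>k\<in>(\<Union>j\<in>S. demand j). gv_bound (n div T) (2 * nat \<lfloor>2 * \<theta> * real (n div T)\<rfloor>) (card (letters k Q)) (W n k)"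
      by (intro eventually_ball_finite ballI ev) auto
    then obtain n0 where n0: "\<And>n k. n0 \<le> n \<Longrightarrow> k \<in> (\<Union>j\<in>S. demand j) \<Longrightarrow> gv_bound (n div T) (2 * nat \<lfloor>2 * \<theta> * real (n div T)\<rfloor>) (card (letters k Q)) (W n k)"
      unfolding eventually_sequentially by blast
    \<comment> \<open>A valid code is demanded at every block length; below \<open>n0\<close> the
      trivial one fills the gap.\<close>
    have "\<exists>(enc :: ('r, 'k, 'm) encoders) (dec :: ('r, 'k, 'm) decoders).
        valid_encoders \<mu> S P n (W n) enc \<and> valid_decoders \<mu> S n dec \<and>
        (n0 \<le> n \<longrightarrow> error_probability \<mu> S demand n (W n) enc dec \<le> 2 * (1/2) ^ (n div T))" for n
    proof (cases "n0 \<le> n")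
      case True
      show ?thesis using bc[OF P Q W1 n0[OF True]] by blast
    next
      case False
      with trivial_code[OF P(2)] show ?thesis by blast
    qed
    then obtain enc :: "nat \<Rightarrow> ('r, 'k, 'm) encoders" and dec :: "nat \<Rightarrow> ('r, 'k, 'm) decoders" where
      ed: "\<And>n. valid_encoders \<mu> S P n (W n) (enc n)" "\<And>n. valid_decoders \<mu> S n (dec n)"
        "\<And>n. n0 \<le> n \<Longrightarrow> error_probability \<mu> S demand n (W n) (enc n) (dec n) \<le> 2 * (1/2) ^ (n div T)"
      by metis
    have "(\<lambda>n. error_probability \<mu> S demand n (W n) (enc n) (dec n)) \<longlonglongrightarrow> 0"
    proof (rule tendsto_sandwich)
      show "\<forall>\<^sub>F n in sequentially. 0 \<le> error_probability \<mu> S demand n (W n) (enc n) (dec n)"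
        by (simp add: error_probability_def Let_def)
      show "\<forall>\<^sub>F n in sequentially. error_probability \<mu> S demand n (W n) (enc n) (dec n) \<le> 2 * (1/2) ^ (n div T)"
        using eventually_ge_at_top[of n0] by eventually_elim (rule ed(3))
      have "(\<lambda>i. (1/2::real) ^ i) \<longlonglongrightarrow> 0" by (rule LIMSEQ_power_zero) simp
      from tendsto_mult_left[OF filterlim_compose[OF this div_lim], of 2]
      show "(\<lambda>n. 2 * (1/2::real) ^ (n div T)) \<longlonglongrightarrow> 0" by simp
    qed simp
    then show "achievable TYPE('m) \<mu> S demand P R"
      unfolding achievable_def Let_def using R0 ed(1,2) unfolding W_def
      by (intro conjI allI exI[of _ enc] exI[of _ dec])
  qed
qed

end

section \<open>Achievability\<close>

text \<open>
  A message that nobody in \<open>S\<close> requests need not be sent: it causes no interference, and its rate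
  is unconstrained.
\<close>

definition dof_polytope :: "real \<Rightarrow> 'r set \<Rightarrow> ('r \<Rightarrow> 'k set) \<Rightarrow> (real ^ 'k::finite) set" where
  "dof_polytope M S demand = {d. (\<forall>k. 0 \<le> d $ k) \<and>
     (\<forall>j\<in>S. (\<Sum>k\<in>demand j. d $ k) \<le> M \<and>
        (\<forall>i\<in>(\<Union>j\<in>S. demand j) - demand j. (\<Sum>k\<in>demand j. d $ k) + d $ i \<le> M))}"

text \<open>At rate zero every message has a single value, which the zero decoder returns. This
  keeps the capacity region nonempty at every positive power, as closest points require.\<close>

lemma achievable_zero:
  assumes "prob_space \<mu>" "0 \<le> P"
  shows "achievable TYPE('m::finite) \<mu> (S :: 'r::finite set) demand P (0 :: real ^ 'k::finite)"
proof -
  have "ennreal (error_probability \<mu> S demand n (\<lambda>_. 1) (\<lambda>_ _ _ _. 0 :: complex ^ 'm) (\<lambda>_ _ _ _. 0)) \<le> emeasure (channel_law \<mu> S n :: ('r, 'k, 'm) csi measure) {} + emeasure (noise_law S n :: ('r, 'm) noise measure) {}" for n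
    by (rule error_probability_le[OF assms(1)]) auto
  then have "error_probability \<mu> S demand n (\<lambda>_. 1) (\<lambda>_ _ _ _. 0 :: complex ^ 'm) (\<lambda>_ _ _ _. 0) = 0" for n
    by (simp add: error_probability_def Let_def ennreal_eq_0_iff measure_le_0_iff)
  then show ?thesis
    unfolding achievable_def Let_def using trivial_code[OF assms(2), of \<mu> S]
    by (intro conjI exI[of _ "\<lambda>_ _ _ _ _. 0"]) auto
qed

text \<open>
  The closest point of the closed capacity region turns approximation at each accuracy into a
  single rate function with an exact limit.
\<close>

lemma DoF_regionI:
  fixes d :: "real ^ 'k::finite"
  assumes \<mu>: "prob_space \<mu>" and d: "\<And>k. 0 \<le> d $ k"
    and ev: "\<And>\<eta>. 0 < \<eta> \<Longrightarrow> \<forall>\<^sub>F P in at_top. \<exists>R\<in>capacity_region TYPE('m::finite) \<mu> S demand P. \<forall>k. \<bar>R $ k / log 2 P - d $ k\<bar> \<le> \<eta>"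
  shows "d \<in> DoF_region TYPE('m) \<mu> S demand"
proof -
  let ?C = "\<lambda>P. capacity_region TYPE('m) \<mu> S demand P"
  have cl: "closed (?C P)" for P by (simp add: capacity_region_def)
  have ne: "?C P \<noteq> {}" if "0 < P" for P
    using achievable_zero[OF \<mu>, of P] that closure_subset unfolding capacity_region_def by fastforce
  define R where "R P = closest_point (?C P) (log 2 P *\<^sub>R d)" for P
  have mem: "R P \<in> ?C P" if "0 < P" for P
    unfolding R_def by (rule closest_point_in_set[OF cl ne[OF that]])
  have "((\<lambda>P. R P $ k / log 2 P) \<longlongrightarrow> d $ k) at_top" for k
  proof (rule tendstoI)
    fix e :: real assume e: "0 < e"
    \<comment> \<open>The closest point is no farther away than the approximating one, whose
      distance the sum norm bounds by \<open>CARD('k) * \<eta> * log 2 P\<close>. The factor 2 makes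
      the final inequality strict.\<close>
    define \<eta> where "\<eta> = e / (2 * CARD('k))"
    have \<eta>: "0 < \<eta>" using e by (simp add: \<eta>_def)
    show "\<forall>\<^sub>F P in at_top. dist (R P $ k / log 2 P) (d $ k) < e"
      using ev[OF \<eta>] eventually_gt_at_top[of 1]
    proof eventually_elim
      case (elim P)
      then obtain R' where R': "R' \<in> ?C P" "\<And>k. \<bar>R' $ k / log 2 P - d $ k\<bar> \<le> \<eta>" by blast
      have lp: "0 < log 2 P" using elim by simp
      have comp: "\<bar>v $ k / log 2 P - d $ k\<bar> = \<bar>(log 2 P *\<^sub>R d - v) $ k\<bar> / log 2 P" for v :: "real ^ 'k" and k
      proof -
        have "v $ k / log 2 P - d $ k = - ((log 2 P *\<^sub>R d - v) $ k) / log 2 P" using lp by (simp add: field_simps)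
        then show ?thesis using lp by (simp add: abs_divide)
      qed
      have "norm (log 2 P *\<^sub>R d - R') \<le> (\<Sum>k\<in>UNIV. \<bar>(log 2 P *\<^sub>R d - R') $ k\<bar>)" by (rule norm_le_l1_cart)
      also have "\<dots> \<le> (\<Sum>k\<in>(UNIV::'k set). \<eta> * log 2 P)"
        using R'(2) lp unfolding comp by (intro sum_mono) (simp add: pos_divide_le_eq)
      finally have n1: "norm (log 2 P *\<^sub>R d - R') \<le> CARD('k) * \<eta> * log 2 P" by simp
      have "\<bar>(log 2 P *\<^sub>R d - R P) $ k\<bar> \<le> norm (log 2 P *\<^sub>R d - R P)" by (rule component_le_norm_cart)
      also have "\<dots> \<le> norm (log 2 P *\<^sub>R d - R')"
        using closest_point_le[OF cl R'(1), of "log 2 P *\<^sub>R d"] by (simp add: R_def dist_norm)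
      also note n1
      finally have "\<bar>R P $ k / log 2 P - d $ k\<bar> \<le> CARD('k) * \<eta>" unfolding comp using lp by (simp add: pos_divide_le_eq)
      also have "\<dots> < e" using e by (simp add: \<eta>_def)
      finally show ?case by (simp add: dist_real_def)
    qed
  qed
  with mem d show ?thesis unfolding DoF_region_def by blast
qed

text \<open>The two hypotheses bound the streams of the desired messages plus those of the largest
  interferer by \<open>C\<close>. Multiplied by \<open>Suc N ^ L\<close>, this shows that desired
  and aligned interfering beams fit into \<open>T\<close> slots.\<close>

lemma exists_alignment_scheme:
  fixes demand :: "'r::finite \<Rightarrow> 'k::finite set" and c :: "'k \<Rightarrow> nat" and C N :: nat
  assumes \<mu>: "channel_distribution \<mu>" and C: "0 < C"
    and c1: "\<And>j. j \<in> S \<Longrightarrow> (\<Sum>k\<in>demand j. c k) \<le> C"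
    and c2: "\<And>j i. j \<in> S \<Longrightarrow> i \<notin> demand j \<Longrightarrow> (\<Sum>k\<in>demand j. c k) + c i \<le> C"
  defines "L \<equiv> card (interfering_links S demand :: ('r \<times> 'm::finite \<times> 'k \<times> 'm) set)"
  obtains g0 fil den where
    "alignment_scheme \<mu> S demand c N (C * Suc N ^ L) g0
       (fil :: 'r \<Rightarrow> 'k \<Rightarrow> 'm \<Rightarrow> ('r, 'k, 'm) beam_id \<Rightarrow> nat \<Rightarrow> 'm \<Rightarrow> ('r, 'k, 'm) csi \<Rightarrow> complex) den"
proof -
  let ?X = "interfering_links S demand :: ('r \<times> 'm \<times> 'k \<times> 'm) set"
  have finX: "finite ?X" by (rule finite_interfering_links)
  obtain gx :: "'r \<times> 'm \<times> 'k \<times> 'm \<Rightarrow> nat" where gx: "\<forall>f\<in>?X \<rightarrow>\<^sub>E {..N}. \<forall>f'\<in>?X \<rightarrow>\<^sub>E {..N}.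
    (\<Sum>x\<in>?X. f x * gx x) = (\<Sum>x\<in>?X. f' x * gx x) \<longrightarrow> f = f'"
    using injective_weights[OF finX] by blast
  \<comment> \<open>The stream number \<open>e\<close> is the leading digit above the exponent
    digits, so \<open>g0\<close> has to exceed all their weighted sums.\<close>
  define g0 where "g0 = Suc (\<Sum>x\<in>?X. N * gx x)"
  have lt: "(\<Sum>x\<in>?X. f x * gx x) < g0" if "f \<in> ?X \<rightarrow>\<^sub>E {..N}" for f
    unfolding g0_def less_Suc_eq_le using that by (intro sum_mono mult_right_mono) (auto simp: PiE_iff)
  have w: "e = e' \<and> f = f'" if f: "f \<in> ?X \<rightarrow>\<^sub>E {..N}" "f' \<in> ?X \<rightarrow>\<^sub>E {..N}"
      and eq: "g0 * e + (\<Sum>x\<in>?X. f x * gx x) = g0 * e' + (\<Sum>x\<in>?X. f' x * gx x)" for e f e' f'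
  proof -
    have "e * g0 + (\<Sum>x\<in>?X. f x * gx x) = e' * g0 + (\<Sum>x\<in>?X. f' x * gx x)"
      using eq by (simp only: mult.commute)
    from weighted_sum_unique[OF this lt[OF f(1)] lt[OF f(2)]] gx f show ?thesis by blast
  qed
  define T where "T = C * Suc N ^ L"
  define Q where "Q j k b s g d h0 \<longleftrightarrow> (\<forall>t a. t < T \<longrightarrow> sep_poly (csi_index S T) (g t a)) \<and> sep_poly (csi_index S T) d \<and>
      d (restrict h0 (csi_index S T)) \<noteq> 0 \<and>
      (\<forall>h sym. (\<Sum>t<T. \<Sum>a\<in>UNIV. g t a h * (\<Sum>k'\<in>UNIV. \<Sum>b'\<in>UNIV. h (t, j, k', a, b') *
        (\<Sum>s'\<in>stream_index ?X (c k') N. beam ?X g0 s' t h * sym k' b' s'))) = d h * sym k (b :: 'm) s)" for j k b s g d h0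
  have ex: "\<exists>g d h0. Q j k b s g d h0"
    if j: "j \<in> S" and k: "k \<in> demand j" and s: "s \<in> stream_index ?X (c k) N" for j k b s
  proof -
    \<comment> \<open>Without interferers the maximum would run over the empty set; with the value 0
      the hypothesis \<open>c1\<close> alone gives the bound.\<close>
    define cm where "cm = (if demand j = UNIV then 0 else Max (c ` (- demand j)))"
    have cm: "c i \<le> cm" if "i \<notin> demand j" for i
    proof -
      have "demand j \<noteq> UNIV" using that by auto
      then show ?thesis using that by (auto simp: cm_def intro: Max_ge)
    qed
    have tot: "(\<Sum>k\<in>demand j. c k) + cm \<le> C"
    proof (cases "demand j = UNIV")
      case True then show ?thesis using c1[OF j] by (simp add: cm_def)
    next
      case False
      then have "cm \<in> c ` (- demand j)" unfolding cm_def by (auto intro!: Max_in)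
      then show ?thesis using c2[OF j] by auto
    qed
    have "(\<Sum>k\<in>demand j. card (stream_index ?X (c k) N)) + card (stream_index ?X cm (Suc N))
      = (\<Sum>k\<in>demand j. c k) * N ^ L + cm * Suc N ^ L"
      by (simp add: card_stream_index[OF finX] L_def sum_distrib_right)
    also have "\<dots> \<le> (\<Sum>k\<in>demand j. c k) * Suc N ^ L + cm * Suc N ^ L"
      by (intro add_right_mono mult_left_mono power_mono) auto
    also have "\<dots> = ((\<Sum>k\<in>demand j. c k) + cm) * Suc N ^ L" by (simp only: add_mult_distrib)
    also have "\<dots> \<le> T" unfolding T_def using tot by (rule mult_right_mono) simp
    finally have TT: "(\<Sum>k\<in>demand j. card (stream_index ?X (c k) N)) + card (stream_index ?X cm (Suc N)) \<le> T" .
    show ?thesis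
    proof (rule zero_forcing_filter[where S = S and demand = demand and N = N and ?g0.0 = g0 and gx = gx
          and j = j and c = c and cm = cm and T = T and k = k and s = s and b = b])
      show "e = e' \<and> f = f'" if "f \<in> ?X \<rightarrow>\<^sub>E {..N}" "f' \<in> ?X \<rightarrow>\<^sub>E {..N}"
        "g0 * e + (\<Sum>x\<in>?X. f x * gx x) = g0 * e' + (\<Sum>x\<in>?X. f' x * gx x)" for e f e' f'
        by (rule w[OF that])
      show "j \<in> S" "k \<in> demand j" "s \<in> stream_index ?X (c k) N" by fact+
      show "c i \<le> cm" if "i \<notin> demand j" for i by (rule cm[OF that])
      show "(\<Sum>k\<in>demand j. card (stream_index ?X (c k) N)) + card (stream_index ?X cm (Suc N)) \<le> T" by (rule TT)
    qed (unfold Q_def csi_index_def, intro exI conjI allI impI, assumption+)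
  qed
  define fil where "fil j k b s = (SOME g. \<exists>d h0. Q j k b s g d h0)" for j k b s
  \<comment> \<open>The denominator is chosen for the filter already fixed, so that the two belong
    together. Both are specified only for receivers in \<open>S\<close>, their requested messages
    and existing streams.\<close>
  define den where "den j k b s = (SOME d. \<exists>h0. Q j k b s (fil j k b s) d h0)" for j k b s
  have fd: "\<exists>h0. Q j k b s (fil j k b s) (den j k b s) h0"
    if "j \<in> S" "k \<in> demand j" "s \<in> stream_index ?X (c k) N" for j k b s
  proof -
    have "\<exists>d h0. Q j k b s (fil j k b s) d h0"
      unfolding fil_def by (rule someI_ex[of "\<lambda>g. \<exists>d h0. Q j k b s g d h0", OF ex[OF that]])
    from someI_ex[of "\<lambda>d. \<exists>h0. Q j k b s (fil j k b s) d h0", OF this]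
    show ?thesis unfolding den_def .
  qed
  have "alignment_scheme \<mu> S demand c N T g0 fil den"
  proof (unfold_locales)
    show "channel_distribution \<mu>" by fact
    show "0 < T" using C by (simp add: T_def)
    fix j k b s assume jks: "j \<in> S" "k \<in> demand j" "s \<in> stream_index ?X (c k) N"
    obtain h0 where q: "Q j k b s (fil j k b s) (den j k b s) h0" using fd[OF jks] by blast
    show "sep_poly (csi_index S T) (fil j k b s t a)" if "t < T" for t a using q that by (simp add: Q_def)
    show "sep_poly (csi_index S T) (den j k b s)" using q by (simp add: Q_def)
    show "AE h in channel_law \<mu> S T. den j k b s h \<noteq> 0"
      unfolding channel_law_alt using q unfolding Q_def
      by (intro AE_sep_poly_nonzero[OF finite_index(1) channel_distributionD[OF \<mu>], where ?h0.0 = h0]) auto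
    show "(\<Sum>t<T. \<Sum>a\<in>UNIV. fil j k b s t a h * (\<Sum>k'\<in>UNIV. \<Sum>b'\<in>UNIV. h (t, j, k', a, b') *
        (\<Sum>s'\<in>stream_index ?X (c k') N. beam ?X g0 s' t h * sym k' b' s'))) = den j k b s h * sym k b s" for h sym
      using q by (simp add: Q_def)
  qed
  then show ?thesis unfolding T_def by (rule that)
qed

text \<open>There are about \<open>sqrt P / \<kappa>\<close> points per real coordinate, hence half
  of \<open>log 2 P\<close>; the two coordinates of a complex symbol make up for the half. For
  values of at least 2, rounding down loses at most a factor 2.\<close>

lemma log_floor_sqrt_limit:
  assumes "0 < \<kappa>"
  shows "((\<lambda>P. log 2 (real (nat \<lfloor>sqrt P / \<kappa>\<rfloor>)) / log 2 P) \<longlongrightarrow> 1 / 2) at_top"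
proof (rule tendsto_sandwich)
  show "((\<lambda>P. log 2 (sqrt P / (2 * \<kappa>)) / log 2 P) \<longlongrightarrow> 1 / 2) at_top"
    using assms by real_asymp
  show "((\<lambda>P. log 2 (sqrt P / \<kappa>) / log 2 P) \<longlongrightarrow> 1 / 2) at_top"
    using assms by real_asymp
  have "\<forall>\<^sub>F P in at_top. sqrt P / \<kappa> \<ge> 2" using assms by real_asymp
  then have ev: "\<forall>\<^sub>F P in at_top. sqrt P / (2 * \<kappa>) \<le> real (nat \<lfloor>sqrt P / \<kappa>\<rfloor>) \<and> real (nat \<lfloor>sqrt P / \<kappa>\<rfloor>) \<le> sqrt P / \<kappa> \<and> 0 < sqrt P / (2 * \<kappa>) \<and> 0 < real (nat \<lfloor>sqrt P / \<kappa>\<rfloor>) \<and> 0 < log 2 P"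
    using eventually_gt_at_top[of 1]
  proof eventually_elim
    case (elim P)
    define v where "v = sqrt P / \<kappa>"
    have "v / 2 \<le> real_of_int \<lfloor>v\<rfloor>" using elim(1) unfolding v_def[symmetric] by linarith
    moreover have "sqrt P / (2 * \<kappa>) = v / 2" by (simp add: v_def)
    ultimately show ?case using elim unfolding v_def[symmetric] by auto
  qed
  show "\<forall>\<^sub>F P in at_top. log 2 (sqrt P / (2 * \<kappa>)) / log 2 P \<le> log 2 (real (nat \<lfloor>sqrt P / \<kappa>\<rfloor>)) / log 2 P"
    using ev by eventually_elim (intro divide_right_mono log_mono, auto)
  show "\<forall>\<^sub>F P in at_top. log 2 (real (nat \<lfloor>sqrt P / \<kappa>\<rfloor>)) / log 2 P \<le> log 2 (sqrt P / \<kappa>) / log 2 P"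
    using ev by eventually_elim (intro divide_right_mono log_mono, auto)
qed

text \<open>The coordinates of \<open>d\<close> are rounded down to stream numbers
  \<open>c k\<close> on the scale \<open>C / M\<close>, which turns the inequalities of the polytope
  into those required of \<open>c\<close>. Three losses remain and are made small: the rounding, the
  exponent range, and the redundancy of the code.\<close>

theorem dof_polytope_achievable:
  fixes demand :: "'r::finite \<Rightarrow> 'k::finite set" and d :: "real ^ 'k"
  assumes \<mu>: "channel_distribution \<mu>" and d: "d \<in> dof_polytope CARD('m::finite) S demand"
  shows "d \<in> DoF_region TYPE('m) \<mu> S demand"
proof (rule DoF_regionI)
  show "prob_space \<mu>" by (rule channel_distributionD[OF \<mu>])
  show d0: "0 \<le> d $ k" for k using d by (simp add: dof_polytope_def)
  fix \<eta> :: real assume \<eta>: "0 < \<eta>"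
  define U where "U = (\<Union>j\<in>S. demand j)"
  define M where "M = real CARD('m)"
  have M: "0 < M" by (simp add: M_def)
  have sum_le: "(\<Sum>k\<in>demand j. d $ k) \<le> M" if "j \<in> S" for j
    using d that by (auto simp: dof_polytope_def M_def)
  have sum_le': "(\<Sum>k\<in>demand j. d $ k) + d $ i \<le> M" if "j \<in> S" "i \<in> U" "i \<notin> demand j" for i j
    using d that by (auto simp: dof_polytope_def M_def U_def)
  have dM: "d $ k \<le> M" if k: "k \<in> U" for k
  proof -
    obtain j where j: "j \<in> S" "k \<in> demand j" using k by (auto simp: U_def)
    have "d $ k \<le> (\<Sum>k\<in>demand j. d $ k)" using j d0 by (intro member_le_sum) auto
    then show ?thesis using sum_le[OF j(1)] by simp
  qed
  \<comment> \<open>Each of the two factors of \<open>\<rho>\<close> loses at most \<epsilon>, so a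
    rate of at most \<open>M\<close> loses at most \<open>2 * \<epsilon> * M\<close>. This loss and
    the rounding loss \<open>M / C\<close> get \<open>\<eta> / 4\<close> each; the other half of
    \<eta> is left to the limit in \<open>P\<close>.\<close>
  define \<epsilon> where "\<epsilon> = min (1/2) (\<eta> / (8 * M))"
  have \<epsilon>: "0 < \<epsilon>" "\<epsilon> \<le> 1/2" "2 * \<epsilon> * M \<le> \<eta> / 4"
  proof -
    show "0 < \<epsilon>" using \<eta> M by (simp add: \<epsilon>_def)
    show "\<epsilon> \<le> 1/2" by (simp add: \<epsilon>_def)
    have "\<epsilon> \<le> \<eta> / (8 * M)" by (simp add: \<epsilon>_def)
    then show "2 * \<epsilon> * M \<le> \<eta> / 4" using M by (simp add: field_simps)
  qed
  define C where "C = nat \<lceil>4 * M / \<eta>\<rceil> + 1"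
  have C: "0 < C" "M / C \<le> \<eta> / 4"
  proof -
    show "0 < C" by (simp add: C_def)
    have "4 * M / \<eta> \<le> real C" unfolding C_def by linarith
    then show "M / C \<le> \<eta> / 4" using \<eta> \<open>0 < C\<close> by (simp add: field_simps)
  qed
  define c where "c k = (if k \<in> U then nat \<lfloor>C * d $ k / M\<rfloor> else 0)" for k
  have cle: "M * real (c k) \<le> C * d $ k" for k
  proof -
    have "0 \<le> C * d $ k / M" using d0[of k] M by simp
    then have "real (c k) \<le> C * d $ k / M" by (auto simp: c_def)
    then show ?thesis using M by (simp add: field_simps)
  qed
  have cge: "C * d $ k - M \<le> M * real (c k)" if "k \<in> U" for k
  proof -
    have "C * d $ k / M - 1 \<le> real (c k)" using that unfolding c_def by simp linarith
    then show ?thesis using M by (simp add: field_simps)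
  qed
  have sumc: "M * real (\<Sum>k\<in>A. c k) \<le> C * (\<Sum>k\<in>A. d $ k)" for A
    unfolding of_nat_sum sum_distrib_left by (intro sum_mono cle)
  have c1: "(\<Sum>k\<in>demand j. c k) \<le> C" if "j \<in> S" for j
  proof -
    have "M * real (\<Sum>k\<in>demand j. c k) \<le> C * M"
      using sumc[of "demand j"] mult_left_mono[OF sum_le[OF that], of "real C"] by linarith
    then have "real (\<Sum>k\<in>demand j. c k) \<le> C" using M by (simp add: mult.commute del: of_nat_sum)
    then show ?thesis by (simp only: of_nat_le_iff)
  qed
  have c2: "(\<Sum>k\<in>demand j. c k) + c i \<le> C" if "j \<in> S" "i \<notin> demand j" for i j
  proof (cases "i \<in> U")
    case True
    have "M * real ((\<Sum>k\<in>demand j. c k) + c i) \<le> C * ((\<Sum>k\<in>demand j. d $ k) + d $ i)"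
      using sumc[of "demand j"] cle[of i] by (simp add: distrib_left del: of_nat_sum)
    also have "\<dots> \<le> C * M" using sum_le'[OF that(1) True that(2)] by (intro mult_left_mono) auto
    finally have "real ((\<Sum>k\<in>demand j. c k) + c i) \<le> C" using M by (simp add: mult.commute del: of_nat_sum of_nat_add)
    then show ?thesis by (simp only: of_nat_le_iff)
  next
    case False then show ?thesis using c1[OF that(1)] by (simp add: c_def)
  qed
  define L where "L = card (interfering_links S demand :: ('r \<times> 'm \<times> 'k \<times> 'm) set)"
  \<comment> \<open>Fewer exponents are sent than the interference occupies, which costs this
    factor; a large \<open>N\<close> makes it negligible.\<close>
  have "(\<lambda>N. (real N / real (Suc N)) ^ L) \<longlonglongrightarrow> 1 ^ L"
    by (intro tendsto_power) real_asymp
  then have "\<forall>\<^sub>F N in sequentially. 1 - \<epsilon> < (real N / real (Suc N)) ^ L"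
    using \<epsilon>(1) by (intro order_tendstoD) auto
  then obtain N where N: "1 - \<epsilon> < (real N / real (Suc N)) ^ L" by (auto simp: eventually_sequentially)
  define T where "T = C * Suc N ^ L"
  obtain g0 and fil den :: "'r \<Rightarrow> 'k \<Rightarrow> 'm \<Rightarrow> ('r, 'k, 'm) beam_id \<Rightarrow> _" where
    "alignment_scheme \<mu> S demand c N (C * Suc N ^ card (interfering_links S demand :: ('r \<times> 'm \<times> 'k \<times> 'm) set)) g0 fil den"
    by (rule exists_alignment_scheme[OF \<mu> C(1) c1 c2, where N = N])
  then have "alignment_scheme \<mu> S demand c N T g0 fil den" by (simp only: T_def L_def)
  then interpret alignment_scheme \<mu> S demand c N T g0 fil den "interfering_links S demand" .
  have \<theta>: "0 < \<epsilon> / 4" using \<epsilon> by simp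
  obtain \<kappa> where \<kappa>: "0 < \<kappa>" and ach: "\<And>P Q (R :: real ^ 'k). \<kappa> * real Q \<le> sqrt P \<Longrightarrow> 0 \<le> P \<Longrightarrow> 1 \<le> Q \<Longrightarrow> (\<And>k. 0 \<le> R $ k) \<Longrightarrow>
      (\<And>k. k \<in> (\<Union>j\<in>S. demand j) \<Longrightarrow> R $ k = 0 \<or> T * R $ k < (1 - 4 * (\<epsilon> / 4)) * log 2 (card (letters k Q)) - 1) \<Longrightarrow>
      achievable TYPE('m) \<mu> S demand P R"
    using achievable_rates[OF \<theta>] by metis
  define Q where "Q P = nat \<lfloor>sqrt P / \<kappa>\<rfloor>" for P
  define n where "n k = CARD('m) * (c k * N ^ L)" for k
  \<comment> \<open>Subtracting 2 instead of 1 gives the strict inequality of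
    \<open>achievable_rates\<close>, and \<open>max 0\<close> replaces negative values at low power
    by rate zero. A message requested by nobody in \<open>S\<close> gets exactly its target
    rate.\<close>
  define r where "r P k = (if k \<in> U then max 0 (((1 - \<epsilon>) * (2 * n k * log 2 (Q P)) - 2) / T) else d $ k * log 2 P)" for P k
  define x where "x k = M * c k / C" for k
  define \<rho> where "\<rho> = (1 - \<epsilon>) * (real N / real (Suc N)) ^ L"
  have T0: "0 < T" using C by (simp add: T_def)
  have \<rho>: "1 - 2 * \<epsilon> \<le> \<rho>" "\<rho> \<le> 1" "0 \<le> \<rho>"
  proof -
    have "(1 - \<epsilon>) * (1 - \<epsilon>) \<le> \<rho>" unfolding \<rho>_def using N \<epsilon> by (intro mult_left_mono) auto
    moreover have "1 - 2 * \<epsilon> \<le> (1 - \<epsilon>) * (1 - \<epsilon>)" by (simp add: algebra_simps)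
    ultimately show "1 - 2 * \<epsilon> \<le> \<rho>" by linarith
    have "(real N / real (Suc N)) ^ L \<le> 1" by (intro power_le_one) auto
    then show "\<rho> \<le> 1" unfolding \<rho>_def using \<epsilon> by (intro mult_le_one) auto
    show "0 \<le> \<rho>" unfolding \<rho>_def using \<epsilon> by auto
  qed
  have near: "\<bar>\<rho> * x k - d $ k\<bar> \<le> \<eta> / 2" if k: "k \<in> U" for k
  proof -
    have x: "x k \<le> d $ k" "d $ k - x k \<le> \<eta> / 4" "0 \<le> x k"
    proof -
      show "x k \<le> d $ k" unfolding x_def using cle[of k] C(1) by (simp add: field_simps)
      have "d $ k - x k \<le> M / C" 
      proof -
        have "(C * d $ k - M * real (c k)) / C \<le> M / C"
          using cge[OF k] C(1) by (intro divide_right_mono) auto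
        then show ?thesis using C(1) by (simp add: x_def diff_divide_distrib)
      qed
      then show "d $ k - x k \<le> \<eta> / 4" using C(2) by linarith
      show "0 \<le> x k" using M by (simp add: x_def)
    qed
    have xM: "x k \<le> M" using x(1) dM[OF k] by linarith
    have "(1 - \<rho>) * x k \<le> 2 * \<epsilon> * M" using \<rho> x xM \<epsilon> by (intro mult_mono) auto
    then have "x k - \<rho> * x k \<le> \<eta> / 4" using \<epsilon>(3) by (simp add: algebra_simps)
    moreover have "\<rho> * x k \<le> x k" using \<rho> x by (simp add: mult_left_le_one_le)
    ultimately show ?thesis using x by linarith
  qed
  have lim: "((\<lambda>P. r P k / log 2 P) \<longlongrightarrow> (if k \<in> U then \<rho> * x k else d $ k)) at_top" for k
  proof (cases "k \<in> U")
    case True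
    have l0: "((\<lambda>P. 2 / log 2 P) \<longlongrightarrow> (0::real)) at_top" by real_asymp
    have "((\<lambda>P. max 0 (((1 - \<epsilon>) * (2 * n k * (log 2 (real (nat \<lfloor>sqrt P / \<kappa>\<rfloor>)) / log 2 P)) - 2 / log 2 P) / T)) \<longlongrightarrow>
      max 0 (((1 - \<epsilon>) * (2 * n k * (1 / 2)) - 0) / T)) at_top"
      by (intro tendsto_intros log_floor_sqrt_limit[OF \<kappa>] l0) (use T0 in auto)
    also have "max 0 (((1 - \<epsilon>) * (2 * n k * (1 / 2)) - 0) / T) = \<rho> * x k"
    proof -
      have "((1 - \<epsilon>) * (2 * n k * (1 / 2)) - 0) / T = \<rho> * x k"
        using C(1) by (simp add: n_def T_def \<rho>_def x_def M_def power_divide field_simps)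
      moreover have "0 \<le> \<rho> * x k" using \<rho> M by (simp add: x_def)
      ultimately show ?thesis by simp
    qed
    finally have "((\<lambda>P. r P k / log 2 P) \<longlongrightarrow> \<rho> * x k) at_top"
    proof (rule Lim_transform_eventually)
      show "\<forall>\<^sub>F P in at_top. max 0 (((1 - \<epsilon>) * (2 * n k * (log 2 (real (nat \<lfloor>sqrt P / \<kappa>\<rfloor>)) / log 2 P)) - 2 / log 2 P) / T) = r P k / log 2 P"
        using eventually_gt_at_top[of 1]
      proof eventually_elim
        case (elim P)
        have lp: "0 < log 2 P" using elim by simp
        have "r P k / log 2 P = max (0 / log 2 P) (((1 - \<epsilon>) * (2 * n k * log 2 (Q P)) - 2) / T / log 2 P)"
          using True lp unfolding r_def by (simp add: max_divide_distrib_right)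
        also have "\<dots> = max 0 (((1 - \<epsilon>) * (2 * n k * (log 2 (real (nat \<lfloor>sqrt P / \<kappa>\<rfloor>)) / log 2 P)) - 2 / log 2 P) / T)"
          by (simp add: Q_def diff_divide_distrib mult.commute)
        finally show ?case ..
      qed
    qed
    then show ?thesis using True by simp
  next
    case False
    have "\<forall>\<^sub>F P in at_top. d $ k = r P k / log 2 P"
      using eventually_gt_at_top[of 1]
    proof eventually_elim
      case (elim P)
      then have "log 2 P \<noteq> 0" using zero_less_log_cancel_iff[of 2 P] by linarith
      then show ?case by (simp add: r_def False)
    qed
    then show ?thesis using False Lim_transform_eventually[OF tendsto_const] by auto
  qed
  have "\<forall>\<^sub>F P in at_top. \<forall>k\<in>UNIV. \<bar>r P k / log 2 P - (if k \<in> U then \<rho> * x k else d $ k)\<bar> < \<eta> / 2"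
    using \<eta> by (intro eventually_ball_finite ballI tendstoD[OF lim, unfolded dist_real_def]) auto
  moreover have "\<forall>\<^sub>F P in at_top. 1 \<le> sqrt P / \<kappa>" using \<kappa> by real_asymp
  ultimately show "\<forall>\<^sub>F P in at_top. \<exists>R\<in>capacity_region TYPE('m) \<mu> S demand P. \<forall>k. \<bar>R $ k / log 2 P - d $ k\<bar> \<le> \<eta>"
    using eventually_gt_at_top[of 1]
  proof eventually_elim
    case (elim P)
    define R where "R = (\<chi> k. r P k)"
    have Q1: "1 \<le> Q P" using elim(2) by (simp add: Q_def le_nat_floor)
    have "real (Q P) \<le> sqrt P / \<kappa>" using elim(2) by (simp add: Q_def)
    then have QP: "\<kappa> * real (Q P) \<le> sqrt P" using \<kappa> by (simp add: field_simps)
    have "achievable TYPE('m) \<mu> S demand P R"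
    proof (rule ach[OF QP _ Q1])
      show "0 \<le> P" using elim(3) by simp
      show "0 \<le> R $ k" for k using d0[of k] elim(3) by (simp add: R_def r_def)
      fix k assume k: "k \<in> (\<Union>j\<in>S. demand j)"
      have "real (card (letters k (Q P))) = real (Q P) powr (2 * n k)"
      proof -
        have "card (letters k (Q P)) = Q P ^ (2 * n k)"
          unfolding card_letters n_def L_def power_mult power2_eq_square ..
        then have "real (card (letters k (Q P))) = real (Q P) ^ (2 * n k)" by (simp only: of_nat_power)
        then show ?thesis using Q1 powr_realpow[of "real (Q P)" "2 * n k"] by simp
      qed
      then have lg: "log 2 (card (letters k (Q P))) = 2 * n k * log 2 (Q P)" using Q1 by (simp add: log_powr)
      show "R $ k = 0 \<or> T * R $ k < (1 - 4 * (\<epsilon> / 4)) * log 2 (card (letters k (Q P))) - 1"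
      proof (cases "((1 - \<epsilon>) * (2 * n k * log 2 (Q P)) - 2) / T \<le> 0")
        case True then show ?thesis using k by (simp add: R_def r_def U_def)
      next
        case False
        then have "T * R $ k = (1 - \<epsilon>) * (2 * n k * log 2 (Q P)) - 2"
          using k T0 by (simp add: R_def r_def U_def)
        then show ?thesis unfolding lg by simp
      qed
    qed
    then have "R \<in> capacity_region TYPE('m) \<mu> S demand P"
      unfolding capacity_region_def by (intro subsetD[OF closure_subset] CollectI)
    moreover have "\<bar>R $ k / log 2 P - d $ k\<bar> \<le> \<eta>" for k
    proof -
      have "\<bar>r P k / log 2 P - (if k \<in> U then \<rho> * x k else d $ k)\<bar> < \<eta> / 2" by (rule bspec[OF elim(1) UNIV_I])
      moreover have "\<bar>(if k \<in> U then \<rho> * x k else d $ k) - d $ k\<bar> \<le> \<eta> / 2" using near[of k] \<eta> by simp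
      moreover have "\<bar>u - v\<bar> < \<eta> / 2 \<Longrightarrow> \<bar>v - w\<bar> \<le> \<eta> / 2 \<Longrightarrow> \<bar>u - w\<bar> \<le> \<eta>" for u v w :: real by linarith
      ultimately show ?thesis by (simp add: R_def)
    qed
    ultimately show ?case by blast
  qed
qed

section \<open>Gaussian integrals on the complex plane\<close>

lemma borel_measurable_Complex [measurable]:
  "(\<lambda>(u, v). Complex u v) \<in> borel_measurable (borel \<Otimes>\<^sub>M borel)"
  by (subst borel_measurable_complex_iff) (auto simp: split_beta')

lemma distr_lborel_Complex: "distr (lborel \<Otimes>\<^sub>M lborel) borel (\<lambda>(u, v). Complex u v) = (lborel :: complex measure)"
proof (rule lborel_eqI[symmetric])
  fix l u :: complex
  assume le: "\<And>b. b \<in> Basis \<Longrightarrow> l \<bullet> b \<le> u \<bullet> b"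
  have lu: "Re l \<le> Re u" "Im l \<le> Im u" using le[of 1] le[of \<i>] by (auto simp: Basis_complex_def)
  have "(\<lambda>(u, v). Complex u v) -` box l u \<inter> space (lborel \<Otimes>\<^sub>M lborel) = {Re l<..<Re u} \<times> {Im l<..<Im u}"
    by (auto simp: box_def Basis_complex_def space_pair_measure)
  then have "emeasure (distr (lborel \<Otimes>\<^sub>M lborel) borel (\<lambda>(u, v). Complex u v)) (box l u) =
    emeasure (lborel \<Otimes>\<^sub>M lborel) ({Re l<..<Re u} \<times> {Im l<..<Im u})"
    by (subst emeasure_distr) auto
  also have "\<dots> = ennreal (Re u - Re l) * ennreal (Im u - Im l)"
    using lu by (subst lborel.emeasure_pair_measure_Times) auto
  also have "\<dots> = ennreal (\<Prod>b\<in>Basis. (u - l) \<bullet> b)"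
    using lu by (simp add: Basis_complex_def ennreal_mult)
  finally show "emeasure (distr (lborel \<Otimes>\<^sub>M lborel) borel (\<lambda>(u, v). Complex u v)) (box l u) = (\<Prod>b\<in>Basis. (u - l) \<bullet> b)" .
qed simp

text \<open>Left unnormalized: the peak is 1 and the total mass is \<open>pi * s\<close> for
  positive \<open>s\<close>, so the function can act as a weight bounded by 1 and, integrated, as a
  volume.\<close>

definition gauss :: "real \<Rightarrow> complex \<Rightarrow> ennreal" where
  "gauss s c = ennreal (exp (- (cmod c)\<^sup>2 / s))"

lemma gauss_measurable [measurable]: "gauss s \<in> borel_measurable borel"
  unfolding gauss_def[abs_def] by measurable

text \<open>Real and imaginary part separate into two normal densities of variance
  \<open>s / 2\<close>.\<close>

lemma gauss_integral:
  assumes "0 < s"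
  shows "(\<integral>\<^sup>+ c. gauss s (c - v) \<partial>lborel) = ennreal (pi * s)"
proof -
  define \<sigma> where "\<sigma> = sqrt (s / 2)"
  have \<sigma>: "0 < \<sigma>" "2 * \<sigma>\<^sup>2 = s" using assms by (auto simp: \<sigma>_def)
  have one: "(\<integral>\<^sup>+ x. ennreal (exp (- (x - a)\<^sup>2 / s)) \<partial>lborel) = ennreal (sqrt (pi * s))" for a :: real
  proof -
    interpret prob_space "density lborel (\<lambda>x. ennreal (normal_density a \<sigma> x))"
      by (rule prob_space_normal_density[OF \<sigma>(1)])
    have "1 = (\<integral>\<^sup>+ x. ennreal (normal_density a \<sigma> x) \<partial>lborel)"
      using emeasure_space_1 by (simp add: emeasure_density)
    also have "(\<lambda>x. ennreal (normal_density a \<sigma> x)) = (\<lambda>x. ennreal (1 / sqrt (pi * s)) * ennreal (exp (- (x - a)\<^sup>2 / s)))"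
    proof -
      have e: "2 * pi * \<sigma>\<^sup>2 = pi * s" using \<sigma>(2) by auto
      then show ?thesis
        unfolding normal_density_def \<sigma>(2) e using assms by (simp add: ennreal_mult[symmetric])
    qed
    also have "(\<integral>\<^sup>+ x. ennreal (1 / sqrt (pi * s)) * ennreal (exp (- (x - a)\<^sup>2 / s)) \<partial>lborel)
      = ennreal (1 / sqrt (pi * s)) * (\<integral>\<^sup>+ x. ennreal (exp (- (x - a)\<^sup>2 / s)) \<partial>lborel)"
      by (rule nn_integral_cmult) measurable
    finally have "ennreal (sqrt (pi * s)) * 1 = ennreal (sqrt (pi * s)) * (ennreal (1 / sqrt (pi * s)) * (\<integral>\<^sup>+ x. ennreal (exp (- (x - a)\<^sup>2 / s)) \<partial>lborel))"
      by simp
    also have "\<dots> = (\<integral>\<^sup>+ x. ennreal (exp (- (x - a)\<^sup>2 / s)) \<partial>lborel)"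
      using assms by (simp add: mult.assoc[symmetric] ennreal_mult[symmetric])
    finally show ?thesis by simp
  qed
  have m: "(\<lambda>c. gauss s (c - v)) \<in> borel_measurable borel" by measurable
  have "(\<integral>\<^sup>+ c. gauss s (c - v) \<partial>lborel) = (\<integral>\<^sup>+ x. gauss s ((case x of (a, b) \<Rightarrow> Complex a b) - v) \<partial>(lborel \<Otimes>\<^sub>M lborel))"
    unfolding distr_lborel_Complex[symmetric] by (rule nn_integral_distr) (use m in simp_all)
  also have "\<dots> = (\<integral>\<^sup>+ x. ennreal (exp (- (fst x - Re v)\<^sup>2 / s)) * ennreal (exp (- (snd x - Im v)\<^sup>2 / s)) \<partial>(lborel \<Otimes>\<^sub>M lborel))"
    by (intro nn_integral_cong)
       (auto simp: gauss_def cmod_power2 ennreal_mult[symmetric] exp_add[symmetric] add_divide_distrib diff_divide_distrib split: prod.split)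
  also have "\<dots> = (\<integral>\<^sup>+ a. \<integral>\<^sup>+ b. ennreal (exp (- (a - Re v)\<^sup>2 / s)) * ennreal (exp (- (b - Im v)\<^sup>2 / s)) \<partial>lborel \<partial>lborel)"
    by (subst lborel.nn_integral_fst[symmetric]) simp_all
  also have "\<dots> = ennreal (sqrt (pi * s)) * ennreal (sqrt (pi * s))"
    by (simp add: nn_integral_cmult nn_integral_multc one[simplified])
  also have "\<dots> = ennreal (pi * s)" using assms by (simp add: ennreal_mult[symmetric])
  finally show ?thesis .
qed

lemma std_complex_normal_density:
  "std_complex_normal = density lborel (\<lambda>c. ennreal (1 / pi) * gauss 1 c)"
proof -
  let ?f = "\<lambda>x. ennreal (normal_density 0 (1 / sqrt 2) x)"
  have "density lborel ?f \<Otimes>\<^sub>M density lborel ?f = density (lborel \<Otimes>\<^sub>M lborel) (\<lambda>(x, y). ?f x * ?f y)"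
  proof (rule pair_measure_density)
    show "sigma_finite_measure (density lborel ?f)"
      by (rule prob_space_imp_sigma_finite[OF prob_space_normal_density]) simp
  qed (auto intro: lborel.sigma_finite_measure_axioms)
  also have "(\<lambda>(x, y). ?f x * ?f y) = (\<lambda>z. ennreal (1 / pi) * gauss 1 (case z of (u, v) \<Rightarrow> Complex u v))"
  proof (rule ext, clarify)
    fix x y :: real
    have "normal_density 0 (1 / sqrt 2) x * normal_density 0 (1 / sqrt 2) y = (1 / pi) * exp (- (cmod (Complex x y))\<^sup>2 / 1)"
      unfolding normal_density_def by (simp add: power_divide cmod_power2 exp_add[symmetric])
    then show "?f x * ?f y = ennreal (1 / pi) * gauss 1 (Complex x y)"
      by (simp only: gauss_def ennreal_mult[symmetric] normal_density_nonneg) (simp add: ennreal_mult[symmetric])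
  qed
  finally have "std_complex_normal = distr (density (lborel \<Otimes>\<^sub>M lborel) (\<lambda>z. ennreal (1 / pi) * gauss 1 (case z of (u, v) \<Rightarrow> Complex u v))) borel (\<lambda>(u, v). Complex u v)"
    by (simp add: std_complex_normal_def Let_def)
  also have "\<dots> = density (distr (lborel \<Otimes>\<^sub>M lborel) borel (\<lambda>(u, v). Complex u v)) (\<lambda>c. ennreal (1 / pi) * gauss 1 c)"
    by (subst density_distr) auto
  finally show ?thesis by (simp add: distr_lborel_Complex)
qed

lemma nn_integral_std_complex_normal_shift:
  assumes [measurable]: "f \<in> borel_measurable borel"
  shows "(\<integral>\<^sup>+ z. f (m + z) \<partial>std_complex_normal) = (\<integral>\<^sup>+ y. f y * (ennreal (1 / pi) * gauss 1 (y - m)) \<partial>lborel)"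
proof -
  have "(\<integral>\<^sup>+ z. f (m + z) \<partial>std_complex_normal) = (\<integral>\<^sup>+ z. (ennreal (1 / pi) * gauss 1 z) * f (m + z) \<partial>lborel)"
    unfolding std_complex_normal_density by (subst nn_integral_density) auto
  also have "\<dots> = (\<integral>\<^sup>+ z. (ennreal (1 / pi) * gauss 1 ((m + z) - m)) * f (m + z) \<partial>lborel)" by simp
  also have "\<dots> = (\<integral>\<^sup>+ y. (ennreal (1 / pi) * gauss 1 (y - m)) * f y \<partial>distr lborel borel ((+) m))"
    by (subst nn_integral_distr) auto
  finally show ?thesis by (simp add: lborel_distr_plus mult.commute)
qed

text \<open>The exact value is 1. Spending half of the decay through
  \<open>t \<le> 2 * exp (t / 2)\<close> reduces the moment to a Gaussian mass.\<close>

lemma noise_second_moment: "(\<integral>\<^sup>+ z. ennreal ((cmod z)\<^sup>2) \<partial>std_complex_normal) \<le> 4"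
proof -
  have "(\<integral>\<^sup>+ z. ennreal ((cmod z)\<^sup>2) \<partial>std_complex_normal) = (\<integral>\<^sup>+ z. (ennreal (1 / pi) * gauss 1 z) * ennreal ((cmod z)\<^sup>2) \<partial>lborel)"
    unfolding std_complex_normal_density by (subst nn_integral_density) auto
  also have "\<dots> \<le> (\<integral>\<^sup>+ z. ennreal (2 / pi) * gauss 2 (z - 0) \<partial>lborel)"
  proof (rule nn_integral_mono)
    fix z :: complex
    define t where "t = (cmod z)\<^sup>2"
    have "t / 2 \<le> exp (t / 2)" using exp_ge_add_one_self[of "t / 2"] by linarith
    then have "exp (- t) * t \<le> exp (- t) * (2 * exp (t / 2))" by (intro mult_left_mono) auto
    also have "\<dots> = 2 * exp (- t / 2)" by (simp add: exp_add[symmetric])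
    finally have "1 / pi * exp (- t) * t \<le> 2 / pi * exp (- t / 2)" by (simp add: field_simps)
    then show "(ennreal (1 / pi) * gauss 1 z) * ennreal ((cmod z)\<^sup>2) \<le> ennreal (2 / pi) * gauss 2 (z - 0)"
      unfolding gauss_def t_def by (simp add: ennreal_mult[symmetric])
  qed
  also have "\<dots> = ennreal (2 / pi) * ennreal (pi * 2)"
    by (subst nn_integral_cmult) (auto simp: gauss_integral[where v = 0, simplified])
  also have "\<dots> = 4" by (simp add: ennreal_mult[symmetric])
  finally show ?thesis .
qed

lemma product_sigma_finite_lborel: "product_sigma_finite (\<lambda>_. lborel :: 'b::euclidean_space measure)"
  by (simp add: product_sigma_finite_def lborel.sigma_finite_measure_axioms)

text \<open>The received signal replaces the noise as variable of integration. For a fixed received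
  signal the compatible messages can then be counted, which is how the volume bounds work.\<close>

lemma nn_integral_noise_shift:
  assumes "finite I" and "f \<in> borel_measurable (PiM I (\<lambda>_. borel))"
  shows "(\<integral>\<^sup>+ z. f (\<lambda>i\<in>I. m i + z i) \<partial>PiM I (\<lambda>_. std_complex_normal)) =
    (\<integral>\<^sup>+ y. f y * (\<Prod>i\<in>I. ennreal (1 / pi) * gauss 1 (y i - m i)) \<partial>PiM I (\<lambda>_. lborel))"
  using assms
proof (induction I arbitrary: f rule: finite_induct)
  case empty
  then show ?case by (simp add: PiM_empty nn_integral_count_space_finite)
next
  case (insert x I)
  interpret N: product_sigma_finite "\<lambda>_. std_complex_normal"
    by (rule product_sigma_finite_const[OF prob_space_std_complex_normal])
  interpret Lb: product_sigma_finite "\<lambda>_. lborel :: complex measure" by (rule product_sigma_finite_lborel)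
  note f[measurable] = insert.prems
  have s2: "sets (PiM J (\<lambda>_. lborel)) = sets (PiM J (\<lambda>_. borel :: complex measure))" for J :: "'a set"
    by (intro sets_PiM_cong) auto
  define F where "F w = (\<integral>\<^sup>+ y. f (w(x := y)) * (ennreal (1 / pi) * gauss 1 (y - m x)) \<partial>lborel)" for w
  have fu: "(\<lambda>(w, y). f (w(x := y))) \<in> borel_measurable (PiM I (\<lambda>_. borel) \<Otimes>\<^sub>M borel)"
    using measurable_compose[OF measurable_add_dim[of x I "\<lambda>_. borel"] f] by (simp add: split_beta')
  have mf: "(\<lambda>y. f (w(x := y))) \<in> borel_measurable borel" if "w \<in> space (PiM I (\<lambda>_. borel))" for w
    using measurable_Pair2[OF fu that] by simp
  have Fm: "F \<in> borel_measurable (PiM I (\<lambda>_. borel))"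
    unfolding F_def[abs_def]
    by (rule lborel.borel_measurable_nn_integral) (use fu in \<open>simp add: split_beta'\<close>)
  have sh: "(\<lambda>z. \<lambda>i\<in>insert x I. m i + z i) \<in> measurable (PiM (insert x I) (\<lambda>_. std_complex_normal)) (PiM (insert x I) (\<lambda>_. borel))"
    by (intro measurable_restrict) auto
  have up: "(\<lambda>i\<in>insert x I. m i + (z(x := u)) i) = (\<lambda>i\<in>I. m i + z i)(x := m x + u)" for z u
    using insert.hyps by (auto simp: fun_eq_iff)
  have sp: "(\<lambda>i\<in>I. m i + z i) \<in> space (PiM I (\<lambda>_. borel))" for z by (simp add: space_PiM)
  have "(\<integral>\<^sup>+ z. f (\<lambda>i\<in>insert x I. m i + z i) \<partial>PiM (insert x I) (\<lambda>_. std_complex_normal))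
    = (\<integral>\<^sup>+ z. (\<integral>\<^sup>+ u. f (\<lambda>i\<in>insert x I. m i + (z(x := u)) i) \<partial>std_complex_normal) \<partial>PiM I (\<lambda>_. std_complex_normal))"
    by (rule N.product_nn_integral_insert[OF insert.hyps measurable_compose[OF sh f]])
  also have "\<dots> = (\<integral>\<^sup>+ z. F (\<lambda>i\<in>I. m i + z i) \<partial>PiM I (\<lambda>_. std_complex_normal))"
    unfolding up F_def using nn_integral_std_complex_normal_shift[OF mf[OF sp]] by (intro nn_integral_cong)
  also have "\<dots> = (\<integral>\<^sup>+ w. F w * (\<Prod>i\<in>I. ennreal (1 / pi) * gauss 1 (w i - m i)) \<partial>PiM I (\<lambda>_. lborel))"
    by (rule insert.IH[OF Fm])
  also have "\<dots> = (\<integral>\<^sup>+ w. (\<integral>\<^sup>+ y. f (w(x := y)) * (\<Prod>i\<in>insert x I. ennreal (1 / pi) * gauss 1 ((w(x := y)) i - m i)) \<partial>lborel) \<partial>PiM I (\<lambda>_. lborel))"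
  proof (rule nn_integral_cong)
    fix w assume "w \<in> space (PiM I (\<lambda>_. lborel :: complex measure))"
    then have w: "w \<in> space (PiM I (\<lambda>_. borel))" by (simp add: space_PiM)
    note mf[OF w, measurable]
    have pr: "(\<Prod>i\<in>insert x I. ennreal (1 / pi) * gauss 1 ((w(x := y)) i - m i)) =
      (ennreal (1 / pi) * gauss 1 (y - m x)) * (\<Prod>i\<in>I. ennreal (1 / pi) * gauss 1 (w i - m i))" for y
    proof -
      have "(\<Prod>i\<in>I. ennreal (1 / pi) * gauss 1 ((w(x := y)) i - m i)) = (\<Prod>i\<in>I. ennreal (1 / pi) * gauss 1 (w i - m i))"
        using insert.hyps by (intro prod.cong) auto
      then show ?thesis using insert.hyps by simp
    qed
    show "F w * (\<Prod>i\<in>I. ennreal (1 / pi) * gauss 1 (w i - m i)) =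
      (\<integral>\<^sup>+ y. f (w(x := y)) * (\<Prod>i\<in>insert x I. ennreal (1 / pi) * gauss 1 ((w(x := y)) i - m i)) \<partial>lborel)"
      unfolding F_def pr mult.assoc[symmetric] by (rule nn_integral_multc[symmetric]) measurable
  qed
  also have "\<dots> = (\<integral>\<^sup>+ y. f y * (\<Prod>i\<in>insert x I. ennreal (1 / pi) * gauss 1 (y i - m i)) \<partial>PiM (insert x I) (\<lambda>_. lborel))"
  proof (rule Lb.product_nn_integral_insert[OF insert.hyps, symmetric])
    show "(\<lambda>y. f y * (\<Prod>i\<in>insert x I. ennreal (1 / pi) * gauss 1 (y i - m i))) \<in> borel_measurable (PiM (insert x I) (\<lambda>_. lborel))"
      using f by (intro borel_measurable_times_ennreal borel_measurable_prod_ennreal) (auto simp: s2 cong: measurable_cong_sets)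
  qed
  finally show ?case .
qed

lemma nn_integral_gauss_prod:
  assumes "finite I" "\<And>i. i \<in> I \<Longrightarrow> 0 < s i"
  shows "(\<integral>\<^sup>+ y. (\<Prod>i\<in>I. C i * gauss (s i) (y i - v i)) \<partial>PiM I (\<lambda>_. lborel)) = (\<Prod>i\<in>I. C i * ennreal (pi * s i))"
proof -
  interpret Lb: product_sigma_finite "\<lambda>_. lborel :: complex measure" by (rule product_sigma_finite_lborel)
  have "(\<integral>\<^sup>+ y. (\<Prod>i\<in>I. C i * gauss (s i) (y i - v i)) \<partial>PiM I (\<lambda>_. lborel)) = (\<Prod>i\<in>I. \<integral>\<^sup>+ y. C i * gauss (s i) (y - v i) \<partial>lborel)"
    by (rule Lb.product_nn_integral_prod[OF assms(1), of "\<lambda>i y. C i * gauss (s i) (y - v i)"]) auto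
  also have "\<dots> = (\<Prod>i\<in>I. C i * ennreal (pi * s i))"
    using assms(2) by (intro prod.cong refl) (simp add: nn_integral_cmult gauss_integral)
  finally show ?thesis .
qed

text \<open>The noises of two receivers are disjoint blocks of one product law, so they can be
  integrated one after the other.\<close>

lemma nn_integral_two_blocks:
  assumes \<mu>: "prob_space \<mu>" and K: "finite K" and inj: "inj_on \<sigma> I" "inj_on \<sigma>' I"
    and sub: "\<sigma> ` I \<subseteq> K" "\<sigma>' ` I \<subseteq> K" and disj: "\<sigma> ` I \<inter> \<sigma>' ` I = {}"
    and G: "(\<lambda>(x, x'). G x x') \<in> borel_measurable (PiM I (\<lambda>_. \<mu>) \<Otimes>\<^sub>M PiM I (\<lambda>_. \<mu>))"
  shows "(\<integral>\<^sup>+ z. G (\<lambda>i\<in>I. z (\<sigma> i)) (\<lambda>i\<in>I. z (\<sigma>' i)) \<partial>PiM K (\<lambda>_. \<mu>)) =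
    (\<integral>\<^sup>+ x. (\<integral>\<^sup>+ x'. G x x' \<partial>PiM I (\<lambda>_. \<mu>)) \<partial>PiM I (\<lambda>_. \<mu>))"
proof -
  interpret product_sigma_finite "\<lambda>_. \<mu>" by (rule product_sigma_finite_const[OF \<mu>])
  interpret PI: prob_space "PiM I (\<lambda>_. \<mu>)" by (rule prob_space_PiM_const[OF \<mu>])
  define J where "J = \<sigma>' ` I"
  have JK: "(K - J) \<union> J = K" "finite J" using sub(2) K finite_subset by (auto simp: J_def)
  have sK: "\<sigma> ` I \<subseteq> K - J" using sub(1) disj by (auto simp: J_def)
  have mm: "(\<lambda>z. G (\<lambda>i\<in>I. z (\<sigma> i)) (\<lambda>i\<in>I. z (\<sigma>' i))) \<in> borel_measurable (PiM K (\<lambda>_. \<mu>))"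
    using measurable_compose[OF measurable_Pair[OF measurable_reindex[OF sub(1)] measurable_reindex[OF sub(2)]] G]
    by simp
  have "(\<integral>\<^sup>+ z. G (\<lambda>i\<in>I. z (\<sigma> i)) (\<lambda>i\<in>I. z (\<sigma>' i)) \<partial>PiM K (\<lambda>_. \<mu>))
    = (\<integral>\<^sup>+ u. (\<integral>\<^sup>+ v. G (\<lambda>i\<in>I. merge (K - J) J (u, v) (\<sigma> i)) (\<lambda>i\<in>I. merge (K - J) J (u, v) (\<sigma>' i)) \<partial>PiM J (\<lambda>_. \<mu>)) \<partial>PiM (K - J) (\<lambda>_. \<mu>))"
    using product_nn_integral_fold[of "K - J" J "\<lambda>z. G (\<lambda>i\<in>I. z (\<sigma> i)) (\<lambda>i\<in>I. z (\<sigma>' i))"] JK K mm by auto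
  also have "\<dots> = (\<integral>\<^sup>+ u. (\<integral>\<^sup>+ v. G (\<lambda>i\<in>I. u (\<sigma> i)) (\<lambda>i\<in>I. v (\<sigma>' i)) \<partial>PiM J (\<lambda>_. \<mu>)) \<partial>PiM (K - J) (\<lambda>_. \<mu>))"
  proof (intro nn_integral_cong arg_cong2[where f = G])
    fix u v
    show "(\<lambda>i\<in>I. merge (K - J) J (u, v) (\<sigma> i)) = (\<lambda>i\<in>I. u (\<sigma> i))"
      using sK by (auto simp: fun_eq_iff merge_def)
    show "(\<lambda>i\<in>I. merge (K - J) J (u, v) (\<sigma>' i)) = (\<lambda>i\<in>I. v (\<sigma>' i))"
      by (auto simp: fun_eq_iff merge_def J_def)
  qed
  also have "\<dots> = (\<integral>\<^sup>+ u. (\<integral>\<^sup>+ x'. G (\<lambda>i\<in>I. u (\<sigma> i)) x' \<partial>PiM I (\<lambda>_. \<mu>)) \<partial>PiM (K - J) (\<lambda>_. \<mu>))"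
  proof (rule nn_integral_cong)
    fix u assume u: "u \<in> space (PiM (K - J) (\<lambda>_. \<mu>))"
    have "(\<lambda>i\<in>I. u (\<sigma> i)) \<in> space (PiM I (\<lambda>_. \<mu>))" by (rule measurable_space[OF measurable_reindex[OF sK] u])
    from measurable_Pair2[OF G this]
    show "(\<integral>\<^sup>+ v. G (\<lambda>i\<in>I. u (\<sigma> i)) (\<lambda>i\<in>I. v (\<sigma>' i)) \<partial>PiM J (\<lambda>_. \<mu>)) = (\<integral>\<^sup>+ x'. G (\<lambda>i\<in>I. u (\<sigma> i)) x' \<partial>PiM I (\<lambda>_. \<mu>))"
      by (intro nn_integral_reindex[OF \<mu> inj(2)]) (auto simp: J_def)
  qed
  also have "\<dots> = (\<integral>\<^sup>+ x. (\<integral>\<^sup>+ x'. G x x' \<partial>PiM I (\<lambda>_. \<mu>)) \<partial>PiM I (\<lambda>_. \<mu>))"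
    by (rule nn_integral_reindex[OF \<mu> inj(1) sK]) (use PI.borel_measurable_nn_integral[OF G] in simp)
  finally show ?thesis .
qed

section \<open>Volume bounds for a fixed channel realization\<close>

lemma gauss_le_1: "0 < s \<Longrightarrow> gauss s c \<le> 1"
  by (simp add: gauss_def ennreal_le_1)

lemma card_messages_fixed:
  fixes W :: "'k::finite \<Rightarrow> nat"
  shows "card {w. (\<forall>k. w k < W k) \<and> (\<forall>k\<in>D. w k = u k)} \<le> (\<Prod>k\<in>- D. W k)"
proof -
  let ?A = "{w. (\<forall>k. w k < W k) \<and> (\<forall>k\<in>D. w k = u k)}"
  have "inj_on (\<lambda>w. restrict w (- D)) ?A"
  proof (rule inj_onI)
    fix w w' assume w: "w \<in> ?A" "w' \<in> ?A" and eq: "restrict w (- D) = restrict w' (- D)"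
    show "w = w'"
    proof
      fix k show "w k = w' k"
        using w fun_cong[OF eq, of k] by (cases "k \<in> D") auto
    qed
  qed
  moreover have "(\<lambda>w. restrict w (- D)) ` ?A \<subseteq> (\<Pi>\<^sub>E k\<in>- D. {..<W k})" by auto
  moreover have "finite (\<Pi>\<^sub>E k\<in>- D. {..<W k})" by (intro finite_PiE) auto
  ultimately have "card ?A \<le> card (\<Pi>\<^sub>E k\<in>- D. {..<W k})" by (rule card_inj_on_le)
  then show ?thesis by (simp add: card_PiE)
qed

lemma measurable_pred_of_count_space:
  assumes "f \<in> measurable M (count_space UNIV)"
  shows "{x \<in> space M. f x = c} \<in> sets M"
  using measurable_sets[OF assms, of "{c}"] by (simp add: vimage_def Int_def conj_commute)

text \<open>At a fixed output the decoder pins down the messages in \<open>D\<close>, so the number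
  of contributing tuples is at most the product of the other \<open>W k\<close>. Per coordinate the
  noise density is at most \<open>1 / pi\<close> and the weight has mass \<open>pi * P\<close>,
  which leaves a factor \<open>P\<close>; this volume takes the place of the output entropy.\<close>

lemma one_receiver_bound:
  fixes W :: "'k::finite \<Rightarrow> nat" and m :: "('k \<Rightarrow> nat) \<Rightarrow> 'i \<Rightarrow> complex"
  assumes I: "finite I" and P: "0 < P"
    and dec: "\<And>k. k \<in> D \<Longrightarrow> (\<lambda>y. dec y k) \<in> measurable (PiM I (\<lambda>_. borel)) (count_space UNIV)"
  shows "(\<Sum>w | \<forall>k. w k < W k. \<integral>\<^sup>+ z. (indicator {y. \<forall>k\<in>D. dec y k = w k} (\<lambda>i\<in>I. m w i + z i) *
      (\<Prod>i\<in>I. gauss P (m w i + z i))) \<partial>PiM I (\<lambda>_. std_complex_normal))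
    \<le> of_nat (\<Prod>k\<in>- D. W k) * ennreal (P ^ card I)"
proof -
  let ?\<Omega> = "{w. \<forall>k. w k < W k}"
  let ?L = "PiM I (\<lambda>_. lborel :: complex measure)"
  have s2: "sets ?L = sets (PiM I (\<lambda>_. borel))" by (intro sets_PiM_cong) auto
  define f where "f w y = indicator {y. \<forall>k\<in>D. dec y k = w k} y * (\<Prod>i\<in>I. gauss P (y i))" for w and y :: "'i \<Rightarrow> complex"
  have set: "{y \<in> space (PiM I (\<lambda>_. borel)). \<forall>k\<in>D. dec y k = w k} \<in> sets (PiM I (\<lambda>_. borel))" for w
    by (rule sets.sets_Collect_finite_All[OF measurable_pred_of_count_space[OF dec]]) auto
  have ind: "(indicator {y. \<forall>k\<in>D. dec y k = w k} :: _ \<Rightarrow> ennreal) \<in> borel_measurable (PiM I (\<lambda>_. borel))" for w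
    using set[of w] by (subst borel_measurable_indicator_iff) (simp add: Int_def conj_commute)
  have fm: "f w \<in> borel_measurable (PiM I (\<lambda>_. borel))" for w
    unfolding f_def[abs_def] by (intro borel_measurable_times_ennreal ind borel_measurable_prod_ennreal) measurable
  have gm: "(\<lambda>y. f w y * (\<Prod>i\<in>I. ennreal (1 / pi) * gauss 1 (y i - m w i))) \<in> borel_measurable ?L" for w
    using fm[of w] by (intro borel_measurable_times_ennreal borel_measurable_prod_ennreal) (auto cong: measurable_cong_sets simp: s2)
  have "(\<Sum>w\<in>?\<Omega>. \<integral>\<^sup>+ z. (indicator {y. \<forall>k\<in>D. dec y k = w k} (\<lambda>i\<in>I. m w i + z i) *
      (\<Prod>i\<in>I. gauss P (m w i + z i))) \<partial>PiM I (\<lambda>_. std_complex_normal))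
    = (\<Sum>w\<in>?\<Omega>. \<integral>\<^sup>+ z. f w (\<lambda>i\<in>I. m w i + z i) \<partial>PiM I (\<lambda>_. std_complex_normal))"
    by (simp add: f_def)
  also have "\<dots> = (\<Sum>w\<in>?\<Omega>. \<integral>\<^sup>+ y. f w y * (\<Prod>i\<in>I. ennreal (1 / pi) * gauss 1 (y i - m w i)) \<partial>?L)"
    by (intro sum.cong refl nn_integral_noise_shift I fm)
  also have "\<dots> = (\<integral>\<^sup>+ y. (\<Sum>w\<in>?\<Omega>. f w y * (\<Prod>i\<in>I. ennreal (1 / pi) * gauss 1 (y i - m w i))) \<partial>?L)"
    by (rule nn_integral_sum[symmetric]) (rule gm)
  also have "\<dots> \<le> (\<integral>\<^sup>+ y. of_nat (\<Prod>k\<in>- D. W k) * (\<Prod>i\<in>I. ennreal (1 / pi) * gauss P (y i - 0)) \<partial>?L)"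
  proof (rule nn_integral_mono)
    fix y
    let ?A = "{w. (\<forall>k. w k < W k) \<and> (\<forall>k\<in>D. w k = dec y k)}"
    have "(\<Sum>w\<in>?\<Omega>. f w y * (\<Prod>i\<in>I. ennreal (1 / pi) * gauss 1 (y i - m w i)))
      = (\<Sum>w\<in>?A. f w y * (\<Prod>i\<in>I. ennreal (1 / pi) * gauss 1 (y i - m w i)))"
      by (rule sum.mono_neutral_right[OF messages_finite]) (auto simp: f_def indicator_def)
    also have "\<dots> \<le> (\<Sum>w\<in>?A. (\<Prod>i\<in>I. gauss P (y i)) * (\<Prod>i\<in>I. ennreal (1 / pi)))"
    proof (intro sum_mono mult_mono)
      show "f w y \<le> (\<Prod>i\<in>I. gauss P (y i))" for w by (simp add: f_def indicator_def)
      show "(\<Prod>i\<in>I. ennreal (1 / pi) * gauss 1 (y i - m w i)) \<le> (\<Prod>i\<in>I. ennreal (1 / pi))" for w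
        by (intro prod_mono_ennreal) (metis gauss_le_1 mult.right_neutral mult_left_mono zero_le zero_less_one)
    qed auto
    also have "\<dots> = of_nat (card ?A) * (\<Prod>i\<in>I. ennreal (1 / pi) * gauss P (y i - 0))"
      by (simp add: prod.distrib mult.commute)
    also have "\<dots> \<le> of_nat (\<Prod>k\<in>- D. W k) * (\<Prod>i\<in>I. ennreal (1 / pi) * gauss P (y i - 0))"
      using card_messages_fixed[of W D "dec y"] by (intro mult_right_mono) (auto simp del: of_nat_prod)
    finally show "(\<Sum>w\<in>?\<Omega>. f w y * (\<Prod>i\<in>I. ennreal (1 / pi) * gauss 1 (y i - m w i)))
      \<le> of_nat (\<Prod>k\<in>- D. W k) * (\<Prod>i\<in>I. ennreal (1 / pi) * gauss P (y i - 0))" .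
  qed
  also have "\<dots> = of_nat (\<Prod>k\<in>- D. W k) * (\<integral>\<^sup>+ y. (\<Prod>i\<in>I. ennreal (1 / pi) * gauss P (y i - 0)) \<partial>?L)"
    by (rule nn_integral_cmult) (intro borel_measurable_prod_ennreal, auto)
  also have "(\<integral>\<^sup>+ y. (\<Prod>i\<in>I. ennreal (1 / pi) * gauss P (y i - 0)) \<partial>?L) = (\<Prod>i\<in>I. ennreal (1 / pi) * ennreal (pi * P))"
    using nn_integral_gauss_prod[OF I, of "\<lambda>_. P" "\<lambda>_. ennreal (1 / pi)" "\<lambda>_. 0"] P by simp
  also have "\<dots> = ennreal (P ^ card I)" using P by (simp add: ennreal_mult[symmetric] ennreal_power)
  finally show ?thesis .
qed

text \<open>
  For given outputs \<open>y\<close> and \<open>y'\<close> the second decoder allows only one value of message \<open>i0\<close>, and the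
  bound \<open>V\<close> does not depend on that value. Hence message \<open>i0\<close> is not counted at all.
\<close>

lemma two_receiver_bound:
  fixes W :: "'k::finite \<Rightarrow> nat" and m m' :: "('k \<Rightarrow> nat) \<Rightarrow> 'i \<Rightarrow> complex"
  assumes I: "finite I" and P: "0 < P" and s: "\<And>i. i \<in> I \<Longrightarrow> 0 < s i" and i0: "i0 \<notin> D"
    and dec: "\<And>k. k \<in> D \<Longrightarrow> (\<lambda>y. dec y k) \<in> measurable (PiM I (\<lambda>_. borel)) (count_space UNIV)"
    and dec': "dec' \<in> measurable (PiM I (\<lambda>_. borel)) (count_space UNIV)"
    and V: "\<And>w y y'. (\<Prod>i\<in>I. gauss 1 (y i - m w i)) * (\<Prod>i\<in>I. gauss 1 (y' i - m' w i)) * (\<Prod>i\<in>I. gauss P (y' i))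
        \<le> (\<Prod>i\<in>I. gauss (s i) (y' i - V (w(i0 := 0)) y i))"
  shows "(\<Sum>w | \<forall>k. w k < W k. \<integral>\<^sup>+ z. \<integral>\<^sup>+ z'. (indicator {y. \<forall>k\<in>D. dec y k = w k} (\<lambda>i\<in>I. m w i + z i) *
      indicator {y. dec' y = w i0} (\<lambda>i\<in>I. m' w i + z' i) *
      ((\<Prod>i\<in>I. gauss P (m w i + z i)) * (\<Prod>i\<in>I. gauss P (m' w i + z' i)))) \<partial>PiM I (\<lambda>_. std_complex_normal) \<partial>PiM I (\<lambda>_. std_complex_normal))
    \<le> of_nat (\<Prod>k\<in>- insert i0 D. W k) * ennreal (P ^ card I * (\<Prod>i\<in>I. s i))"
proof -
  let ?\<Omega> = "{w. \<forall>k. w k < W k}"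
  let ?L = "PiM I (\<lambda>_. lborel :: complex measure)"
  let ?B = "PiM I (\<lambda>_. borel :: complex measure)"
  have s2: "sets ?L = sets ?B" by (intro sets_PiM_cong) auto
  interpret Lb: product_sigma_finite "\<lambda>_. lborel :: complex measure" by (rule product_sigma_finite_lborel)
  interpret LL: sigma_finite_measure ?L by (rule Lb.sigma_finite[OF I])
  define \<phi> where "\<phi> n y = (\<Prod>i\<in>I. ennreal (1 / pi) * gauss 1 (y i - n i))" for n y :: "'i \<Rightarrow> complex"
  define e where "e y = (\<Prod>i\<in>I. gauss P (y i))" for y :: "'i \<Rightarrow> complex"
  define p where "p w y = (indicator {y. \<forall>k\<in>D. dec y k = w k} y :: ennreal)" for w and y :: "'i \<Rightarrow> complex"
  define p' where "p' w y = (indicator {y. dec' y = w i0} y :: ennreal)" for w and y :: "'i \<Rightarrow> complex"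
  have pm: "p w \<in> borel_measurable ?B" for w
  proof -
    have "{y \<in> space ?B. \<forall>k\<in>D. dec y k = w k} \<in> sets ?B"
      by (rule sets.sets_Collect_finite_All[OF measurable_pred_of_count_space[OF dec]]) auto
    then show ?thesis unfolding p_def[abs_def] by (subst borel_measurable_indicator_iff) (simp add: Int_def conj_commute)
  qed
  have pm': "p' w \<in> borel_measurable ?B" for w
    using measurable_pred_of_count_space[OF dec'] unfolding p'_def[abs_def]
    by (subst borel_measurable_indicator_iff) (simp add: Int_def conj_commute)
  have em: "e \<in> borel_measurable ?B" unfolding e_def[abs_def] by (intro borel_measurable_prod_ennreal) measurable
  have \<phi>m: "\<phi> n \<in> borel_measurable ?B" for n unfolding \<phi>_def[abs_def] by (intro borel_measurable_prod_ennreal) measurable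
  define F where "F w = (\<integral>\<^sup>+ y'. p' w y' * e y' * \<phi> (m' w) y' \<partial>?L)" for w
  have step: "(\<integral>\<^sup>+ z. \<integral>\<^sup>+ z'. (p w (\<lambda>i\<in>I. m w i + z i) * p' w (\<lambda>i\<in>I. m' w i + z' i) *
      (e (\<lambda>i\<in>I. m w i + z i) * e (\<lambda>i\<in>I. m' w i + z' i))) \<partial>PiM I (\<lambda>_. std_complex_normal) \<partial>PiM I (\<lambda>_. std_complex_normal))
    = (\<integral>\<^sup>+ y. \<integral>\<^sup>+ y'. (p w y * e y * \<phi> (m w) y) * (p' w y' * e y' * \<phi> (m' w) y') \<partial>?L \<partial>?L)" for w
  proof -
    have inner: "(\<integral>\<^sup>+ z'. (p' w (\<lambda>i\<in>I. m' w i + z' i) * e (\<lambda>i\<in>I. m' w i + z' i)) \<partial>PiM I (\<lambda>_. std_complex_normal)) = F w"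
      unfolding F_def \<phi>_def using nn_integral_noise_shift[OF I, of "\<lambda>y. p' w y * e y" "m' w"] pm' em by simp
    have m1: "(\<lambda>z'. p' w (\<lambda>i\<in>I. m' w i + z' i) * e (\<lambda>i\<in>I. m' w i + z' i)) \<in> borel_measurable (PiM I (\<lambda>_. std_complex_normal))"
    proof -
      have "(\<lambda>z. \<lambda>i\<in>I. m' w i + z i) \<in> measurable (PiM I (\<lambda>_. std_complex_normal)) ?B"
        by (intro measurable_restrict) auto
      then show ?thesis using pm' em by (intro borel_measurable_times_ennreal) (auto intro: measurable_compose)
    qed
    have "(\<integral>\<^sup>+ z. \<integral>\<^sup>+ z'. (p w (\<lambda>i\<in>I. m w i + z i) * p' w (\<lambda>i\<in>I. m' w i + z' i) *
        (e (\<lambda>i\<in>I. m w i + z i) * e (\<lambda>i\<in>I. m' w i + z' i))) \<partial>PiM I (\<lambda>_. std_complex_normal) \<partial>PiM I (\<lambda>_. std_complex_normal))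
      = (\<integral>\<^sup>+ z. (p w (\<lambda>i\<in>I. m w i + z i) * e (\<lambda>i\<in>I. m w i + z i)) * F w \<partial>PiM I (\<lambda>_. std_complex_normal))"
      unfolding inner[symmetric]
      by (intro nn_integral_cong, subst nn_integral_cmult[OF m1, symmetric]) (simp add: ac_simps)
    also have "\<dots> = (\<integral>\<^sup>+ y. (p w y * e y * F w) * \<phi> (m w) y \<partial>?L)"
      unfolding \<phi>_def using nn_integral_noise_shift[OF I, of "\<lambda>y. p w y * e y * F w" "m w"] pm em by simp
    also have "\<dots> = (\<integral>\<^sup>+ y. \<integral>\<^sup>+ y'. (p w y * e y * \<phi> (m w) y) * (p' w y' * e y' * \<phi> (m' w) y') \<partial>?L \<partial>?L)"
    proof (rule nn_integral_cong)
      fix y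
      have "(\<lambda>y'. p' w y' * e y' * \<phi> (m' w) y') \<in> borel_measurable ?L"
        using pm' em \<phi>m by (intro borel_measurable_times_ennreal) (auto cong: measurable_cong_sets simp: s2)
      from nn_integral_cmult[OF this, of "p w y * e y * \<phi> (m w) y"]
      show "(p w y * e y * F w) * \<phi> (m w) y = (\<integral>\<^sup>+ y'. (p w y * e y * \<phi> (m w) y) * (p' w y' * e y' * \<phi> (m' w) y') \<partial>?L)"
        unfolding F_def by (simp add: ac_simps)
    qed
    finally show ?thesis .
  qed
  define g where "g w y y' = (p w y * e y * \<phi> (m w) y) * (p' w y' * e y' * \<phi> (m' w) y')" for w y y'
  have gm2: "(\<lambda>(y, y'). g w y y') \<in> borel_measurable (?L \<Otimes>\<^sub>M ?L)" for w
  proof -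
    have c: "f \<in> borel_measurable ?B \<Longrightarrow> (\<lambda>x. f (fst x)) \<in> borel_measurable (?L \<Otimes>\<^sub>M ?L)"
      "f \<in> borel_measurable ?B \<Longrightarrow> (\<lambda>x. f (snd x)) \<in> borel_measurable (?L \<Otimes>\<^sub>M ?L)" for f :: "_ \<Rightarrow> ennreal"
      using measurable_compose[OF measurable_fst[of ?L ?L], of f borel] measurable_compose[OF measurable_snd[of ?L ?L], of f borel]
      by (auto cong: measurable_cong_sets simp: s2)
    show ?thesis unfolding g_def split_beta'
      by (intro borel_measurable_times_ennreal c pm em \<phi>m pm')
  qed
  have gm1: "g w y \<in> borel_measurable ?L" if "y \<in> space ?L" for w y
    using measurable_Pair2[OF gm2 that] by simp
  have gm: "(\<lambda>y. \<integral>\<^sup>+ y'. g w y y' \<partial>?L) \<in> borel_measurable ?L" for w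
    using LL.borel_measurable_nn_integral[OF gm2] by simp
  \<comment> \<open>Message \<open>i0\<close> is replaced by the placeholder 0. Forgetting its value
    is injective on the contributing tuples, because the second decoder has fixed it.\<close>
  let ?A = "\<lambda>y. {w. (\<forall>k. w k < W k) \<and> (\<forall>k\<in>insert i0 D. w k = ((dec y)(i0 := 0)) k)}"
  have point: "(\<Sum>w\<in>?\<Omega>. g w y y') \<le> (\<Sum>w\<in>?A y. e y * ((\<Prod>i\<in>I. ennreal (1 / pi)) * (\<Prod>i\<in>I. ennreal (1 / pi) * gauss (s i) (y' i - V w y i))))" for y y'
  proof -
    let ?A' = "{w\<in>?\<Omega>. (\<forall>k\<in>D. dec y k = w k) \<and> dec' y' = w i0}"
    let ?G = "\<lambda>w. e y * ((\<Prod>i\<in>I. ennreal (1 / pi)) * (\<Prod>i\<in>I. ennreal (1 / pi) * gauss (s i) (y' i - V w y i)))"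
    have fin: "finite (?A y)" by (rule finite_subset[OF _ messages_finite[of W]]) auto
    have "(\<Sum>w\<in>?\<Omega>. g w y y') = (\<Sum>w\<in>?A'. g w y y')"
      by (rule sum.mono_neutral_right[OF messages_finite]) (auto simp: g_def p_def p'_def indicator_def)
    also have "\<dots> \<le> (\<Sum>w\<in>?A'. ?G (w(i0 := 0)))"
    proof (rule sum_mono)
      fix w
      have "g w y y' \<le> (1 * e y * \<phi> (m w) y) * (1 * e y' * \<phi> (m' w) y')"
        unfolding g_def by (intro mult_mono mult_right_mono) (auto simp: p_def p'_def indicator_def)
      also have "\<dots> = e y * ((\<Prod>i\<in>I. ennreal (1 / pi)) * (\<Prod>i\<in>I. ennreal (1 / pi)) * ((\<Prod>i\<in>I. gauss 1 (y i - m w i)) * (\<Prod>i\<in>I. gauss 1 (y' i - m' w i)) * e y'))"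
        unfolding \<phi>_def prod.distrib by (simp only: ac_simps mult_1)
      also have "\<dots> \<le> e y * ((\<Prod>i\<in>I. ennreal (1 / pi)) * (\<Prod>i\<in>I. ennreal (1 / pi)) * (\<Prod>i\<in>I. gauss (s i) (y' i - V (w(i0 := 0)) y i)))"
        using V[of y w y'] unfolding e_def[of y', symmetric] by (intro mult_left_mono) auto
      also have "\<dots> = ?G (w(i0 := 0))" by (simp only: prod.distrib ac_simps)
      finally show "g w y y' \<le> ?G (w(i0 := 0))" .
    qed
    also have "\<dots> = (\<Sum>w\<in>(\<lambda>w. w(i0 := 0)) ` ?A'. ?G w)"
    proof (rule sum.reindex_cong[symmetric, OF _ refl refl])
      show "inj_on (\<lambda>w. w(i0 := 0)) ?A'"
      proof (rule inj_onI)
        fix w w' assume w: "w \<in> ?A'" "w' \<in> ?A'" "w(i0 := 0) = w'(i0 := 0)"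
        show "w = w'"
        proof
          fix k show "w k = w' k" using w(1,2) fun_cong[OF w(3), of k] by (cases "k = i0") auto
        qed
      qed
    qed
    \<comment> \<open>The tuple with 0 in place \<open>i0\<close> is admissible, as
      \<open>W i0\<close> is positive once some \<open>w i0\<close> lies below it.\<close>
    also have "\<dots> \<le> (\<Sum>w\<in>?A y. ?G w)"
      using i0 by (intro sum_mono2[OF fin]) (auto, metis gr0I not_less0)
    finally show ?thesis .
  qed
  let ?K = "(\<Prod>i\<in>I. ennreal (1 / pi)) * (\<Prod>i\<in>I. ennreal (1 / pi) * ennreal (pi * s i))"
  have Vint: "(\<integral>\<^sup>+ y'. (\<Sum>w\<in>?A y. e y * ((\<Prod>i\<in>I. ennreal (1 / pi)) * (\<Prod>i\<in>I. ennreal (1 / pi) * gauss (s i) (y' i - V w y i)))) \<partial>?L)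
    = of_nat (card (?A y)) * (e y * ?K)" for y
  proof -
    have "(\<integral>\<^sup>+ y'. (\<Sum>w\<in>?A y. e y * ((\<Prod>i\<in>I. ennreal (1 / pi)) * (\<Prod>i\<in>I. ennreal (1 / pi) * gauss (s i) (y' i - V w y i)))) \<partial>?L)
      = (\<Sum>w\<in>?A y. \<integral>\<^sup>+ y'. e y * ((\<Prod>i\<in>I. ennreal (1 / pi)) * (\<Prod>i\<in>I. ennreal (1 / pi) * gauss (s i) (y' i - V w y i))) \<partial>?L)"
      by (rule nn_integral_sum) (intro borel_measurable_times_ennreal borel_measurable_const borel_measurable_prod_ennreal, measurable)
    also have "\<dots> = (\<Sum>w\<in>?A y. e y * ?K)"
    proof (intro sum.cong refl)
      fix w
      have mm: "(\<lambda>y'. \<Prod>i\<in>I. ennreal (1 / pi) * gauss (s i) (y' i - V w y i)) \<in> borel_measurable ?L"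
        by (intro borel_measurable_prod_ennreal) measurable
      show "(\<integral>\<^sup>+ y'. e y * ((\<Prod>i\<in>I. ennreal (1 / pi)) * (\<Prod>i\<in>I. ennreal (1 / pi) * gauss (s i) (y' i - V w y i))) \<partial>?L) = e y * ?K"
        using nn_integral_gauss_prod[where C = "\<lambda>_. ennreal (1 / pi)" and v = "V w y", OF I s]
        by (simp only: nn_integral_cmult borel_measurable_times_ennreal borel_measurable_const mm)
    qed
    finally show ?thesis by simp
  qed
  have "(\<Sum>w\<in>?\<Omega>. \<integral>\<^sup>+ z. \<integral>\<^sup>+ z'. (p w (\<lambda>i\<in>I. m w i + z i) * p' w (\<lambda>i\<in>I. m' w i + z' i) *
      (e (\<lambda>i\<in>I. m w i + z i) * e (\<lambda>i\<in>I. m' w i + z' i))) \<partial>PiM I (\<lambda>_. std_complex_normal) \<partial>PiM I (\<lambda>_. std_complex_normal))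
    = (\<Sum>w\<in>?\<Omega>. \<integral>\<^sup>+ y. \<integral>\<^sup>+ y'. g w y y' \<partial>?L \<partial>?L)"
    unfolding step g_def ..
  also have "\<dots> = (\<integral>\<^sup>+ y. (\<Sum>w\<in>?\<Omega>. \<integral>\<^sup>+ y'. g w y y' \<partial>?L) \<partial>?L)"
    by (rule nn_integral_sum[symmetric]) (rule gm)
  also have "\<dots> = (\<integral>\<^sup>+ y. \<integral>\<^sup>+ y'. (\<Sum>w\<in>?\<Omega>. g w y y') \<partial>?L \<partial>?L)"
    by (intro nn_integral_cong nn_integral_sum[symmetric]) (rule gm1)
  also have "\<dots> \<le> (\<integral>\<^sup>+ y. of_nat (card (?A y)) * (e y * ?K) \<partial>?L)"
    unfolding Vint[symmetric] by (intro nn_integral_mono point)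
  also have "\<dots> \<le> (\<integral>\<^sup>+ y. of_nat (\<Prod>k\<in>- insert i0 D. W k) * ?K * (\<Prod>i\<in>I. 1 * gauss P (y i - 0)) \<partial>?L)"
  proof (rule nn_integral_mono)
    fix y
    have "(of_nat (card (?A y)) :: ennreal) * (e y * ?K) \<le> of_nat (\<Prod>k\<in>- insert i0 D. W k) * (e y * ?K)"
      using card_messages_fixed[of W "insert i0 D" "(dec y)(i0 := 0)"] by (intro mult_right_mono) (auto simp del: of_nat_prod)
    also have "\<dots> = of_nat (\<Prod>k\<in>- insert i0 D. W k) * ?K * (\<Prod>i\<in>I. 1 * gauss P (y i - 0))"
      by (simp only: e_def mult_1 diff_zero ac_simps)
    finally show "(of_nat (card (?A y)) :: ennreal) * (e y * ?K) \<le> of_nat (\<Prod>k\<in>- insert i0 D. W k) * ?K * (\<Prod>i\<in>I. 1 * gauss P (y i - 0))" .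
  qed
  also have "\<dots> = of_nat (\<Prod>k\<in>- insert i0 D. W k) * ?K * (\<Prod>i\<in>I. 1 * ennreal (pi * P))"
  proof -
    have mm: "(\<lambda>y. \<Prod>i\<in>I. 1 * gauss P (y i - 0)) \<in> borel_measurable ?L"
      by (intro borel_measurable_prod_ennreal) measurable
    show ?thesis
      unfolding nn_integral_cmult[OF mm] using nn_integral_gauss_prod[OF I, of "\<lambda>_. P" "\<lambda>_. 1" "\<lambda>_. 0"] P by simp
  qed
  also have "\<dots> = of_nat (\<Prod>k\<in>- insert i0 D. W k) * ennreal (P ^ card I * (\<Prod>i\<in>I. s i))"
  proof -
    have "?K * (\<Prod>i\<in>I. 1 * ennreal (pi * P)) = (\<Prod>i\<in>I. ennreal (P * s i))"
      unfolding prod.distrib[symmetric]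
    proof (intro prod.cong refl)
      fix i assume "i \<in> I"
      with s P show "ennreal (1 / pi) * (ennreal (1 / pi) * ennreal (pi * s i)) * (1 * ennreal (pi * P)) = ennreal (P * s i)"
        by (simp add: ennreal_mult[symmetric] less_imp_le)
    qed
    also have "\<dots> = ennreal (\<Prod>i\<in>I. P * s i)" using s P by (intro prod_ennreal) (simp add: less_imp_le)
    finally show ?thesis by (simp add: mult.assoc prod.distrib)
  qed
  finally have fin: "(\<Sum>w\<in>?\<Omega>. \<integral>\<^sup>+ z. \<integral>\<^sup>+ z'. (p w (\<lambda>i\<in>I. m w i + z i) * p' w (\<lambda>i\<in>I. m' w i + z' i) *
      (e (\<lambda>i\<in>I. m w i + z i) * e (\<lambda>i\<in>I. m' w i + z' i))) \<partial>PiM I (\<lambda>_. std_complex_normal) \<partial>PiM I (\<lambda>_. std_complex_normal))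
    \<le> of_nat (\<Prod>k\<in>- insert i0 D. W k) * ennreal (P ^ card I * (\<Prod>i\<in>I. s i))" .
  then show ?thesis unfolding p_def p'_def e_def by (simp cong: prod.cong)
qed

section \<open>Transferring the signal of one receiver to another\<close>

lemma norm_matrix_vector_le:
  fixes A :: "complex ^ 'm ^ 'm"
  shows "norm (A *v v) \<le> (\<Sum>a\<in>UNIV. \<Sum>b\<in>UNIV. cmod (A $ a $ b)) * norm v"
proof -
  have "norm (A *v v) \<le> (\<Sum>a\<in>UNIV. cmod ((A *v v) $ a))"
    unfolding norm_vec_def by (rule L2_set_le_sum) auto
  also have "\<dots> \<le> (\<Sum>a\<in>UNIV. \<Sum>b\<in>UNIV. cmod (A $ a $ b) * norm v)"
  proof (rule sum_mono)
    fix a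
    show "cmod ((A *v v) $ a) \<le> (\<Sum>b\<in>UNIV. cmod (A $ a $ b) * norm v)"
      unfolding matrix_vector_mult_def vec_lambda_beta
      by (intro sum_norm_le) (auto simp: norm_mult intro!: mult_left_mono Finite_Cartesian_Product.norm_nth_le)
  qed
  finally show ?thesis by (simp add: sum_distrib_right)
qed

text \<open>The matrix is the channel into \<open>j'\<close> times the inverse of the channel into
  \<open>j\<close>, which exists almost surely. Its norm need not be bounded, so a set of
  probability \<epsilon> is given up; \<tau> depends on \<epsilon> but not on the power.\<close>

lemma slot_transfer:
  fixes \<mu> :: "complex measure" and S :: "'r::finite set" and i :: "'k::finite"
  assumes \<mu>: "channel_distribution \<mu>" and j: "j \<in> S" "j' \<in> S" and \<epsilon>: "0 < \<epsilon>"
  obtains \<tau> A where "0 < \<tau>" "A \<in> sets (PiM (csi_index S 1) (\<lambda>_. \<mu>))"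
    "emeasure (PiM (csi_index S 1) (\<lambda>_. \<mu>)) A \<le> ennreal \<epsilon>"
    "\<And>h. h \<in> space (PiM (csi_index S 1) (\<lambda>_. \<mu>)) \<Longrightarrow> h \<notin> A \<Longrightarrow>
       \<exists>B :: complex ^ 'm::finite ^ 'm. B ** channel_matrix h 0 j i = channel_matrix h 0 j' i \<and>
         (\<forall>v. norm (B *v v) \<le> \<tau> * norm v)"
proof -
  note \<mu>D = channel_distributionD[OF \<mu>]
  let ?I = "csi_index S 1 :: (nat \<times> 'r \<times> 'k \<times> 'm \<times> 'm) set"
  let ?M = "PiM ?I (\<lambda>_. \<mu>)"
  interpret prob_space ?M by (rule prob_space_PiM_const[OF \<mu>D(1)])
  have mem: "(0, j, i, a, b) \<in> ?I" "(0, j', i, a, b) \<in> ?I" for a b using j by (auto simp: csi_index_def)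
  define col where "col = (\<lambda>(b::'m) (a::'m) (h::('r, 'k, 'm) csi). h (0, j, i, a, b))"
  define h0 :: "('r, 'k, 'm) csi" where "h0 = restrict (\<lambda>(t, j, i, a, b). if a = b then 1 else 0) ?I"
  have col0: "col b a h0 = (if a = b then 1 else 0)" for a b using mem by (simp add: col_def h0_def)
  have ex: "\<forall>b. \<exists>g. (\<forall>r. sep_poly ?I (g r)) \<and> (\<forall>b'. b' \<noteq> b \<longrightarrow> (\<forall>h. (\<Sum>r\<in>UNIV. g r h * col b' r h) = 0)) \<and>
      (\<Sum>r\<in>UNIV. g r h0 * col b r h0) \<noteq> 0"
  proof
    fix b
    obtain g where "\<And>r. r \<in> UNIV \<Longrightarrow> sep_poly ?I (g r)"
      "\<And>c h. c \<in> UNIV - {b} \<Longrightarrow> (\<Sum>r\<in>UNIV. g r h * col c r h) = 0"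
      "(\<Sum>r\<in>UNIV. g r h0 * col b r h0) \<noteq> 0"
    proof (rule annihilating_row_insert[of "UNIV - {b}" UNIV b ?I col h0])
      show "sep_poly ?I (col c r)" for c r unfolding col_def using mem by (intro sep_poly_coord)
      fix l assume "\<And>r. r \<in> UNIV \<Longrightarrow> (\<Sum>c\<in>insert b (UNIV - {b}). l c * col c r h0) = 0"
      then have "(\<Sum>c\<in>UNIV. l c * (if r = c then 1 else 0)) = 0" for r by (simp add: col0 insert_absorb)
      then have "l r = 0" for r by (simp add: if_distrib cong: if_cong)
      then show "\<forall>c\<in>insert b (UNIV - {b}). l c = 0" by simp
    qed auto
    then show "\<exists>g. (\<forall>r. sep_poly ?I (g r)) \<and> (\<forall>b'. b' \<noteq> b \<longrightarrow> (\<forall>h. (\<Sum>r\<in>UNIV. g r h * col b' r h) = 0)) \<and>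
      (\<Sum>r\<in>UNIV. g r h0 * col b r h0) \<noteq> 0" by blast
  qed
  from choice[OF ex] obtain g where g': "\<forall>b. (\<forall>r. sep_poly ?I (g b r)) \<and> (\<forall>b'. b' \<noteq> b \<longrightarrow> (\<forall>h. (\<Sum>r\<in>UNIV. g b r h * col b' r h) = 0)) \<and>
      (\<Sum>r\<in>UNIV. g b r h0 * col b r h0) \<noteq> 0" ..
  have g: "\<And>b r. sep_poly ?I (g b r)" "\<And>b b' h. b' \<noteq> b \<Longrightarrow> (\<Sum>r\<in>UNIV. g b r h * col b' r h) = 0"
    "\<And>b. (\<Sum>r\<in>UNIV. g b r h0 * col b r h0) \<noteq> 0"
    using g' by auto
  define d where "d b h = (\<Sum>r\<in>UNIV. g b r h * col b r h)" for b h
  have spd: "sep_poly ?I (d b)" for b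
    unfolding d_def[abs_def] col_def using g(1) mem by (intro sep_poly_sum sep_poly_mult sep_poly_coord)
  have meas: "f \<in> borel_measurable ?M" if "sep_poly ?I f" for f
    using sep_poly_measurable[OF that] by (simp add: \<mu>D(2) cong: measurable_cong_sets sets_PiM_cong)
  have h0r: "restrict h0 ?I = h0" by (auto simp: h0_def restrict_def fun_eq_iff)
  have AEd: "AE h in ?M. d b h \<noteq> 0" for b
    by (rule AE_sep_poly_nonzero[OF finite_index(1) \<mu>D spd, where ?h0.0 = h0]) (unfold h0r d_def, rule g(3))
  \<comment> \<open>\<open>g b r / d b h\<close> is entry \<open>(b, r)\<close> of the inverse: the
    row \<open>g b\<close> annihilates every column of the channel except \<open>b\<close>, on which
    its value is \<open>d b h\<close>.\<close>
  define Bm where "Bm h = (\<chi> a r. \<Sum>b\<in>UNIV. h (0, j', i, a, b) * (g b r h / d b h))" for h :: "('r, 'k, 'm) csi"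
  define \<Gamma> where "\<Gamma> h = (\<Sum>a\<in>UNIV. \<Sum>r\<in>UNIV. cmod (Bm h $ a $ r))" for h
  have \<Gamma>m: "\<Gamma> \<in> borel_measurable ?M"
    unfolding \<Gamma>_def[abs_def] Bm_def vec_lambda_beta
    by (intro borel_measurable_sum measurable_compose[OF _ borel_measurable_norm] borel_measurable_times
        borel_measurable_divide meas g(1) spd sep_poly_coord mem)
  obtain G where G: "0 < G" "emeasure ?M {h \<in> space ?M. G < \<Gamma> h} \<le> ennreal \<epsilon>"
    using exists_tail_bound[OF \<Gamma>m \<epsilon>] .
  let ?A = "{h \<in> space ?M. G < \<Gamma> h} \<union> (\<Union>b\<in>UNIV. {h \<in> space ?M. d b h = 0})"
  have sA: "{h \<in> space ?M. G < \<Gamma> h} \<in> sets ?M" "{h \<in> space ?M. d b h = 0} \<in> sets ?M" for b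
    using \<Gamma>m meas[OF spd[of b]] by measurable
  have A: "?A \<in> sets ?M" using sA by (intro sets.Un sets.finite_UN) auto
  have "AE h in ?M. \<forall>b\<in>UNIV. d b h \<noteq> 0" by (intro AE_finite_allI finite AEd)
  then have "emeasure ?M ?A = emeasure ?M {h \<in> space ?M. G < \<Gamma> h}"
    using A sA by (intro emeasure_eq_AE) auto
  then have eA: "emeasure ?M ?A \<le> ennreal \<epsilon>" using G(2) by simp
  show ?thesis
  proof (rule that[OF G(1) A eA])
    fix h assume h: "h \<in> space ?M" "h \<notin> ?A"
    then have nz: "d b h \<noteq> 0" and le: "\<Gamma> h \<le> G" for b by (auto simp: not_less)
    have "(Bm h ** channel_matrix h 0 j i) $ a $ c = channel_matrix h 0 j' i $ a $ c" for a c
    proof -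
      have "(Bm h ** channel_matrix h 0 j i) $ a $ c = (\<Sum>r\<in>UNIV. \<Sum>b\<in>UNIV. h (0, j', i, a, b) / d b h * (g b r h * col c r h))"
        by (simp add: matrix_matrix_mult_def Bm_def channel_matrix_def col_def sum_distrib_right mult.assoc)
      also have "\<dots> = (\<Sum>b\<in>UNIV. h (0, j', i, a, b) / d b h * (\<Sum>r\<in>UNIV. g b r h * col c r h))"
        by (subst sum.swap) (simp add: sum_distrib_left)
      also have "\<dots> = (\<Sum>b\<in>UNIV. if b = c then h (0, j', i, a, c) else 0)"
      proof (intro sum.cong refl)
        fix b
        show "h (0, j', i, a, b) / d b h * (\<Sum>r\<in>UNIV. g b r h * col c r h) = (if b = c then h (0, j', i, a, c) else 0)"
          using g(2)[of c b h] nz[of b] by (cases "b = c") (auto simp: d_def)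
      qed
      also have "\<dots> = h (0, j', i, a, c)" by simp
      finally show ?thesis by (simp add: channel_matrix_def)
    qed
    moreover have "norm (Bm h *v v) \<le> G * norm v" for v
      using norm_matrix_vector_le[of "Bm h" v] le unfolding \<Gamma>_def by (meson mult_right_mono norm_ge_zero order_trans)
    ultimately show "\<exists>B :: complex ^ 'm ^ 'm. B ** channel_matrix h 0 j i = channel_matrix h 0 j' i \<and> (\<forall>v. norm (B *v v) \<le> G * norm v)"
      by (intro exI[of _ "Bm h"]) (simp add: vec_eq_iff)
  qed
qed

lemma prod_gauss: "(\<Prod>a\<in>UNIV. gauss s (v $ a)) = ennreal (exp (- (norm (v :: complex ^ 'm))\<^sup>2 / s))"
proof -
  have "(norm v)\<^sup>2 = (\<Sum>a\<in>UNIV. (cmod (v $ a))\<^sup>2)"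
    unfolding norm_vec_def L2_set_def by (simp add: sum_nonneg)
  then have "exp (- (norm v)\<^sup>2 / s) = (\<Prod>a\<in>UNIV. exp (- (cmod (v $ a))\<^sup>2 / s))"
    by (simp add: exp_sum[symmetric] sum_negf[symmetric] sum_divide_distrib)
  then show ?thesis by (simp add: gauss_def prod_ennreal)
qed

text \<open>
  After subtracting the known signals, the two observations are \<open>H x\<close> and \<open>B H x\<close> plus unit
  noise, so \<open>q - B p\<close> is pure noise, of variance at most \<open>1 + \<tau>\<^sup>2\<close>.
\<close>

lemma gauss_transfer:
  fixes B :: "complex ^ 'm ^ 'm"
  assumes "\<And>v. norm (B *v v) \<le> \<tau> * norm v" "0 < \<tau>"
  shows "(\<Prod>a\<in>UNIV. gauss 1 (p $ a)) * (\<Prod>a\<in>UNIV. gauss 1 (q $ a)) \<le> (\<Prod>a\<in>UNIV. gauss (1 + \<tau>\<^sup>2) ((q - B *v p) $ a))"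
proof -
  have t: "0 < 1 + \<tau>\<^sup>2" using zero_le_power2[of \<tau>] by linarith
  have "norm (q - B *v p) \<le> norm q + \<tau> * norm p"
    using norm_triangle_ineq4[of q "B *v p"] assms(1)[of p] by linarith
  then have "(norm (q - B *v p))\<^sup>2 \<le> (norm q + \<tau> * norm p)\<^sup>2" by (intro power_mono) auto
  also have "\<dots> \<le> (1 + \<tau>\<^sup>2) * ((norm p)\<^sup>2 + (norm q)\<^sup>2)"
  proof -
    \<comment> \<open>This square is the difference of the two sides, as in the Cauchy--Schwarz
      inequality.\<close>
    have "0 \<le> (\<tau> * norm q - norm p)\<^sup>2" by simp
    then show ?thesis by (simp add: power2_eq_square algebra_simps)
  qed
  finally have "(norm (q - B *v p))\<^sup>2 / (1 + \<tau>\<^sup>2) \<le> (norm p)\<^sup>2 + (norm q)\<^sup>2"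
    using t by (simp add: pos_divide_le_eq mult.commute)
  then have "exp (- (norm p)\<^sup>2 / 1) * exp (- (norm q)\<^sup>2 / 1) \<le> exp (- (norm (q - B *v p))\<^sup>2 / (1 + \<tau>\<^sup>2))"
    by (simp add: exp_add[symmetric])
  then show ?thesis unfolding prod_gauss by (simp add: ennreal_mult[symmetric])
qed

section \<open>Measurability of the channel outputs\<close>

definition outputs :: "('r::finite, 'k::finite, 'm::finite) encoders \<Rightarrow> ('k \<Rightarrow> nat) \<Rightarrow> ('r, 'k, 'm) csi \<Rightarrow>
    ('r, 'm) noise \<Rightarrow> 'r \<Rightarrow> nat \<Rightarrow> complex ^ 'm" where
  "outputs enc w h z j t = received (\<lambda>k. enc k (w k) h) h z j t"

lemma outputs_nth: "outputs enc w h z j t $ a =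
    (\<Sum>k\<in>UNIV. \<Sum>b\<in>UNIV. h (t, j, k, a, b) * (enc k (w k) h t $ b)) + z (t, j, a)"
  by (simp add: outputs_def received_nth)

lemma sets_message_law: "sets (message_law W) = UNIV"
  by (simp add: message_law_def)

lemma measurable_message: "(\<lambda>w. w k) \<in> measurable (message_law W) (count_space UNIV)"
  by (simp add: message_law_def)

abbreviation code_space :: "complex measure \<Rightarrow> 'r::finite set \<Rightarrow> nat \<Rightarrow> ('k::finite \<Rightarrow> nat) \<Rightarrow>
    (('k \<Rightarrow> nat) \<times> ('r, 'k, 'm::finite) csi \<times> ('r, 'm) noise) measure" where
  "code_space \<mu> S n W \<equiv> message_law W \<Otimes>\<^sub>M (channel_law \<mu> S n \<Otimes>\<^sub>M noise_law S n)"

text \<open>Validity gives measurability of an encoder for each fixed message value; as there are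
  countably many values, the random message can be inserted.\<close>

lemma measurable_outputs:
  fixes enc :: "('r::finite, 'k::finite, 'm::finite) encoders"
  assumes \<mu>: "sets \<mu> = sets borel" and enc: "valid_encoders \<mu> S P n W enc" and j: "j \<in> S" and t: "t < n"
  shows "(\<lambda>x. outputs enc (fst x) (fst (snd x)) (snd (snd x)) j t) \<in> borel_measurable (code_space \<mu> S n W)"
proof (rule borel_measurable_vecI)
  fix a
  let ?\<Omega> = "code_space \<mu> S n W :: (('k \<Rightarrow> nat) \<times> ('r, 'k, 'm) csi \<times> ('r, 'm) noise) measure"
  have e: "(\<lambda>x. enc k (fst x k) (fst (snd x)) t) \<in> borel_measurable ?\<Omega>" for k
  proof (rule measurable_compose_countable[where f = "\<lambda>v x. enc k v (fst (snd x)) t" and g = "\<lambda>x. fst x k"])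
    show "(\<lambda>x. enc k v (fst (snd x)) t) \<in> borel_measurable ?\<Omega>" for v
      using enc t unfolding valid_encoders_def
      by (intro measurable_compose[OF measurable_compose[OF measurable_snd measurable_fst]]) blast
    show "(\<lambda>x. fst x k) \<in> measurable ?\<Omega> (count_space UNIV)"
      by (rule measurable_compose[OF measurable_fst measurable_message])
  qed
  have sb: "f \<in> measurable M \<mu> \<Longrightarrow> f \<in> borel_measurable M" for f and M :: "'x measure"
    by (simp add: \<mu> cong: measurable_cong_sets)
  have h: "(\<lambda>x. fst (snd x) (t, j, k, a, b)) \<in> borel_measurable ?\<Omega>" for k b
    by (rule sb, rule measurable_compose[OF measurable_compose[OF measurable_snd measurable_fst]])
       (use j t in \<open>auto simp: channel_law_alt csi_index_def intro!: measurable_component_singleton\<close>)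
  have z: "(\<lambda>x. snd (snd x) (t, j, a)) \<in> borel_measurable ?\<Omega>"
  proof -
    have "(\<lambda>x. snd (snd x) (t, j, a)) \<in> measurable ?\<Omega> std_complex_normal"
      by (rule measurable_compose[OF measurable_compose[OF measurable_snd measurable_snd]])
       (use j t in \<open>auto simp: noise_law_alt noise_index_def intro!: measurable_component_singleton\<close>)
    then show ?thesis by (simp cong: measurable_cong_sets)
  qed
  show "(\<lambda>x. outputs enc (fst x) (fst (snd x)) (snd (snd x)) j t $ a) \<in> borel_measurable ?\<Omega>"
    unfolding outputs_nth
    by (intro borel_measurable_add borel_measurable_sum borel_measurable_times h z borel_measurable_vec_nth' e)
qed

lemma measurable_correct:
  fixes enc :: "('r::finite, 'k::finite, 'm::finite) encoders" and dec :: "('r, 'k, 'm) decoders"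
  assumes \<mu>: "sets \<mu> = sets borel" and enc: "valid_encoders \<mu> S P n W enc" and dec: "valid_decoders \<mu> S n dec"
  shows "{x \<in> space (code_space \<mu> S n W). \<forall>j\<in>S. \<forall>k\<in>demand j.
      dec j (fst (snd x)) (\<lambda>t\<in>{..<n}. outputs enc (fst x) (fst (snd x)) (snd (snd x)) j t) k = fst x k}
    \<in> sets (code_space \<mu> S n W)"
proof -
  let ?\<Omega> = "code_space \<mu> S n W :: (('k \<Rightarrow> nat) \<times> ('r, 'k, 'm) csi \<times> ('r, 'm) noise) measure"
  have "{x \<in> space ?\<Omega>. dec j (fst (snd x)) (\<lambda>t\<in>{..<n}. outputs enc (fst x) (fst (snd x)) (snd (snd x)) j t) k = fst x k} \<in> sets ?\<Omega>"
    if j: "j \<in> S" for j k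
  proof -
    have y: "(\<lambda>x. \<lambda>t\<in>{..<n}. outputs enc (fst x) (fst (snd x)) (snd (snd x)) j t) \<in> measurable ?\<Omega> (PiM {..<n} (\<lambda>_. borel))"
      by (intro measurable_restrict measurable_outputs[OF \<mu> enc j]) simp
    have p1: "(\<lambda>x. (fst (snd x), \<lambda>t\<in>{..<n}. outputs enc (fst x) (fst (snd x)) (snd (snd x)) j t))
        \<in> measurable ?\<Omega> (channel_law \<mu> S n \<Otimes>\<^sub>M PiM {..<n} (\<lambda>_. borel))"
      by (intro measurable_Pair y measurable_compose[OF measurable_snd measurable_fst])
    have p2: "(\<lambda>(h, y). dec j h y k) \<in> measurable (channel_law \<mu> S n \<Otimes>\<^sub>M PiM {..<n} (\<lambda>_. borel)) (count_space UNIV)"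
      using dec j by (simp add: valid_decoders_def)
    from measurable_compose[OF p1 p2] have q1: "(\<lambda>x. dec j (fst (snd x)) (\<lambda>t\<in>{..<n}. outputs enc (fst x) (fst (snd x)) (snd (snd x)) j t) k) \<in> measurable ?\<Omega> (count_space UNIV)"
      by (simp only: case_prod_conv)
    have q2: "(\<lambda>x. fst x k) \<in> measurable ?\<Omega> (count_space UNIV)"
      by (rule measurable_compose[OF measurable_fst measurable_message])
    have "{x \<in> space ?\<Omega>. dec j (fst (snd x)) (\<lambda>t\<in>{..<n}. outputs enc (fst x) (fst (snd x)) (snd (snd x)) j t) k = fst x k} =
      (\<Union>c. {x \<in> space ?\<Omega>. dec j (fst (snd x)) (\<lambda>t\<in>{..<n}. outputs enc (fst x) (fst (snd x)) (snd (snd x)) j t) k = c} \<inter> {x \<in> space ?\<Omega>. fst x k = c})"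
      by auto
    also have "\<dots> \<in> sets ?\<Omega>"
      by (intro sets.countable_UN'' sets.Int measurable_pred_of_count_space[OF q1] measurable_pred_of_count_space[OF q2]) auto
    finally show ?thesis .
  qed
  then show ?thesis by (intro sets.sets_Collect_finite_All finite)
qed

definition signal :: "('r::finite, 'k::finite, 'm::finite) encoders \<Rightarrow> ('r, 'k, 'm) csi \<Rightarrow> 'r \<Rightarrow> ('k \<Rightarrow> nat) \<Rightarrow> nat \<Rightarrow> complex ^ 'm" where
  "signal enc h j w t = (\<Sum>k\<in>UNIV. channel_matrix h t j k *v enc k (w k) h t)"

lemma outputs_signal: "outputs enc w h z j t = signal enc h j w t + (\<chi> a. z (t, j, a))"
  by (simp add: outputs_def received_def signal_def)

text \<open>A change of message \<open>i\<close> moves the signals of all receivers by their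
  channels applied to one common vector. This lets a single matrix carry the ambiguity at one
  receiver over to another.\<close>

lemma signal_upd:
  "signal enc h j w t = signal enc h j (w(i := v)) t + channel_matrix h t j i *v (enc i (w i) h t - enc i v h t)"
proof -
  have "(\<Sum>k\<in>UNIV - {i}. channel_matrix h t j k *v enc k ((w(i := v)) k) h t) =
    (\<Sum>k\<in>UNIV - {i}. channel_matrix h t j k *v enc k (w k) h t)"
    by (intro sum.cong) auto
  then show ?thesis
    by (simp add: signal_def sum.remove[of UNIV i] matrix_vector_mult_diff_distrib del: sum.remove)
qed

text \<open>With a variance of the order of the received energy, the weight makes the volume of
  possible outputs finite without a sharp cutoff.\<close>

definition weight :: "real \<Rightarrow> nat \<Rightarrow> (nat \<Rightarrow> complex ^ 'm) \<Rightarrow> ennreal" where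
  "weight P n y = (\<Prod>t<n. \<Prod>a\<in>UNIV. gauss P (y t $ a))"

lemma weight_exp: "weight P n y = ennreal (exp (- (\<Sum>t<n. (norm (y t))\<^sup>2) / P))"
  unfolding weight_def prod_gauss
  by (simp add: prod_ennreal exp_sum[symmetric] sum_negf sum_divide_distrib)

definition slots :: "nat \<Rightarrow> (nat \<times> 'm::finite \<Rightarrow> complex) \<Rightarrow> nat \<Rightarrow> complex ^ 'm" where
  "slots n y = (\<lambda>t\<in>{..<n}. \<chi> a. y (t, a))"

lemma measurable_slots: "slots n \<in> measurable (PiM ({..<n} \<times> UNIV) (\<lambda>_. borel)) (PiM {..<n} (\<lambda>_. borel))"
  unfolding slots_def[abs_def]
  by (intro measurable_restrict borel_measurable_vecI, unfold vec_lambda_beta, rule measurable_component_singleton) auto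

lemma measurable_dec_slots:
  assumes "valid_decoders \<mu> S n dec" "j \<in> S" "h \<in> space (channel_law \<mu> S n)"
  shows "(\<lambda>y. dec j h (slots n y) k) \<in> measurable (PiM ({..<n} \<times> UNIV) (\<lambda>_. borel)) (count_space UNIV)"
proof -
  have "(\<lambda>(h, y). dec j h y k) \<in> measurable (channel_law \<mu> S n \<Otimes>\<^sub>M PiM {..<n} (\<lambda>_. borel)) (count_space UNIV)"
    using assms by (simp add: valid_decoders_def)
  from measurable_Pair2[OF this assms(3)]
  have "(\<lambda>y. dec j h y k) \<in> measurable (PiM {..<n} (\<lambda>_. borel)) (count_space UNIV)" by simp
  from measurable_compose[OF measurable_slots this] show ?thesis .
qed

lemma fixed_channel_one:
  fixes enc :: "('r::finite, 'k::finite, 'm::finite) encoders" and dec :: "('r, 'k, 'm) decoders"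
  assumes h: "h \<in> space (channel_law \<mu> S n)" and dec: "valid_decoders \<mu> S n dec" and j: "j \<in> S" and P: "0 < P"
  shows "(\<Sum>w | \<forall>k. w k < W k. \<integral>\<^sup>+ z. (indicator {z. \<forall>k\<in>demand j. dec j h (\<lambda>t\<in>{..<n}. outputs enc w h z j t) k = w k} z *
      weight P n (outputs enc w h z j)) \<partial>noise_law S n)
    \<le> of_nat (\<Prod>k\<in>- demand j. W k) * ennreal (P ^ (n * CARD('m)))"
proof -
  let ?I = "{..<n} \<times> (UNIV :: 'm set)"
  let ?N = "PiM ?I (\<lambda>_. std_complex_normal)"
  define m where "m w i = signal enc h j w (fst i) $ snd i" for w and i :: "nat \<times> 'm"
  define G where "G w x = indicator {y. \<forall>k\<in>demand j. dec j h (slots n y) k = w k} (\<lambda>i\<in>?I. m w i + x i) *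
      (\<Prod>i\<in>?I. gauss P (m w i + x i))" for w x
  have sl: "slots n (\<lambda>i\<in>?I. m w i + z (fst i, j, snd i)) = (\<lambda>t\<in>{..<n}. outputs enc w h z j t)" for w z
    by (auto simp: slots_def fun_eq_iff outputs_signal m_def vec_eq_iff)
  have eq: "indicator {z. \<forall>k\<in>demand j. dec j h (\<lambda>t\<in>{..<n}. outputs enc w h z j t) k = w k} z * weight P n (outputs enc w h z j)
    = G w (\<lambda>i\<in>?I. z (fst i, j, snd i))" for w z
  proof -
    have "(\<Prod>i\<in>?I. gauss P (m w i + (\<lambda>i\<in>?I. z (fst i, j, snd i)) i)) = weight P n (outputs enc w h z j)"
      unfolding weight_def prod.cartesian_product' by (intro prod.cong refl) (auto simp: m_def outputs_signal)
    moreover have "(\<lambda>i\<in>?I. m w i + (\<lambda>i\<in>?I. z (fst i, j, snd i)) i) = (\<lambda>i\<in>?I. m w i + z (fst i, j, snd i))"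
      by (auto simp: fun_eq_iff)
    ultimately show ?thesis by (simp add: G_def sl indicator_def)
  qed
  have dm: "(\<lambda>y. dec j h (slots n y) k) \<in> measurable (PiM ?I (\<lambda>_. borel)) (count_space UNIV)" for k
    by (rule measurable_dec_slots[OF dec j h])
  have set: "{y \<in> space (PiM ?I (\<lambda>_. borel)). \<forall>k\<in>demand j. dec j h (slots n y) k = w k} \<in> sets (PiM ?I (\<lambda>_. borel))" for w
    by (intro sets.sets_Collect_finite_All measurable_pred_of_count_space[OF dm] finite)
  have ind: "(indicator {y. \<forall>k\<in>demand j. dec j h (slots n y) k = w k} :: _ \<Rightarrow> ennreal) \<in> borel_measurable (PiM ?I (\<lambda>_. borel))" for w
    using set[of w] by (subst borel_measurable_indicator_iff) (simp add: Int_def conj_commute)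
  have sh: "(\<lambda>x. \<lambda>i\<in>?I. m w i + x i) \<in> measurable ?N (PiM ?I (\<lambda>_. borel))" for w
    by (intro measurable_restrict) measurable
  have Gm: "G w \<in> borel_measurable ?N" for w
    unfolding G_def[abs_def]
    by (intro borel_measurable_times_ennreal measurable_compose[OF sh ind] borel_measurable_prod_ennreal) measurable
  have "(\<Sum>w | \<forall>k. w k < W k. \<integral>\<^sup>+ z. (indicator {z. \<forall>k\<in>demand j. dec j h (\<lambda>t\<in>{..<n}. outputs enc w h z j t) k = w k} z *
      weight P n (outputs enc w h z j)) \<partial>noise_law S n) = (\<Sum>w | \<forall>k. w k < W k. \<integral>\<^sup>+ x. G w x \<partial>?N)"
    unfolding eq noise_law_alt
    by (intro sum.cong refl nn_integral_reindex[OF prob_space_std_complex_normal _ _ Gm])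
       (use j in \<open>auto simp: inj_on_def noise_index_def\<close>)
  also have "\<dots> \<le> of_nat (\<Prod>k\<in>- demand j. W k) * ennreal (P ^ card ?I)"
    unfolding G_def by (rule one_receiver_bound) (use P dm in auto)
  finally show ?thesis by (simp add: card_cartesian_product)
qed

text \<open>In a slot of \<open>Gd\<close> the second observation is predicted from the first up to
  variance \<open>1 + \<tau>\<^sup>2\<close>. In the remaining slots no prediction is made and only
  the weight confines the second observation, at the price of a factor \<open>P\<close> per
  antenna.\<close>

lemma fixed_channel_two:
  fixes enc :: "('r::finite, 'k::finite, 'm::finite) encoders" and dec :: "('r, 'k, 'm) decoders"
  assumes h: "h \<in> space (channel_law \<mu> S n)" and dec: "valid_decoders \<mu> S n dec" and j: "j \<in> S" "j' \<in> S" "j \<noteq> j'"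
    and i: "i \<notin> demand j" and P: "0 < P" and \<tau>: "0 < \<tau>"
    and good: "\<And>t. t \<in> Gd \<Longrightarrow> t < n \<Longrightarrow> \<exists>B :: complex ^ 'm ^ 'm. B ** channel_matrix h t j i = channel_matrix h t j' i \<and>
         (\<forall>v. norm (B *v v) \<le> \<tau> * norm v)"
  shows "(\<Sum>w | \<forall>k. w k < W k. \<integral>\<^sup>+ z. (indicator {z. (\<forall>k\<in>demand j. dec j h (\<lambda>t\<in>{..<n}. outputs enc w h z j t) k = w k) \<and>
        dec j' h (\<lambda>t\<in>{..<n}. outputs enc w h z j' t) i = w i} z *
      (weight P n (outputs enc w h z j) * weight P n (outputs enc w h z j'))) \<partial>noise_law S n)
    \<le> of_nat (\<Prod>k\<in>- insert i (demand j). W k) * ennreal (P ^ (n * CARD('m)) * (\<Prod>t<n. (if t \<in> Gd then 1 + \<tau>\<^sup>2 else P) ^ CARD('m)))"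
proof -
  let ?I = "{..<n} \<times> (UNIV :: 'm set)"
  let ?N = "PiM ?I (\<lambda>_. std_complex_normal)"
  let ?B = "PiM ?I (\<lambda>_. borel :: complex measure)"
  define m where "m j w i = signal enc h j w (fst i) $ snd i" for j w and i :: "nat \<times> 'm"
  define p where "p w y = (indicator {y. \<forall>k\<in>demand j. dec j h (slots n y) k = w k} y :: ennreal)" for w y
  define p' where "p' w y = (indicator {y. dec j' h (slots n y) i = w i} y :: ennreal)" for w y
  define G where "G w x x' = p w (\<lambda>i\<in>?I. m j w i + x i) * p' w (\<lambda>i\<in>?I. m j' w i + x' i) *
      ((\<Prod>i\<in>?I. gauss P (m j w i + x i)) * (\<Prod>i\<in>?I. gauss P (m j' w i + x' i)))" for w x x'
  have sl: "slots n (\<lambda>i\<in>?I. m j w i + z (fst i, j, snd i)) = (\<lambda>t\<in>{..<n}. outputs enc w h z j t)" for j w z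
    by (auto simp: slots_def fun_eq_iff outputs_signal m_def vec_eq_iff)
  have eq: "indicator {z. (\<forall>k\<in>demand j. dec j h (\<lambda>t\<in>{..<n}. outputs enc w h z j t) k = w k) \<and>
        dec j' h (\<lambda>t\<in>{..<n}. outputs enc w h z j' t) i = w i} z * (weight P n (outputs enc w h z j) * weight P n (outputs enc w h z j'))
    = G w (\<lambda>i\<in>?I. z (fst i, j, snd i)) (\<lambda>i\<in>?I. z (fst i, j', snd i))" for w z
  proof -
    have "(\<Prod>i\<in>?I. gauss P (m j w i + (\<lambda>i\<in>?I. z (fst i, j, snd i)) i)) = weight P n (outputs enc w h z j)" for j
      unfolding weight_def prod.cartesian_product' by (intro prod.cong refl) (auto simp: m_def outputs_signal)
    moreover have "(\<lambda>i\<in>?I. m j w i + (\<lambda>i\<in>?I. z (fst i, j, snd i)) i) = (\<lambda>i\<in>?I. m j w i + z (fst i, j, snd i))" for j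
      by (auto simp: fun_eq_iff)
    ultimately show ?thesis by (simp add: G_def p_def p'_def sl indicator_def)
  qed
  have dm: "(\<lambda>y. dec j h (slots n y) k) \<in> measurable ?B (count_space UNIV)" if "j \<in> S" for j k
    by (rule measurable_dec_slots[OF dec that h])
  have pm: "p w \<in> borel_measurable ?B" for w
  proof -
    have "{y \<in> space ?B. \<forall>k\<in>demand j. dec j h (slots n y) k = w k} \<in> sets ?B"
      by (intro sets.sets_Collect_finite_All measurable_pred_of_count_space[OF dm[OF j(1)]] finite)
    then show ?thesis unfolding p_def[abs_def] by (subst borel_measurable_indicator_iff) (simp add: Int_def conj_commute)
  qed
  have pm': "p' w \<in> borel_measurable ?B" for w
    using measurable_pred_of_count_space[OF dm[OF j(2)]] unfolding p'_def[abs_def]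
    by (subst borel_measurable_indicator_iff) (simp add: Int_def conj_commute)
  have sh: "(\<lambda>x. \<lambda>i\<in>?I. m j w i + x i) \<in> measurable ?N ?B" for j w
    by (intro measurable_restrict) measurable
  have Gm: "(\<lambda>(x, x'). G w x x') \<in> borel_measurable (?N \<Otimes>\<^sub>M ?N)" for w
    unfolding G_def split_beta'
    by (intro borel_measurable_times_ennreal measurable_compose[OF measurable_compose[OF measurable_fst sh] pm]
      measurable_compose[OF measurable_compose[OF measurable_snd sh] pm'] borel_measurable_prod_ennreal) measurable
  have blocks: "(\<integral>\<^sup>+ z. G w (\<lambda>i\<in>?I. z (fst i, j, snd i)) (\<lambda>i\<in>?I. z (fst i, j', snd i)) \<partial>noise_law S n) =
      (\<integral>\<^sup>+ x. \<integral>\<^sup>+ x'. G w x x' \<partial>?N \<partial>?N)" for w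
    unfolding noise_law_alt
    by (rule nn_integral_two_blocks[OF prob_space_std_complex_normal, of _ "\<lambda>i. (fst i, j, snd i)" ?I "\<lambda>i. (fst i, j', snd i)"])
       (use j Gm in \<open>auto simp: inj_on_def noise_index_def\<close>)
  have "\<forall>t. \<exists>B :: complex ^ 'm ^ 'm. t \<in> Gd \<longrightarrow> t < n \<longrightarrow> B ** channel_matrix h t j i = channel_matrix h t j' i \<and> (\<forall>v. norm (B *v v) \<le> \<tau> * norm v)"
    using good by blast
  from choice[OF this] obtain Bt :: "nat \<Rightarrow> complex ^ 'm ^ 'm" where Bt:
    "\<forall>t. t \<in> Gd \<longrightarrow> t < n \<longrightarrow> Bt t ** channel_matrix h t j i = channel_matrix h t j' i \<and> (\<forall>v. norm (Bt t *v v) \<le> \<tau> * norm v)" ..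
  define s where "s t = (if t \<in> Gd then 1 + \<tau>\<^sup>2 else P)" for t
  have s0: "0 < s t" for t using P zero_le_power2[of \<tau>] unfolding s_def by (auto intro: add_pos_nonneg)
  \<comment> \<open>The prediction of the second observation from the first. It is evaluated with
    message \<open>i\<close> set to 0, which may stand for the true value because the residual is
    the same for both; outside \<open>Gd\<close> the prediction is 0.\<close>
  define V where "V w y ia = (if fst ia \<in> Gd then (signal enc h j' w (fst ia) +
      Bt (fst ia) *v ((\<chi> a. y (fst ia, a)) - signal enc h j w (fst ia))) $ snd ia else 0)" for w y and ia :: "nat \<times> 'm"
  have le1: "(\<Prod>a\<in>UNIV. gauss s (v $ a)) \<le> 1" if "0 < s" for s and v :: "complex ^ 'm"
    unfolding prod_gauss using that by (simp add: ennreal_le_1)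
  have Vb: "(\<Prod>i\<in>?I. gauss 1 (y i - m j w i)) * (\<Prod>i\<in>?I. gauss 1 (y' i - m j' w i)) * (\<Prod>i\<in>?I. gauss P (y' i))
        \<le> (\<Prod>ia\<in>?I. gauss (s (fst ia)) (y' ia - V (w(i := 0)) y ia))" for w y y'
  proof -
    define yv where "yv t = (\<chi> a. y (t, a))" for t
    define yv' where "yv' t = (\<chi> a. y' (t, a))" for t
    have "(\<Prod>i\<in>?I. gauss 1 (y i - m j w i)) * (\<Prod>i\<in>?I. gauss 1 (y' i - m j' w i)) * (\<Prod>i\<in>?I. gauss P (y' i))
      = (\<Prod>t<n. (\<Prod>a\<in>UNIV. gauss 1 ((yv t - signal enc h j w t) $ a)) * (\<Prod>a\<in>UNIV. gauss 1 ((yv' t - signal enc h j' w t) $ a)) * (\<Prod>a\<in>UNIV. gauss P (yv' t $ a)))"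
      unfolding prod.cartesian_product' prod.distrib by (simp add: m_def yv_def yv'_def)
    also have "\<dots> \<le> (\<Prod>t<n. \<Prod>a\<in>UNIV. gauss (s t) (y' (t, a) - V (w(i := 0)) y (t, a)))"
    proof (rule prod_mono_ennreal)
      fix t assume t: "t \<in> {..<n}"
      show "(\<Prod>a\<in>UNIV. gauss 1 ((yv t - signal enc h j w t) $ a)) * (\<Prod>a\<in>UNIV. gauss 1 ((yv' t - signal enc h j' w t) $ a)) * (\<Prod>a\<in>UNIV. gauss P (yv' t $ a))
        \<le> (\<Prod>a\<in>UNIV. gauss (s t) (y' (t, a) - V (w(i := 0)) y (t, a)))"
      proof (cases "t \<in> Gd")
        case True
        with Bt t have B: "Bt t ** channel_matrix h t j i = channel_matrix h t j' i" "\<And>v. norm (Bt t *v v) \<le> \<tau> * norm v" by auto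
        define \<delta> where "\<delta> = enc i (w i) h t - enc i 0 h t"
        \<comment> \<open>The vector \<delta> enters the second signal through
          \<open>channel_matrix h t j' i\<close> and the prediction through
          \<open>Bt t ** channel_matrix h t j i\<close>; these agree, so it cancels.\<close>
        have e: "yv' t - signal enc h j' w t - Bt t *v (yv t - signal enc h j w t) =
          yv' t - (signal enc h j' (w(i := 0)) t + Bt t *v (yv t - signal enc h j (w(i := 0)) t))"
          unfolding signal_upd[of enc h j w t i 0] signal_upd[of enc h j' w t i 0] \<delta>_def[symmetric]
          by (simp add: matrix_vector_mult_diff_distrib matrix_vector_right_distrib matrix_vector_mul_assoc B(1))
        have eqV: "(yv' t - signal enc h j' w t - Bt t *v (yv t - signal enc h j w t)) $ a = y' (t, a) - V (w(i := 0)) y (t, a)" for a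
          unfolding e using True by (simp add: V_def yv_def yv'_def)
        have "(\<Prod>a\<in>UNIV. gauss 1 ((yv t - signal enc h j w t) $ a)) * (\<Prod>a\<in>UNIV. gauss 1 ((yv' t - signal enc h j' w t) $ a)) * (\<Prod>a\<in>UNIV. gauss P (yv' t $ a))
          \<le> (\<Prod>a\<in>UNIV. gauss 1 ((yv t - signal enc h j w t) $ a)) * (\<Prod>a\<in>UNIV. gauss 1 ((yv' t - signal enc h j' w t) $ a)) * 1"
          using le1[OF P] by (intro mult_left_mono) auto
        also have "\<dots> \<le> (\<Prod>a\<in>UNIV. gauss (1 + \<tau>\<^sup>2) ((yv' t - signal enc h j' w t - Bt t *v (yv t - signal enc h j w t)) $ a))"
          unfolding mult_1_right by (rule gauss_transfer[OF B(2) \<tau>])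
        finally show ?thesis unfolding eqV using True by (simp add: s_def)
      next
        case False
        have "(\<Prod>a\<in>UNIV. gauss 1 ((yv t - signal enc h j w t) $ a)) * (\<Prod>a\<in>UNIV. gauss 1 ((yv' t - signal enc h j' w t) $ a)) * (\<Prod>a\<in>UNIV. gauss P (yv' t $ a))
          \<le> 1 * 1 * (\<Prod>a\<in>UNIV. gauss P (yv' t $ a))"
          by (intro mult_mono le1) auto
        then show ?thesis using False by (simp add: V_def s_def yv'_def)
      qed
    qed
    also have "\<dots> = (\<Prod>ia\<in>?I. gauss (s (fst ia)) (y' ia - V (w(i := 0)) y ia))"
      unfolding prod.cartesian_product' by simp
    finally show ?thesis .
  qed
  have "(\<Sum>w | \<forall>k. w k < W k. \<integral>\<^sup>+ z. (indicator {z. (\<forall>k\<in>demand j. dec j h (\<lambda>t\<in>{..<n}. outputs enc w h z j t) k = w k) \<and>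
        dec j' h (\<lambda>t\<in>{..<n}. outputs enc w h z j' t) i = w i} z *
      (weight P n (outputs enc w h z j) * weight P n (outputs enc w h z j'))) \<partial>noise_law S n)
    = (\<Sum>w | \<forall>k. w k < W k. \<integral>\<^sup>+ x. \<integral>\<^sup>+ x'. G w x x' \<partial>?N \<partial>?N)"
    unfolding eq blocks ..
  also have "\<dots> \<le> of_nat (\<Prod>k\<in>- insert i (demand j). W k) * ennreal (P ^ card ?I * (\<Prod>ia\<in>?I. s (fst ia)))"
    unfolding G_def p_def p'_def
    by (rule two_receiver_bound[where V = V]) (use P s0 i dm j Vb in auto)
  also have "P ^ card ?I * (\<Prod>ia\<in>?I. s (fst ia)) = P ^ (n * CARD('m)) * (\<Prod>t<n. (if t \<in> Gd then 1 + \<tau>\<^sup>2 else P) ^ CARD('m))"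
    unfolding prod.cartesian_product' by (simp add: card_cartesian_product s_def)
  finally show ?thesis .
qed

section \<open>Energy of the received signals\<close>

lemma sum_square_le_card:
  fixes f :: "'a \<Rightarrow> real"
  shows "(\<Sum>i\<in>A. f i)\<^sup>2 \<le> card A * (\<Sum>i\<in>A. (f i)\<^sup>2)"
  using sum_squared_le_sum_of_squares[of f A] by (simp add: mult.commute)

lemma norm_sq_sum_add_le:
  fixes u :: "'k::finite \<Rightarrow> 'v::real_normed_vector"
  shows "(norm ((\<Sum>k\<in>UNIV. u k) + v))\<^sup>2 \<le> 2 * CARD('k) * (\<Sum>k\<in>UNIV. (norm (u k))\<^sup>2) + 2 * (norm v)\<^sup>2"
proof -
  have "norm ((\<Sum>k\<in>UNIV. u k) + v) \<le> (\<Sum>k\<in>UNIV. norm (u k)) + norm v"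
    by (intro norm_triangle_le add_mono norm_sum) simp
  then have "(norm ((\<Sum>k\<in>UNIV. u k) + v))\<^sup>2 \<le> ((\<Sum>k\<in>UNIV. norm (u k)) + norm v)\<^sup>2"
    by (intro power_mono) auto
  also have "\<dots> \<le> 2 * (\<Sum>k\<in>UNIV. norm (u k))\<^sup>2 + 2 * (norm v)\<^sup>2"
    using zero_le_power2[of "(\<Sum>k\<in>UNIV. norm (u k)) - norm v"] by (simp add: power2_eq_square algebra_simps)
  also have "(\<Sum>k\<in>UNIV. norm (u k))\<^sup>2 \<le> CARD('k) * (\<Sum>k\<in>UNIV. (norm (u k))\<^sup>2)"
    by (rule sum_square_le_card)
  finally show ?thesis by (simp add: algebra_simps)
qed

text \<open>The power constraint averages over messages and channels only; integrating out the noise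
  carries it over to \<open>code_space\<close>.\<close>

lemma nn_integral_code_space_csi:
  fixes f :: "('k::finite \<Rightarrow> nat) \<times> ('r::finite, 'k, 'm::finite) csi \<Rightarrow> ennreal"
  assumes "prob_space \<mu>" and f: "f \<in> borel_measurable (message_law W \<Otimes>\<^sub>M channel_law \<mu> S n)"
  shows "(\<integral>\<^sup>+ x. f (fst x, fst (snd x)) \<partial>(code_space \<mu> S n W :: (_ \<times> ('r, 'k, 'm) csi \<times> _) measure)) = (\<integral>\<^sup>+ y. f y \<partial>(message_law W \<Otimes>\<^sub>M channel_law \<mu> S n))"
proof -
  let ?C = "channel_law \<mu> S n :: ('r, 'k, 'm) csi measure" and ?Z = "noise_law S n :: ('r, 'm) noise measure"
  interpret M: prob_space "message_law W" by (rule prob_space_message_law)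
  interpret C: prob_space ?C by (rule prob_space_channel_law[OF assms(1)])
  interpret Z: prob_space ?Z by (rule prob_space_noise_law)
  interpret CZ: pair_prob_space ?C ?Z ..
  have m: "(\<lambda>x. f (fst x, fst (snd x))) \<in> borel_measurable (message_law W \<Otimes>\<^sub>M (?C \<Otimes>\<^sub>M ?Z))"
    by (rule measurable_compose[OF _ f]) measurable
  have "(\<integral>\<^sup>+ x. f (fst x, fst (snd x)) \<partial>(message_law W \<Otimes>\<^sub>M (?C \<Otimes>\<^sub>M ?Z))) = (\<integral>\<^sup>+ w. \<integral>\<^sup>+ y. f (w, fst y) \<partial>(?C \<Otimes>\<^sub>M ?Z) \<partial>message_law W)"
    using CZ.P.nn_integral_fst[OF m] by simp
  also have "\<dots> = (\<integral>\<^sup>+ w. \<integral>\<^sup>+ h. f (w, h) \<partial>?C \<partial>message_law W)"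
  proof (rule nn_integral_cong)
    fix w assume "w \<in> space (message_law W)"
    then have "(\<lambda>h. f (w, h)) \<in> borel_measurable ?C" using measurable_Pair2[OF f] by simp
    then have "(\<lambda>y. f (w, fst y)) \<in> borel_measurable (?C \<Otimes>\<^sub>M ?Z)" by (rule measurable_compose[OF measurable_fst])
    from Z.nn_integral_fst[OF this]
    show "(\<integral>\<^sup>+ y. f (w, fst y) \<partial>(?C \<Otimes>\<^sub>M ?Z)) = (\<integral>\<^sup>+ h. f (w, h) \<partial>?C)" by (simp add: Z.emeasure_space_1)
  qed
  also have "\<dots> = (\<integral>\<^sup>+ y. f y \<partial>(message_law W \<Otimes>\<^sub>M ?C))" by (rule C.nn_integral_fst[OF f])
  finally show ?thesis .
qed

lemma nn_integral_code_space_noise: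
  fixes S :: "'r::finite set" and i :: "nat \<times> 'r \<times> 'm::finite" and W :: "'k::finite \<Rightarrow> nat"
  assumes "prob_space \<mu>" and f: "f \<in> borel_measurable std_complex_normal" and i: "i \<in> noise_index S n"
  shows "(\<integral>\<^sup>+ x. f (snd (snd x) i) \<partial>code_space \<mu> S n W) = (\<integral>\<^sup>+ z. f z \<partial>std_complex_normal)"
proof -
  let ?C = "channel_law \<mu> S n :: ('r, 'k, 'm) csi measure" and ?Z = "noise_law S n :: ('r, 'm) noise measure"
  interpret M: prob_space "message_law W" by (rule prob_space_message_law)
  interpret C: prob_space ?C by (rule prob_space_channel_law[OF assms(1)])
  interpret Z: prob_space ?Z by (rule prob_space_noise_law)
  interpret CZ: pair_prob_space ?C ?Z ..
  have c: "(\<lambda>z. z i) \<in> measurable ?Z std_complex_normal"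
    unfolding noise_law_alt by (rule measurable_component_singleton[OF i])
  have f1: "(\<lambda>z. f (z i)) \<in> borel_measurable ?Z" by (rule measurable_compose[OF c f])
  have f2: "(\<lambda>y. f (snd y i)) \<in> borel_measurable (?C \<Otimes>\<^sub>M ?Z)" by (rule measurable_compose[OF measurable_snd f1])
  have f3: "(\<lambda>x. f (snd (snd x) i)) \<in> borel_measurable (message_law W \<Otimes>\<^sub>M (?C \<Otimes>\<^sub>M ?Z))" by (rule measurable_compose[OF measurable_snd f2])
  have "(\<integral>\<^sup>+ x. f (snd (snd x) i) \<partial>(message_law W \<Otimes>\<^sub>M (?C \<Otimes>\<^sub>M ?Z))) = (\<integral>\<^sup>+ z. f (z i) \<partial>?Z)"
    using CZ.P.nn_integral_fst[OF f3] Z.nn_integral_fst[OF f2] by (simp add: M.emeasure_space_1[simplified] C.emeasure_space_1)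
  also have "\<dots> = (\<integral>\<^sup>+ z. f z \<partial>distr ?Z std_complex_normal (\<lambda>z. z i))" by (rule nn_integral_distr[OF c, symmetric]) (use f in simp)
  also have "distr ?Z std_complex_normal (\<lambda>z. z i) = std_complex_normal"
    unfolding noise_law_alt
    using distr_PiM_component[of "noise_index S n" "\<lambda>_. std_complex_normal" i] prob_space_std_complex_normal i by simp
  finally show ?thesis .
qed

lemma measurable_enc_csi:
  assumes "valid_encoders \<mu> S P n W enc" "t < n"
  shows "(\<lambda>x. enc k (fst x k) (snd x) t) \<in> borel_measurable (message_law W \<Otimes>\<^sub>M channel_law \<mu> S n)"
proof (rule measurable_compose_countable[where f = "\<lambda>v x. enc k v (snd x) t" and g = "\<lambda>x. fst x k"])
  show "(\<lambda>x. enc k v (snd x) t) \<in> borel_measurable (message_law W \<Otimes>\<^sub>M channel_law \<mu> S n)" for v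
    using assms unfolding valid_encoders_def by (intro measurable_compose[OF measurable_snd]) blast
  show "(\<lambda>x. fst x k) \<in> measurable (message_law W \<Otimes>\<^sub>M channel_law \<mu> S n) (count_space UNIV)"
    by (rule measurable_compose[OF measurable_fst measurable_message])
qed

abbreviation "output_energy \<mu> S n W enc j t \<equiv>
  \<integral>\<^sup>+ x. ennreal ((norm (outputs enc (fst x) (fst (snd x)) (snd (snd x)) j t))\<^sup>2) \<partial>code_space \<mu> S n W"

text \<open>Inputs may depend on the channel, but with almost surely bounded gains the received
  energy is at most a multiple of the input energy, to which the power constraint applies. As
  \<open>1 \<le> P\<close>, the noise fits into the same bound.\<close>

lemma outputs_second_moment:
  fixes \<mu> :: "complex measure" and S :: "'r::finite set"
  assumes \<mu>: "channel_distribution \<mu>"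
  obtains Yc where "0 < Yc" "\<And>P n W (enc :: ('r, 'k::finite, 'm::finite) encoders) j t. 1 \<le> P \<Longrightarrow> valid_encoders \<mu> S P n W enc \<Longrightarrow> j \<in> S \<Longrightarrow> t < n \<Longrightarrow>
    output_energy \<mu> S n W enc j t \<le> ennreal (Yc * P)"
proof -
  note \<mu>D = channel_distributionD[OF \<mu>]
  from \<mu> obtain b0 where b0: "AE c in \<mu>. cmod c \<le> b0" unfolding channel_distribution_def by auto
  define b where "b = max 1 b0"
  have b: "AE c in \<mu>. cmod c \<le> b" using b0 by eventually_elim (simp add: b_def)
  \<comment> \<open>Bounds the squared entrywise sum norm of a channel matrix. In \<open>Yc\<close>,
    the 8 per antenna is twice the bound 4 on the noise moment.\<close>
  define \<beta> where "\<beta> = (CARD('m) * (CARD('m) * b))\<^sup>2"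
  define Yc where "Yc = 2 * CARD('k) * CARD('k) * \<beta> + 8 * CARD('m)"
  have \<beta>: "0 \<le> \<beta>" by (simp add: \<beta>_def)
  have Yc: "0 < Yc" unfolding Yc_def using \<beta> by (intro add_nonneg_pos) auto
  show ?thesis
  proof (rule that[OF Yc])
    fix P :: real and n :: nat and W :: "'k \<Rightarrow> nat" and enc :: "('r, 'k, 'm) encoders" and j t
    assume P: "1 \<le> P" and enc: "valid_encoders \<mu> S P n W enc" and j: "j \<in> S" and t: "t < n"
    let ?\<Omega> = "code_space \<mu> S n W :: (('k \<Rightarrow> nat) \<times> ('r, 'k, 'm) csi \<times> ('r, 'm) noise) measure"
    interpret Z: prob_space "noise_law S n :: ('r, 'm) noise measure" by (rule prob_space_noise_law)
    interpret C: prob_space "channel_law \<mu> S n :: ('r, 'k, 'm) csi measure" by (rule prob_space_channel_law[OF \<mu>D(1)])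
    interpret CZ: pair_prob_space "channel_law \<mu> S n :: ('r, 'k, 'm) csi measure" "noise_law S n :: ('r, 'm) noise measure" ..
    have "AE h in channel_law \<mu> S n :: ('r, 'k, 'm) csi measure. \<forall>i\<in>csi_index S n. cmod (h i) \<le> b"
      unfolding channel_law_alt
    proof (intro AE_finite_allI finite_index)
      fix i :: "nat \<times> 'r \<times> 'k \<times> 'm \<times> 'm" assume "i \<in> csi_index S n"
      from AE_PiM_component[of "csi_index S n" "\<lambda>_. \<mu>", OF \<mu>D(1) this b]
      show "AE h in PiM (csi_index S n) (\<lambda>_. \<mu>). cmod (h i) \<le> b" .
    qed
    then have AEb: "AE x in ?\<Omega>. \<forall>i\<in>csi_index S n. cmod (fst (snd x) i) \<le> b"
      by (intro AE_pair_snd[OF CZ.P.prob_space_axioms, where P = "\<lambda>y. \<forall>i\<in>csi_index S n. cmod (fst y i) \<le> b"]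
          AE_pair_fst[OF Z.prob_space_axioms])
    define e where "e k x = ennreal ((norm (enc k (fst x k) (fst (snd x)) t))\<^sup>2)" for k and x :: "('k \<Rightarrow> nat) \<times> ('r, 'k, 'm) csi \<times> ('r, 'm) noise"
    define z where "z a x = ennreal ((cmod (snd (snd x) (t, j, a)))\<^sup>2)" for a and x :: "('k \<Rightarrow> nat) \<times> ('r, 'k, 'm) csi \<times> ('r, 'm) noise"
    have em0: "(\<lambda>y. ennreal ((norm (enc k (fst y k) (snd y) t))\<^sup>2)) \<in> borel_measurable (message_law W \<Otimes>\<^sub>M channel_law \<mu> S n)" for k
      using measurable_enc_csi[OF enc t, of k] by measurable
    have em: "e k \<in> borel_measurable ?\<Omega>" for k
    proof -
      have "(\<lambda>x. (fst x, fst (snd x))) \<in> measurable ?\<Omega> (message_law W \<Otimes>\<^sub>M channel_law \<mu> S n)" by measurable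
      from measurable_compose[OF this em0[of k]] show ?thesis by (simp add: e_def[abs_def])
    qed
    have ni: "(t, j, a) \<in> noise_index S n" for a using j t by (simp add: noise_index_def)
    have zm: "z a \<in> borel_measurable ?\<Omega>" for a
    proof -
      have "(\<lambda>x. snd (snd x) (t, j, a)) \<in> measurable ?\<Omega> std_complex_normal"
        by (rule measurable_compose[OF measurable_compose[OF measurable_snd measurable_snd]])
           (unfold noise_law_alt, rule measurable_component_singleton[OF ni])
      then have "(\<lambda>x. snd (snd x) (t, j, a)) \<in> borel_measurable ?\<Omega>" by (simp cong: measurable_cong_sets)
      then show ?thesis unfolding z_def[abs_def] by measurable
    qed
    have ie: "(\<integral>\<^sup>+ x. e k x \<partial>?\<Omega>) \<le> ennreal P" for k
    proof -
      have "(\<integral>\<^sup>+ x. e k x \<partial>?\<Omega>) = (\<integral>\<^sup>+ y. ennreal ((norm (enc k (fst y k) (snd y) t))\<^sup>2) \<partial>(message_law W \<Otimes>\<^sub>M channel_law \<mu> S n))"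
        using nn_integral_code_space_csi[OF \<mu>D(1) em0[of k]] by (simp add: e_def)
      also have "\<dots> \<le> ennreal P" using enc t unfolding valid_encoders_def by (simp add: split_beta')
      finally show ?thesis .
    qed
    have iz: "(\<integral>\<^sup>+ x. z a x \<partial>?\<Omega>) \<le> 4" for a
    proof -
      have m: "(\<lambda>c. ennreal ((cmod c)\<^sup>2)) \<in> borel_measurable std_complex_normal" by (simp cong: measurable_cong_sets)
      show ?thesis using nn_integral_code_space_noise[OF \<mu>D(1) m ni, of W a] noise_second_moment by (simp add: z_def)
    qed
    have "(\<integral>\<^sup>+ x. ennreal ((norm (outputs enc (fst x) (fst (snd x)) (snd (snd x)) j t))\<^sup>2) \<partial>?\<Omega>)
      \<le> (\<integral>\<^sup>+ x. (\<Sum>k\<in>UNIV. ennreal (2 * CARD('k) * \<beta>) * e k x) + (\<Sum>a\<in>UNIV. 2 * z a x) \<partial>?\<Omega>)"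
    proof (rule nn_integral_mono_AE)
      show "AE x in ?\<Omega>. ennreal ((norm (outputs enc (fst x) (fst (snd x)) (snd (snd x)) j t))\<^sup>2)
          \<le> (\<Sum>k\<in>UNIV. ennreal (2 * CARD('k) * \<beta>) * e k x) + (\<Sum>a\<in>UNIV. 2 * z a x)"
        using AEb
      proof eventually_elim
        case (elim x)
        define h where "h = fst (snd x)"
        define E where "E k = norm (enc k (fst x k) h t)" for k
        define v where "v = (\<chi> a. snd (snd x) (t, j, a))"
        have u: "(norm (channel_matrix h t j k *v enc k (fst x k) h t))\<^sup>2 \<le> \<beta> * (E k)\<^sup>2" for k
        proof -
          have "(\<Sum>a\<in>UNIV. \<Sum>c\<in>UNIV. cmod (channel_matrix h t j k $ a $ c)) \<le> (\<Sum>a\<in>(UNIV::'m set). \<Sum>c\<in>(UNIV::'m set). b)"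
            using elim j t by (intro sum_mono) (auto simp: channel_matrix_def h_def csi_index_def)
          also have "\<dots> = CARD('m) * (CARD('m) * b)" by simp
          finally have "norm (channel_matrix h t j k *v enc k (fst x k) h t) \<le> CARD('m) * (CARD('m) * b) * E k"
            using norm_matrix_vector_le[of "channel_matrix h t j k" "enc k (fst x k) h t"] unfolding E_def
            by (meson mult_right_mono norm_ge_zero order_trans)
          then have "(norm (channel_matrix h t j k *v enc k (fst x k) h t))\<^sup>2 \<le> (CARD('m) * (CARD('m) * b) * E k)\<^sup>2"
            by (intro power_mono) auto
          then show ?thesis by (simp only: \<beta>_def power_mult_distrib)
        qed
        have nv: "(norm v)\<^sup>2 = (\<Sum>a\<in>UNIV. (cmod (snd (snd x) (t, j, a)))\<^sup>2)"
          unfolding norm_vec_def L2_set_def by (simp add: v_def sum_nonneg)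
        have "(norm (outputs enc (fst x) h (snd (snd x)) j t))\<^sup>2 \<le>
            2 * CARD('k) * (\<Sum>k\<in>UNIV. (norm (channel_matrix h t j k *v enc k (fst x k) h t))\<^sup>2) + 2 * (norm v)\<^sup>2"
          unfolding outputs_signal signal_def v_def by (rule norm_sq_sum_add_le)
        also have "\<dots> \<le> 2 * CARD('k) * (\<Sum>k\<in>UNIV. \<beta> * (E k)\<^sup>2) + 2 * (norm v)\<^sup>2"
          using u by (intro add_right_mono mult_left_mono sum_mono) auto
        also have "\<dots> = (\<Sum>k\<in>UNIV. 2 * CARD('k) * \<beta> * (E k)\<^sup>2) + (\<Sum>a\<in>UNIV. 2 * (cmod (snd (snd x) (t, j, a)))\<^sup>2)"
          unfolding nv by (simp add: sum_distrib_left mult.assoc)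
        finally have "ennreal ((norm (outputs enc (fst x) h (snd (snd x)) j t))\<^sup>2) \<le>
          ennreal ((\<Sum>k\<in>UNIV. 2 * CARD('k) * \<beta> * (E k)\<^sup>2) + (\<Sum>a\<in>UNIV. 2 * (cmod (snd (snd x) (t, j, a)))\<^sup>2))"
          by (rule ennreal_leI)
        also have "\<dots> = (\<Sum>k\<in>UNIV. ennreal (2 * CARD('k) * \<beta>) * e k x) + (\<Sum>a\<in>UNIV. 2 * z a x)"
        proof -
          have "(\<Sum>k\<in>UNIV. ennreal (2 * CARD('k) * \<beta>) * e k x) = ennreal (\<Sum>k\<in>UNIV. 2 * CARD('k) * \<beta> * (E k)\<^sup>2)"
            using \<beta> by (subst sum_ennreal[symmetric]) (auto simp: e_def E_def h_def ennreal_mult[symmetric])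
          moreover have "(\<Sum>a\<in>UNIV. 2 * z a x) = ennreal (\<Sum>a\<in>UNIV. 2 * (cmod (snd (snd x) (t, j, a)))\<^sup>2)"
            by (subst sum_ennreal[symmetric]) (auto simp: z_def ennreal_mult)
          ultimately show ?thesis using \<beta> by (simp add: ennreal_plus[symmetric] sum_nonneg del: ennreal_plus)
        qed
        finally show ?case by (simp add: h_def)
      qed
    qed
    also have "\<dots> = (\<Sum>k\<in>UNIV. ennreal (2 * CARD('k) * \<beta>) * (\<integral>\<^sup>+ x. e k x \<partial>?\<Omega>)) + (\<Sum>a\<in>UNIV. 2 * (\<integral>\<^sup>+ x. z a x \<partial>?\<Omega>))"
      using em zm by (simp add: nn_integral_add nn_integral_sum nn_integral_cmult)
    also have "\<dots> \<le> (\<Sum>k\<in>(UNIV::'k set). ennreal (2 * CARD('k) * \<beta>) * ennreal P) + (\<Sum>a\<in>(UNIV::'m set). 2 * 4)"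
      by (intro add_mono sum_mono mult_left_mono ie iz) auto
    also have "\<dots> = ennreal (2 * CARD('k) * CARD('k) * \<beta> * P + 8 * CARD('m))"
    proof -
      have "(\<Sum>k\<in>(UNIV::'k set). ennreal (2 * CARD('k) * \<beta>) * ennreal P) = ennreal (2 * CARD('k) * CARD('k) * \<beta> * P)"
        using \<beta> P by (simp add: ennreal_mult[symmetric] ennreal_of_nat_eq_real_of_nat mult_ac)
      moreover have "(\<Sum>a\<in>(UNIV::'m set). 2 * 4 :: ennreal) = ennreal (8 * CARD('m))"
        by (simp add: ennreal_of_nat_eq_real_of_nat ennreal_mult mult.commute)
      ultimately show ?thesis using \<beta> P by (simp add: ennreal_plus[symmetric] del: ennreal_plus)
    qed
    also have "\<dots> \<le> ennreal (Yc * P)"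
      using P by (intro ennreal_leI) (simp add: Yc_def distrib_right)
    finally show "(\<integral>\<^sup>+ x. ennreal ((norm (outputs enc (fst x) (fst (snd x)) (snd (snd x)) j t))\<^sup>2) \<partial>?\<Omega>) \<le> ennreal (Yc * P)" .
  qed
qed

lemma card_messages: "card {w :: 'k::finite \<Rightarrow> nat. \<forall>k. w k < W k} = (\<Prod>k\<in>UNIV. W k)"
proof -
  have "{w. \<forall>k. w k < W k} = (\<Pi>\<^sub>E k\<in>UNIV. {..<W k})" by auto
  then show ?thesis by (simp add: card_PiE)
qed

section \<open>Converse\<close>

text \<open>
  On the event that the outputs have typical energy the Gaussian weights are at least
  \<open>exp (- 8 * Yc * n)\<close>, so inserting them costs only a factor independent of the power.
\<close>

lemma weighted_converse:
  fixes enc :: "('r::finite, 'k::finite, 'm::finite) encoders" and dec :: "('r, 'k, 'm) decoders"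
  assumes \<mu>: "channel_distribution \<mu>" and enc: "valid_encoders \<mu> S P n W enc" and dec: "valid_decoders \<mu> S n dec"
    and W: "\<And>k. 0 < W k" and P: "0 < P" and Yc: "0 < Yc" and n: "0 < n" and j: "j \<in> S" "j' \<in> S"
    and err: "error_probability \<mu> S demand n W enc dec \<le> 1 / 4"
    and mom: "\<And>j t. j \<in> S \<Longrightarrow> t < n \<Longrightarrow>
      output_energy \<mu> S n W enc j t \<le> ennreal (Yc * P)"
    and H: "H \<in> sets (channel_law \<mu> S n)" "emeasure (channel_law \<mu> S n) (space (channel_law \<mu> S n) - H) \<le> ennreal (1 / 8)"
    and B: "\<And>h. h \<in> H \<Longrightarrow> (\<Sum>w | \<forall>k. w k < W k. \<integral>\<^sup>+ z. (indicator {z. \<forall>j\<in>S. \<forall>k\<in>demand j.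
        dec j h (\<lambda>t\<in>{..<n}. outputs enc w h z j t) k = w k} z *
      (weight P n (outputs enc w h z j) * weight P n (outputs enc w h z j'))) \<partial>noise_law S n) \<le> B"
  shows "ennreal (3 / 8) * of_nat (\<Prod>k\<in>UNIV. W k) \<le> ennreal (exp (16 * Yc * n)) * B"
proof -
  note \<mu>D = channel_distributionD[OF \<mu>]
  let ?M = "message_law W" and ?C = "channel_law \<mu> S n :: ('r, 'k, 'm) csi measure"
    and ?Z = "noise_law S n :: ('r, 'm) noise measure"
  let ?\<Omega> = "?M \<Otimes>\<^sub>M (?C \<Otimes>\<^sub>M ?Z)"
  interpret M: prob_space ?M by (rule prob_space_message_law)
  interpret C: prob_space ?C by (rule prob_space_channel_law[OF \<mu>D(1)])
  interpret Z: prob_space ?Z by (rule prob_space_noise_law)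
  interpret CZ: pair_prob_space ?C ?Z ..
  interpret \<Omega>: pair_prob_space ?M "?C \<Otimes>\<^sub>M ?Z" ..
  define y where "y j x t = outputs enc (fst x) (fst (snd x)) (snd (snd x)) j t" for j x t
  have ym: "(\<lambda>x. y j x t) \<in> borel_measurable ?\<Omega>" if "j \<in> S" "t < n" for j t
    unfolding y_def by (rule measurable_outputs[OF \<mu>D(2) enc that])
  have em: "(\<lambda>x. \<Sum>t<n. (norm (y j x t))\<^sup>2) \<in> borel_measurable ?\<Omega>" if "j \<in> S" for j
    using ym[OF that] by (intro borel_measurable_sum) simp
  define C0 where "C0 = {x \<in> space ?\<Omega>. \<forall>j\<in>S. \<forall>k\<in>demand j.
      dec j (fst (snd x)) (\<lambda>t\<in>{..<n}. outputs enc (fst x) (fst (snd x)) (snd (snd x)) j t) k = fst x k}"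
  have C0: "C0 \<in> sets ?\<Omega>" unfolding C0_def by (rule measurable_correct[OF \<mu>D(2) enc dec])
  have "error_probability \<mu> S demand n W enc dec = \<Omega>.P.prob (space ?\<Omega> - C0)"
  proof -
    have "{(w, h, z) \<in> space ?\<Omega>. \<exists>j\<in>S. \<exists>k\<in>demand j. dec j h (\<lambda>t\<in>{..<n}. received (\<lambda>k. enc k (w k) h) h z j t) k \<noteq> w k} = space ?\<Omega> - C0"
      unfolding C0_def outputs_def by (auto, blast)
    then show ?thesis unfolding error_probability_def Let_def by (rule arg_cong)
  qed
  then have pC0: "3 / 4 \<le> \<Omega>.P.prob C0" using err \<Omega>.P.prob_compl[OF C0] by simp
  \<comment> \<open>Markov's inequality: the mean energy is at most \<open>n * (Yc * P)\<close>, so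
    eight times that value is exceeded with probability at most \<open>1 / 8\<close>.\<close>
  define Bj where "Bj j = {x \<in> space ?\<Omega>. 8 * Yc * n * P < (\<Sum>t<n. (norm (y j x t))\<^sup>2)}" for j
  have Bj: "Bj j \<in> sets ?\<Omega>" "\<Omega>.P.prob (Bj j) \<le> 1 / 8" if j: "j \<in> S" for j
  proof -
    show s: "Bj j \<in> sets ?\<Omega>" unfolding Bj_def using em[OF j] by measurable
    have pos: "0 < 8 * Yc * n * P" using Yc n P by simp
    let ?u = "\<lambda>x. \<Sum>t<n. ennreal ((norm (y j x t))\<^sup>2)"
    have "ennreal (8 * Yc * n * P) * emeasure ?\<Omega> (Bj j) = (\<integral>\<^sup>+ x. ennreal (8 * Yc * n * P) * indicator (Bj j) x \<partial>?\<Omega>)"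
      using s by (simp add: nn_integral_cmult_indicator)
    also have "\<dots> \<le> (\<integral>\<^sup>+ x. ?u x \<partial>?\<Omega>)"
    proof (rule nn_integral_mono)
      fix x
      show "ennreal (8 * Yc * n * P) * indicator (Bj j) x \<le> ?u x"
        by (cases "x \<in> Bj j") (auto simp: Bj_def sum_ennreal intro!: ennreal_leI)
    qed
    also have "\<dots> = (\<Sum>t<n. \<integral>\<^sup>+ x. ennreal ((norm (y j x t))\<^sup>2) \<partial>?\<Omega>)"
      by (rule nn_integral_sum) (use ym[OF j] in auto)
    also have "\<dots> \<le> (\<Sum>t<n. ennreal (Yc * P))" unfolding y_def by (intro sum_mono mom j) simp
    also have "\<dots> = ennreal (n * (Yc * P))" using Yc P by (simp add: ennreal_mult ennreal_of_nat_eq_real_of_nat)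
    finally have "8 * Yc * n * P * \<Omega>.P.prob (Bj j) \<le> n * (Yc * P)"
      unfolding \<Omega>.P.emeasure_eq_measure using pos Yc P by (simp add: ennreal_mult[symmetric])
    then have "(8 * Yc * n * P) * \<Omega>.P.prob (Bj j) \<le> (8 * Yc * n * P) * (1 / 8)" by (simp add: ac_simps)
    then show "\<Omega>.P.prob (Bj j) \<le> 1 / 8" using pos by (simp only: mult_le_cancel_left_pos)
  qed
  define BH where "BH = (UNIV :: ('k \<Rightarrow> nat) set) \<times> ((space ?C - H) \<times> space ?Z)"
  have U: "UNIV \<in> sets ?M" by (simp add: sets_message_law)
  have BH: "BH \<in> sets ?\<Omega>" unfolding BH_def using H(1) U by auto
  have "emeasure ?\<Omega> BH = emeasure ?C (space ?C - H)"
    unfolding BH_def using H(1) U M.emeasure_space_1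
    by (simp add: CZ.P.emeasure_pair_measure_Times Z.emeasure_pair_measure_Times Z.emeasure_space_1)
  then have "ennreal (\<Omega>.P.prob BH) \<le> ennreal (1 / 8)" using H(2) unfolding \<Omega>.P.emeasure_eq_measure by (simp only:)
  then have pBH: "\<Omega>.P.prob BH \<le> 1 / 8" by (subst (asm) ennreal_le_iff) auto
  \<comment> \<open>Correct decoding has probability at least \<open>3 / 4\<close>; removing three
    sets of probability at most \<open>1 / 8\<close> leaves the \<open>3 / 8\<close> of the
    statement.\<close>
  define Gd where "Gd = C0 - (Bj j \<union> Bj j' \<union> BH)"
  have Gd: "Gd \<in> sets ?\<Omega>" unfolding Gd_def using C0 Bj(1) j BH by auto
  have "\<Omega>.P.prob C0 \<le> \<Omega>.P.prob (Gd \<union> (Bj j \<union> Bj j' \<union> BH))"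
    using Gd C0 Bj(1) j BH by (intro \<Omega>.P.finite_measure_mono) (auto simp: Gd_def)
  also have "\<dots> \<le> \<Omega>.P.prob Gd + \<Omega>.P.prob (Bj j \<union> Bj j' \<union> BH)"
    using Gd Bj(1) j BH by (intro measure_Un_le) auto
  also have "\<Omega>.P.prob (Bj j \<union> Bj j' \<union> BH) \<le> \<Omega>.P.prob (Bj j \<union> Bj j') + \<Omega>.P.prob BH"
    using Bj(1) j BH by (intro measure_Un_le) auto
  also have "\<Omega>.P.prob (Bj j \<union> Bj j') \<le> \<Omega>.P.prob (Bj j) + \<Omega>.P.prob (Bj j')"
    using Bj(1) j by (intro measure_Un_le) auto
  finally have "3 / 8 \<le> \<Omega>.P.prob Gd" using pC0 Bj(2)[OF j(1)] Bj(2)[OF j(2)] pBH by linarith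
  then have "ennreal (3 / 8) \<le> emeasure ?\<Omega> Gd" unfolding \<Omega>.P.emeasure_eq_measure by (rule ennreal_leI)
  define F where "F x = indicator H (fst (snd x)) * (indicator C0 x * (weight P n (y j x) * weight P n (y j' x)))" for x
  have wm: "(\<lambda>x. weight P n (y j x)) \<in> borel_measurable ?\<Omega>" if "j \<in> S" for j
    unfolding weight_exp using em[OF that] by measurable
  have Hm: "(\<lambda>x. indicator H (fst (snd x)) :: ennreal) \<in> borel_measurable ?\<Omega>"
    by (rule measurable_compose[OF measurable_compose[OF measurable_snd measurable_fst]]) (use H(1) in simp)
  have Fm: "F \<in> borel_measurable ?\<Omega>"
    unfolding F_def[abs_def] using C0 by (intro borel_measurable_times_ennreal Hm wm j borel_measurable_indicator)
  note \<open>ennreal (3 / 8) \<le> emeasure ?\<Omega> Gd\<close>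
  also have "emeasure ?\<Omega> Gd = (\<integral>\<^sup>+ x. indicator Gd x \<partial>?\<Omega>)" using Gd by simp
  also have "\<dots> \<le> (\<integral>\<^sup>+ x. ennreal (exp (16 * Yc * n)) * F x \<partial>?\<Omega>)"
  proof (rule nn_integral_mono)
    fix x assume x: "x \<in> space ?\<Omega>"
    show "indicator Gd x \<le> ennreal (exp (16 * Yc * n)) * F x"
    proof (cases "x \<in> Gd")
      case True
      then have "x \<in> C0" "fst (snd x) \<in> H" and e: "\<And>l. l \<in> {j, j'} \<Longrightarrow> (\<Sum>t<n. (norm (y l x t))\<^sup>2) \<le> 8 * Yc * n * P"
        using x by (auto simp: Gd_def Bj_def BH_def space_pair_measure not_less)
      have ex: "exp (- (8 * Yc * n)) \<le> exp (- (\<Sum>t<n. (norm (y l x t))\<^sup>2) / P)" if "l \<in> {j, j'}" for l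
        using e[OF that] P by (simp add: pos_divide_le_eq)
      have "1 = exp (16 * Yc * n) * (exp (- (8 * Yc * n)) * exp (- (8 * Yc * n)))" by (simp add: exp_add[symmetric])
      also have "\<dots> \<le> exp (16 * Yc * n) * (exp (- (\<Sum>t<n. (norm (y j x t))\<^sup>2) / P) * exp (- (\<Sum>t<n. (norm (y j' x t))\<^sup>2) / P))"
        by (intro mult_left_mono mult_mono ex) auto
      finally have "ennreal 1 \<le> ennreal (exp (16 * Yc * n)) * (weight P n (y j x) * weight P n (y j' x))"
        unfolding weight_exp by (simp add: ennreal_mult[symmetric] ennreal_leI del: ennreal_1)
      then show ?thesis using True \<open>x \<in> C0\<close> \<open>fst (snd x) \<in> H\<close> by (simp add: F_def)
    qed simp
  qed
  also have "\<dots> = ennreal (exp (16 * Yc * n)) * (\<integral>\<^sup>+ x. F x \<partial>?\<Omega>)" by (rule nn_integral_cmult[OF Fm])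
  finally have step1: "ennreal (3 / 8) \<le> ennreal (exp (16 * Yc * n)) * (\<integral>\<^sup>+ x. F x \<partial>?\<Omega>)" .
  let ?S = "{w. \<forall>k. w k < W k}"
  have Fw: "(\<lambda>y. F (w, y)) \<in> borel_measurable (?C \<Otimes>\<^sub>M ?Z)" for w
    using measurable_Pair2[OF Fm, of w] by simp
  have "(\<integral>\<^sup>+ x. F x \<partial>?\<Omega>) = (\<integral>\<^sup>+ w. \<integral>\<^sup>+ y. F (w, y) \<partial>(?C \<Otimes>\<^sub>M ?Z) \<partial>?M)"
    by (rule CZ.P.nn_integral_fst[OF Fm, symmetric])
  \<comment> \<open>Messages are uniform, so multiplying by their number turns the average into the
    sum that the volume bounds estimate.\<close>
  also have "\<dots> = (\<Sum>w\<in>?S. \<integral>\<^sup>+ y. F (w, y) \<partial>(?C \<Otimes>\<^sub>M ?Z)) / card ?S"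
    unfolding message_law_def using messages_nonempty[OF W] messages_finite by (rule nn_integral_pmf_of_set)
  finally have "(\<integral>\<^sup>+ x. F x \<partial>?\<Omega>) * card ?S = (\<Sum>w\<in>?S. \<integral>\<^sup>+ y. F (w, y) \<partial>(?C \<Otimes>\<^sub>M ?Z)) / card ?S * card ?S" by simp
  also have "\<dots> = (\<Sum>w\<in>?S. \<integral>\<^sup>+ y. F (w, y) \<partial>(?C \<Otimes>\<^sub>M ?Z))"
  proof -
    have "card ?S \<noteq> 0" unfolding card_messages using W by simp
    then have "(of_nat (card ?S) :: ennreal) / of_nat (card ?S) = 1" by (intro ennreal_divide_self) (auto simp: of_nat_less_top)
    then show ?thesis unfolding ennreal_divide_times by simp
  qed
  also have "\<dots> = (\<Sum>w\<in>?S. \<integral>\<^sup>+ h. \<integral>\<^sup>+ z. F (w, h, z) \<partial>?Z \<partial>?C)"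
    by (intro sum.cong refl Z.nn_integral_fst[OF Fw, symmetric])
  also have "\<dots> = (\<integral>\<^sup>+ h. (\<Sum>w\<in>?S. \<integral>\<^sup>+ z. F (w, h, z) \<partial>?Z) \<partial>?C)"
    by (rule nn_integral_sum[symmetric]) (use Z.borel_measurable_nn_integral_fst[OF Fw] in simp)
  also have "\<dots> \<le> (\<integral>\<^sup>+ h. B \<partial>?C)"
  proof (rule nn_integral_mono)
    fix h assume h: "h \<in> space ?C"
    show "(\<Sum>w\<in>?S. \<integral>\<^sup>+ z. F (w, h, z) \<partial>?Z) \<le> B"
    proof (cases "h \<in> H")
      case True
      have "y l (w, h, z) = outputs enc w h z l" for l w z by (rule ext) (simp add: y_def)
      then have "(\<Sum>w\<in>?S. \<integral>\<^sup>+ z. F (w, h, z) \<partial>?Z) \<le> (\<Sum>w\<in>?S. \<integral>\<^sup>+ z. (indicator {z. \<forall>j\<in>S. \<forall>k\<in>demand j.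
        dec j h (\<lambda>t\<in>{..<n}. outputs enc w h z j t) k = w k} z *
      (weight P n (outputs enc w h z j) * weight P n (outputs enc w h z j'))) \<partial>?Z)"
        by (intro sum_mono nn_integral_mono) (auto simp: F_def C0_def indicator_def)
      also note B[OF True]
      finally show ?thesis .
    qed (simp add: F_def)
  qed
  also have "\<dots> = B" by (simp add: C.emeasure_space_1)
  finally have step2: "(\<integral>\<^sup>+ x. F x \<partial>?\<Omega>) * card ?S \<le> B" .
  have "ennreal (3 / 8) * of_nat (\<Prod>k\<in>UNIV. W k) \<le> ennreal (exp (16 * Yc * n)) * (\<integral>\<^sup>+ x. F x \<partial>?\<Omega>) * card ?S"
    unfolding card_messages[symmetric, of W] using step1 by (intro mult_right_mono) auto
  also have "\<dots> \<le> ennreal (exp (16 * Yc * n)) * B" unfolding mult.assoc using step2 by (intro mult_left_mono) auto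
  finally show ?thesis .
qed

text \<open>Logarithms divided by \<open>n\<close>: factors exponential in \<open>n\<close> become
  constants free of \<open>P\<close>, and these vanish once the rates are divided by
  \<open>log 2 P\<close>.\<close>

lemma rate_sum_le:
  fixes R :: "real ^ 'k::finite" and W :: "'k \<Rightarrow> nat"
  assumes W: "\<And>k. 2 powr (real n * R $ k) \<le> real (W k)" and n: "1 \<le> n" and P: "1 \<le> P"
    and le: "ennreal (3 / 8) * of_nat (\<Prod>k\<in>UNIV. W k) \<le> ennreal (exp (c1 * n)) *
       (of_nat (\<Prod>k\<in>- D. W k) * ennreal (exp (c2 * n) * P powr (n * a)))"
  shows "(\<Sum>k\<in>D. R $ k) \<le> a * log 2 P + ((c1 + c2) / ln 2 + 2)"
proof -
  have W0: "0 < real (W k)" for k using W[of k] powr_gt_zero[of 2 "real n * R $ k"] by linarith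
  define A where "A = (\<Prod>k\<in>D. real (W k))"
  define A' where "A' = (\<Prod>k\<in>- D. real (W k))"
  have A': "0 < A'" unfolding A'_def using W0 by (intro prod_pos) auto
  have split: "real (\<Prod>k\<in>UNIV. W k) = A * A'"
    unfolding A_def A'_def of_nat_prod by (subst prod.union_disjoint[symmetric]) (auto simp: Compl_partition)
  have A0: "0 \<le> A" unfolding A_def by (intro prod_nonneg) auto
  have pA': "real (\<Prod>k\<in>- D. W k) = A'" by (simp add: A'_def)
  have "ennreal (3 / 8) * of_nat (\<Prod>k\<in>UNIV. W k) = ennreal (3 / 8 * (A * A'))"
    unfolding ennreal_of_nat_eq_real_of_nat split using A0 A' by (subst ennreal_mult) auto
  moreover have "ennreal (exp (c1 * n)) * (of_nat (\<Prod>k\<in>- D. W k) * ennreal (exp (c2 * n) * P powr (n * a)))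
    = ennreal (exp (c1 * n) * (A' * (exp (c2 * n) * P powr (n * a))))"
    unfolding ennreal_of_nat_eq_real_of_nat pA' using A' by (simp add: ennreal_mult)
  ultimately have "ennreal (3 / 8 * (A * A')) \<le> ennreal (exp (c1 * n) * (A' * (exp (c2 * n) * P powr (n * a))))"
    using le by simp
  then have "3 / 8 * (A * A') \<le> exp (c1 * n) * (A' * (exp (c2 * n) * P powr (n * a)))"
    using A' by (subst (asm) ennreal_le_iff) auto
  then have "(3 / 8 * A) * A' \<le> (exp ((c1 + c2) * n) * P powr (n * a)) * A'"
  proof -
    have "exp ((c1 + c2) * n) = exp (c1 * n) * exp (c2 * n)" by (simp add: distrib_right exp_add)
    then show "3 / 8 * (A * A') \<le> exp (c1 * n) * (A' * (exp (c2 * n) * P powr (n * a))) \<Longrightarrow>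
        (3 / 8 * A) * A' \<le> (exp ((c1 + c2) * n) * P powr (n * a)) * A'" by (simp only: ac_simps)
  qed
  then have 1: "3 / 8 * A \<le> exp ((c1 + c2) * n) * P powr (n * a)" using A' by (simp only: mult_le_cancel_right_pos)
  have "2 powr (n * (\<Sum>k\<in>D. R $ k)) = (\<Prod>k\<in>D. 2 powr (n * R $ k))"
    by (simp add: powr_sum sum_distrib_left)
  also have "\<dots> \<le> A" unfolding A_def using W by (intro prod_mono) auto
  finally have "3 / 8 * 2 powr (n * (\<Sum>k\<in>D. R $ k)) \<le> exp ((c1 + c2) * n) * P powr (n * a)" using 1 by linarith
  then have "ln (3 / 8 * 2 powr (n * (\<Sum>k\<in>D. R $ k))) \<le> ln (exp ((c1 + c2) * n) * P powr (n * a))"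
    using P by (subst ln_le_cancel_iff) auto
  moreover have "ln (3 / 8 * 2 powr (n * (\<Sum>k\<in>D. R $ k))) = ln (3 / 8) + n * (\<Sum>k\<in>D. R $ k) * ln 2"
    by (subst ln_mult) (auto simp: ln_powr)
  moreover have "ln (exp ((c1 + c2) * n) * P powr (n * a)) = (c1 + c2) * n + n * a * ln P"
    using P by (simp add: ln_mult ln_powr)
  \<comment> \<open>\<open>3 / 8\<close> exceeds \<open>1 / 4\<close>, so the probability of the
    good event costs at most 2 bits, which \<open>1 \<le> n\<close> allows to be charged per
    slot.\<close>
  moreover have "- (2 * ln 2) \<le> ln (3 / 8 :: real)"
  proof -
    have "- (2 * ln 2) = ln (1 / 4 :: real)" using ln_powr[of 2 2] by (simp add: ln_div)
    also have "\<dots> \<le> ln (3 / 8)" by simp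
    finally show ?thesis .
  qed
  ultimately have "n * ((\<Sum>k\<in>D. R $ k) * ln 2) \<le> n * ((c1 + c2) + a * ln P) + 2 * ln 2"
    by (simp add: algebra_simps)
  also have "2 * ln 2 \<le> real n * (2 * ln 2)" using n by simp
  finally have "n * ((\<Sum>k\<in>D. R $ k) * ln 2) \<le> n * ((c1 + c2) + a * ln P + 2 * ln 2)" by (simp add: algebra_simps)
  then have "(\<Sum>k\<in>D. R $ k) * ln 2 \<le> (c1 + c2) + a * ln P + 2 * ln 2" using n by simp
  then have "(\<Sum>k\<in>D. R $ k) \<le> ((c1 + c2) + a * ln P + 2 * ln 2) / ln 2" by (simp add: pos_le_divide_eq)
  also have "\<dots> = a * log 2 P + ((c1 + c2) / ln 2 + 2)" by (simp add: log_def add_divide_distrib)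
  finally show ?thesis .
qed

text \<open>A linear inequality is a closed condition, so it passes from achievable rates to their
  closure; the constant disappears in the limit of the power.\<close>

lemma DoF_sum_le:
  fixes d :: "real ^ 'k::finite"
  assumes d: "d \<in> DoF_region TYPE('m::finite) \<mu> S demand"
    and le: "\<And>P R. 1 \<le> P \<Longrightarrow> achievable TYPE('m::finite) \<mu> S demand P R \<Longrightarrow> (\<Sum>k\<in>D. R $ k) \<le> a * log 2 P + c"
  shows "(\<Sum>k\<in>D. d $ k) \<le> a"
proof -
  from d obtain R :: "real \<Rightarrow> real ^ 'k" where R: "\<And>P. 0 < P \<Longrightarrow> R P \<in> capacity_region TYPE('m) \<mu> S demand P"
    "\<And>k. ((\<lambda>P. R P $ k / log 2 P) \<longlongrightarrow> d $ k) at_top" by (auto simp: DoF_region_def)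
  have cap: "(\<Sum>k\<in>D. R P $ k) \<le> a * log 2 P + c" if P: "1 \<le> P" for P
  proof -
    have "closure {R. achievable TYPE('m) \<mu> S demand P R} \<subseteq> {R. (\<Sum>k\<in>D. R $ k) \<le> a * log 2 P + c}"
    proof (rule closure_minimal)
      show "closed {R :: real ^ 'k. (\<Sum>k\<in>D. R $ k) \<le> a * log 2 P + c}"
        by (intro closed_Collect_le continuous_intros)
    qed (use le[OF P] in blast)
    then show ?thesis using R(1)[of P] P unfolding capacity_region_def by auto
  qed
  have "((\<lambda>P. \<Sum>k\<in>D. R P $ k / log 2 P) \<longlongrightarrow> (\<Sum>k\<in>D. d $ k)) at_top" by (intro tendsto_sum R(2))
  moreover have "((\<lambda>P. a + c / log 2 P) \<longlongrightarrow> a) at_top" by real_asymp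
  moreover have "\<forall>\<^sub>F P in at_top. (\<Sum>k\<in>D. R P $ k / log 2 P) \<le> a + c / log 2 P"
    using eventually_gt_at_top[of 1]
  proof eventually_elim
    case (elim P)
    then have lp: "0 < log 2 P" by simp
    have "(\<Sum>k\<in>D. R P $ k / log 2 P) = (\<Sum>k\<in>D. R P $ k) / log 2 P" by (simp add: sum_divide_distrib)
    also have "\<dots> \<le> (a * log 2 P + c) / log 2 P" using cap[of P] elim lp by (intro divide_right_mono) auto
    also have "\<dots> = a + c / log 2 P" using lp by (simp add: add_divide_distrib)
    finally show ?case .
  qed
  ultimately show ?thesis by (intro tendsto_le[of at_top]) auto
qed

text \<open>One code at one block length is enough for the converse. The error \<open>1 / 4\<close>
  leaves room for the other exceptional events, and \<open>3 \<le> n\<close> brings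
  \<open>(1 / 2) ^ n\<close> down to \<open>1 / 8\<close>.\<close>

lemma achievable_good_code:
  fixes R :: "real ^ 'k::finite"
  assumes "achievable TYPE('m::finite) \<mu> S demand P R"
  obtains n W and enc :: "('r::finite, 'k::finite, 'm::finite) encoders" and dec :: "('r, 'k, 'm) decoders" where
    "3 \<le> n" "\<And>k. 0 < W k" "\<And>k. 2 powr (real n * R $ k) \<le> real (W k)"
    "valid_encoders \<mu> S P n W enc" "valid_decoders \<mu> S n dec" "error_probability \<mu> S demand n W enc dec \<le> 1 / 4"
proof -
  define W where "W n k = nat \<lceil>2 powr (real n * R $ k)\<rceil>" for n k
  from assms obtain enc :: "nat \<Rightarrow> ('r, 'k, 'm) encoders" and dec :: "nat \<Rightarrow> ('r, 'k, 'm) decoders" where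
    v: "\<And>n. valid_encoders \<mu> S P n (W n) (enc n)" "\<And>n. valid_decoders \<mu> S n (dec n)"
    and lim: "(\<lambda>n. error_probability \<mu> S demand n (W n) (enc n) (dec n)) \<longlonglongrightarrow> 0"
    unfolding achievable_def Let_def W_def by blast
  have "\<forall>\<^sub>F n in sequentially. error_probability \<mu> S demand n (W n) (enc n) (dec n) < 1 / 4"
    by (rule order_tendstoD(2)[OF lim]) simp
  then have "\<forall>\<^sub>F n in sequentially. error_probability \<mu> S demand n (W n) (enc n) (dec n) < 1 / 4 \<and> 3 \<le> n"
    using eventually_ge_at_top[of 3] by (rule eventually_conj)
  then obtain n where n: "error_probability \<mu> S demand n (W n) (enc n) (dec n) < 1 / 4" "3 \<le> n"
    by (auto simp: eventually_sequentially)
  show ?thesis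
    by (rule that[of n "W n" "enc n" "dec n"])
       (use n v in \<open>auto simp: W_def real_nat_ceiling_ge\<close>)
qed

lemma weight_le_1: "0 < P \<Longrightarrow> weight P n y \<le> 1"
  unfolding weight_exp by (auto intro!: ennreal_le_1[THEN iffD2] sum_nonneg divide_nonneg_pos)

text \<open>The weighted bound is applied with \<open>j' = j\<close> and without excluding any
  channel; one of the two equal weights is estimated by 1.\<close>

lemma achievable_rate_one:
  fixes S :: "'r::finite set" and demand :: "'r \<Rightarrow> 'k::finite set"
  assumes \<mu>: "channel_distribution \<mu>" and j: "j \<in> S"
  obtains c where "\<And>P R. 1 \<le> P \<Longrightarrow> achievable TYPE('m::finite) \<mu> S demand P R \<Longrightarrow>
    (\<Sum>k\<in>demand j. R $ k) \<le> CARD('m) * log 2 P + c"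
proof -
  obtain Yc where Yc: "0 < Yc" and mom: "\<And>P n W (enc :: ('r, 'k, 'm) encoders) j t. 1 \<le> P \<Longrightarrow> valid_encoders \<mu> S P n W enc \<Longrightarrow> j \<in> S \<Longrightarrow> t < n \<Longrightarrow>
    output_energy \<mu> S n W enc j t \<le> ennreal (Yc * P)"
  proof (rule outputs_second_moment[where S = S and 'k = 'k and 'm = 'm, OF \<mu>])
    fix Yc :: real
    assume a: "0 < Yc" and b: "\<And>P n W (enc :: ('r, 'k, 'm) encoders) j t. 1 \<le> P \<Longrightarrow> valid_encoders \<mu> S P n W enc \<Longrightarrow> j \<in> S \<Longrightarrow> t < n \<Longrightarrow>
      output_energy \<mu> S n W enc j t \<le> ennreal (Yc * P)"
    show thesis by (rule that[OF a b])
  qed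
  show ?thesis
  proof (rule that)
    fix P :: real and R :: "real ^ 'k" assume P: "1 \<le> P" and ach: "achievable TYPE('m) \<mu> S demand P R"
    obtain n W and enc :: "('r, 'k, 'm) encoders" and dec :: "('r, 'k, 'm) decoders" where
      n: "3 \<le> n" and W: "\<And>k. 0 < W k" "\<And>k. 2 powr (real n * R $ k) \<le> real (W k)"
      and v: "valid_encoders \<mu> S P n W enc" "valid_decoders \<mu> S n dec" and err: "error_probability \<mu> S demand n W enc dec \<le> 1 / 4"
      using achievable_good_code[OF ach] by metis
    have P0: "0 < P" and n0: "0 < n" using P n by auto
    have "ennreal (3 / 8) * of_nat (\<Prod>k\<in>UNIV. W k) \<le> ennreal (exp (16 * Yc * n)) *
       (of_nat (\<Prod>k\<in>- demand j. W k) * ennreal (P ^ (n * CARD('m))))"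
    proof (rule weighted_converse[OF \<mu> v W(1) P0 Yc n0 j j err mom[OF P v(1)] sets.top])
      fix h assume h: "h \<in> space (channel_law \<mu> S n :: ('r, 'k, 'm) csi measure)"
      have "(\<Sum>w | \<forall>k. w k < W k. \<integral>\<^sup>+ z. (indicator {z. \<forall>j\<in>S. \<forall>k\<in>demand j.
          dec j h (\<lambda>t\<in>{..<n}. outputs enc w h z j t) k = w k} z *
          (weight P n (outputs enc w h z j) * weight P n (outputs enc w h z j))) \<partial>noise_law S n)
        \<le> (\<Sum>w | \<forall>k. w k < W k. \<integral>\<^sup>+ z. (indicator {z. \<forall>k\<in>demand j. dec j h (\<lambda>t\<in>{..<n}. outputs enc w h z j t) k = w k} z *
          weight P n (outputs enc w h z j)) \<partial>noise_law S n)"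
      proof (intro sum_mono nn_integral_mono mult_mono)
        fix w z
        have "weight P n (outputs enc w h z j) * weight P n (outputs enc w h z j) \<le> 1 * weight P n (outputs enc w h z j)"
          by (intro mult_right_mono weight_le_1 P0) auto
        then show "weight P n (outputs enc w h z j) * weight P n (outputs enc w h z j) \<le> weight P n (outputs enc w h z j)" by simp
      qed (use j in \<open>auto simp: indicator_def\<close>)
      also have "\<dots> \<le> of_nat (\<Prod>k\<in>- demand j. W k) * ennreal (P ^ (n * CARD('m)))"
        by (rule fixed_channel_one[OF h v(2) j P0])
      finally show "(\<Sum>w | \<forall>k. w k < W k. \<integral>\<^sup>+ z. (indicator {z. \<forall>j\<in>S. \<forall>k\<in>demand j.
          dec j h (\<lambda>t\<in>{..<n}. outputs enc w h z j t) k = w k} z *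
          (weight P n (outputs enc w h z j) * weight P n (outputs enc w h z j))) \<partial>noise_law S n)
        \<le> of_nat (\<Prod>k\<in>- demand j. W k) * ennreal (P ^ (n * CARD('m)))" .
    qed auto
    also have "P ^ (n * CARD('m)) = exp (0 * n) * P powr (n * CARD('m))"
      using P0 by (simp add: powr_realpow[symmetric])
    finally show "(\<Sum>k\<in>demand j. R $ k) \<le> CARD('m) * log 2 P + ((16 * Yc + 0) / ln 2 + 2)"
      using n by (intro rate_sum_le[OF W(2) _ P]) auto
  qed
qed

text \<open>At most a fraction \<theta> of the slots is given up as ill-conditioned, and each of
  them costs a factor \<open>P ^ CARD('m)\<close>; this is the excess \<theta> in the bound. The
  constant \<open>c\<close> depends on \<theta> through \<tau>, so \<theta> stays fixed
  here.\<close>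

lemma achievable_rate_two:
  fixes S :: "'r::finite set" and demand :: "'r \<Rightarrow> 'k::finite set" and \<theta> :: real
  assumes \<mu>: "channel_distribution \<mu>" and j: "j \<in> S" "j' \<in> S" and i: "i \<notin> demand j" "i \<in> demand j'" and \<theta>: "0 < \<theta>"
  obtains c where "\<And>P R. 1 \<le> P \<Longrightarrow> achievable TYPE('m::finite) \<mu> S demand P R \<Longrightarrow>
    (\<Sum>k\<in>insert i (demand j). R $ k) \<le> CARD('m) * (1 + \<theta>) * log 2 P + c"
proof -
  note \<mu>D = channel_distributionD[OF \<mu>]
  obtain Yc where Yc: "0 < Yc" and mom: "\<And>P n W (enc :: ('r, 'k, 'm) encoders) j t. 1 \<le> P \<Longrightarrow> valid_encoders \<mu> S P n W enc \<Longrightarrow> j \<in> S \<Longrightarrow> t < n \<Longrightarrow>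
    output_energy \<mu> S n W enc j t \<le> ennreal (Yc * P)"
  proof (rule outputs_second_moment[where S = S and 'k = 'k and 'm = 'm, OF \<mu>])
    fix Yc :: real
    assume a: "0 < Yc" and b: "\<And>P n W (enc :: ('r, 'k, 'm) encoders) j t. 1 \<le> P \<Longrightarrow> valid_encoders \<mu> S P n W enc \<Longrightarrow> j \<in> S \<Longrightarrow> t < n \<Longrightarrow>
      output_energy \<mu> S n W enc j t \<le> ennreal (Yc * P)"
    show thesis by (rule that[OF a b])
  qed
  let ?Y = "csi_index S 1 :: (nat \<times> 'r \<times> 'k \<times> 'm \<times> 'm) set"
  obtain \<tau> A where \<tau>: "0 < \<tau>" and A: "A \<in> sets (PiM ?Y (\<lambda>_. \<mu>))"
    "emeasure (PiM ?Y (\<lambda>_. \<mu>)) A \<le> ennreal (4 powr (- 1 / \<theta>))"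
    and tr: "\<And>h. h \<in> space (PiM ?Y (\<lambda>_. \<mu>)) \<Longrightarrow> h \<notin> A \<Longrightarrow>
       \<exists>B :: complex ^ 'm ^ 'm. B ** channel_matrix h 0 j i = channel_matrix h 0 j' i \<and> (\<forall>v. norm (B *v v) \<le> \<tau> * norm v)"
    by (rule slot_transfer[OF \<mu> j, of "4 powr (- 1 / \<theta>)" i]) auto
  define M where "M = real CARD('m)"
  define c2 where "c2 = M * ln (1 + \<tau>\<^sup>2)"
  have \<tau>1: "1 \<le> 1 + \<tau>\<^sup>2" by simp
  show ?thesis
  proof (rule that)
    fix P :: real and R :: "real ^ 'k" assume P: "1 \<le> P" and ach: "achievable TYPE('m) \<mu> S demand P R"
    obtain n W and enc :: "('r, 'k, 'm) encoders" and dec :: "('r, 'k, 'm) decoders" where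
      n: "3 \<le> n" and W: "\<And>k. 0 < W k" "\<And>k. 2 powr (real n * R $ k) \<le> real (W k)"
      and v: "valid_encoders \<mu> S P n W enc" "valid_decoders \<mu> S n dec" and err: "error_probability \<mu> S demand n W enc dec \<le> 1 / 4"
      using achievable_good_code[OF ach] by metis
    have P0: "0 < P" and n0: "0 < n" using P n by auto
    let ?C = "channel_law \<mu> S n :: ('r, 'k, 'm) csi measure"
    interpret C: prob_space ?C by (rule prob_space_channel_law[OF \<mu>D(1)])
    define slot where "slot t h = (\<lambda>y\<in>?Y. h (shift_time (t * 1) y))" for t and h :: "('r, 'k, 'm) csi"
    have sub: "shift_time (t * 1) ` ?Y \<subseteq> csi_index S n" if "t < n" for t
      using shift_time_index(1)[of t n 1] that by simp
    define Bd where "Bd = {h \<in> space ?C. \<theta> * card {..<n} \<le> card {t \<in> {..<n}. slot t h \<in> A}}"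
    have Bd: "Bd \<in> sets ?C" "emeasure ?C Bd \<le> ennreal ((1 / 2) ^ n)"
    proof -
      have dj: "disjoint_family_on (\<lambda>t. shift_time (t * 1) ` ?Y) {..<n}"
        by (rule disjoint_shift_time) (auto simp: csi_index_def)
      note mb = many_bad_blocks[where Bs = "{..<n}" and \<sigma> = "\<lambda>t. shift_time (t * 1)" and K = "csi_index S n" and Y = ?Y,
          OF \<mu>D(1) finite_lessThan finite_index(1) inj_shift_time sub[OF lessThan_iff[THEN iffD1]] dj A(1) \<theta> A(2)]
      show "Bd \<in> sets ?C" "emeasure ?C Bd \<le> ennreal ((1 / 2) ^ n)"
        unfolding Bd_def slot_def channel_law_alt using mb[unfolded card_lessThan] unfolding card_lessThan by blast+
    qed
    define H where "H = space ?C - Bd"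
    have H: "H \<in> sets ?C" "emeasure ?C (space ?C - H) \<le> ennreal (1 / 8)"
    proof -
      show "H \<in> sets ?C" unfolding H_def using Bd(1) by auto
      have "space ?C - H = Bd" unfolding H_def Bd_def by auto
      moreover have "(1 / 2 :: real) ^ n \<le> (1 / 2) ^ 3" using n by (intro power_decreasing) auto
      ultimately show "emeasure ?C (space ?C - H) \<le> ennreal (1 / 8)"
        using Bd(2) by (auto simp: power3_eq_cube intro: order_trans[OF _ ennreal_leI])
    qed
    define a where "a = M * (1 + \<theta>)"
    have "ennreal (3 / 8) * of_nat (\<Prod>k\<in>UNIV. W k) \<le> ennreal (exp (16 * Yc * n)) *
       (of_nat (\<Prod>k\<in>- insert i (demand j). W k) * ennreal (exp (c2 * n) * P powr (n * a)))"
    proof (rule weighted_converse[OF \<mu> v W(1) P0 Yc n0 j err mom[OF P v(1)] H])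
      fix h assume hH: "h \<in> H"
      then have h: "h \<in> space ?C" by (simp add: H_def)
      define Gd where "Gd = {t. t < n \<and> slot t h \<notin> A}"
      have good: "\<exists>B :: complex ^ 'm ^ 'm. B ** channel_matrix h t j i = channel_matrix h t j' i \<and> (\<forall>v. norm (B *v v) \<le> \<tau> * norm v)"
        if t: "t \<in> Gd" "t < n" for t
      proof -
        have "slot t h \<in> space (PiM ?Y (\<lambda>_. \<mu>))"
          unfolding slot_def by (rule measurable_space[OF measurable_reindex[OF sub[OF t(2)]]]) (use h in \<open>simp add: channel_law_alt\<close>)
        moreover have "channel_matrix (slot t h) 0 l i = channel_matrix h t l i" if "l \<in> S" for l
          using that by (simp add: channel_matrix_def slot_def csi_index_def shift_time_def)
        ultimately show ?thesis using tr[of "slot t h"] t(1) j by (simp add: Gd_def)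
      qed
      have card_bad: "real (card ({..<n} - Gd)) \<le> \<theta> * n"
      proof -
        have "{..<n} - Gd = {t \<in> {..<n}. slot t h \<in> A}" by (auto simp: Gd_def)
        then show ?thesis using hH h unfolding H_def Bd_def by simp
      qed
      \<comment> \<open>Every slot is charged the constant \<open>1 + \<tau>\<^sup>2\<close>, and a
        bad slot the power in addition. The constants collect in \<open>c2\<close>.\<close>
      have prod_le: "(\<Prod>t<n. (if t \<in> Gd then 1 + \<tau>\<^sup>2 else P) ^ CARD('m)) \<le> exp (c2 * n) * P powr (n * (M * \<theta>))"
      proof -
        have "(\<Prod>t<n. (if t \<in> Gd then 1 + \<tau>\<^sup>2 else P) ^ CARD('m)) \<le> (\<Prod>t<n. (1 + \<tau>\<^sup>2) ^ CARD('m) * (if t \<in> Gd then 1 else P ^ CARD('m)))"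
        proof (rule prod_mono)
          fix t
          have "1 * P ^ CARD('m) \<le> (1 + \<tau>\<^sup>2) ^ CARD('m) * P ^ CARD('m)"
            using P0 \<tau>1 by (intro mult_right_mono one_le_power) auto
          then show "0 \<le> (if t \<in> Gd then 1 + \<tau>\<^sup>2 else P) ^ CARD('m) \<and>
            (if t \<in> Gd then 1 + \<tau>\<^sup>2 else P) ^ CARD('m) \<le> (1 + \<tau>\<^sup>2) ^ CARD('m) * (if t \<in> Gd then 1 else P ^ CARD('m))"
            using P0 \<tau>1 by (auto intro!: zero_le_power)
        qed
        also have "\<dots> = ((1 + \<tau>\<^sup>2) ^ CARD('m)) ^ n * (P ^ CARD('m)) ^ card ({..<n} - Gd)"
          by (simp add: prod.distrib prod.If_cases Diff_eq)
        also have "((1 + \<tau>\<^sup>2) ^ CARD('m)) ^ n = exp (c2 * n)"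
        proof -
          have "exp (c2 * n) = exp (real (CARD('m) * n) * ln (1 + \<tau>\<^sup>2))" by (simp add: c2_def M_def ac_simps)
          also have "\<dots> = (1 + \<tau>\<^sup>2) ^ (CARD('m) * n)"
            using \<tau>1 by (subst exp_of_nat_mult) (simp add: exp_ln[OF less_le_trans[OF zero_less_one \<tau>1]])
          finally show ?thesis by (simp add: power_mult)
        qed
        also have "(P ^ CARD('m)) ^ card ({..<n} - Gd) = P powr (real (card ({..<n} - Gd)) * M)"
          unfolding power_mult[symmetric] M_def using powr_realpow[OF P0, of "CARD('m) * card ({..<n} - Gd)"]
          by (simp add: mult.commute)
        also have "exp (c2 * n) * \<dots> \<le> exp (c2 * n) * P powr (n * (M * \<theta>))"
        proof (intro mult_left_mono powr_mono P)
          have "real (card ({..<n} - Gd)) * M \<le> (\<theta> * n) * M" using card_bad by (intro mult_right_mono) (auto simp: M_def)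
          then show "real (card ({..<n} - Gd)) * M \<le> n * (M * \<theta>)" by (simp add: ac_simps)
        qed auto
        finally show ?thesis by simp
      qed
      have "P ^ (n * CARD('m)) * (\<Prod>t<n. (if t \<in> Gd then 1 + \<tau>\<^sup>2 else P) ^ CARD('m)) \<le> P powr (n * M) * (exp (c2 * n) * P powr (n * (M * \<theta>)))"
        using prod_le P0 by (intro mult_mono) (auto simp: powr_realpow[symmetric] M_def intro!: prod_nonneg)
      also have "\<dots> = exp (c2 * n) * P powr (n * a)" by (simp add: a_def powr_add[symmetric] distrib_left ac_simps)
      finally have fin: "P ^ (n * CARD('m)) * (\<Prod>t<n. (if t \<in> Gd then 1 + \<tau>\<^sup>2 else P) ^ CARD('m)) \<le> exp (c2 * n) * P powr (n * a)" .
      have "(\<Sum>w | \<forall>k. w k < W k. \<integral>\<^sup>+ z. (indicator {z. \<forall>j\<in>S. \<forall>k\<in>demand j.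
          dec j h (\<lambda>t\<in>{..<n}. outputs enc w h z j t) k = w k} z *
          (weight P n (outputs enc w h z j) * weight P n (outputs enc w h z j'))) \<partial>noise_law S n)
        \<le> (\<Sum>w | \<forall>k. w k < W k. \<integral>\<^sup>+ z. (indicator {z. (\<forall>k\<in>demand j. dec j h (\<lambda>t\<in>{..<n}. outputs enc w h z j t) k = w k) \<and>
          dec j' h (\<lambda>t\<in>{..<n}. outputs enc w h z j' t) i = w i} z *
          (weight P n (outputs enc w h z j) * weight P n (outputs enc w h z j'))) \<partial>noise_law S n)"
        using j i(2) by (intro sum_mono nn_integral_mono mult_right_mono) (auto simp: indicator_def)
      also have "\<dots> \<le> of_nat (\<Prod>k\<in>- insert i (demand j). W k) * ennreal (P ^ (n * CARD('m)) * (\<Prod>t<n. (if t \<in> Gd then 1 + \<tau>\<^sup>2 else P) ^ CARD('m)))"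
        using i by (intro fixed_channel_two[where Gd = Gd and demand = demand, OF h v(2) j] good i(1) P0 \<tau>) auto
      also have "\<dots> \<le> of_nat (\<Prod>k\<in>- insert i (demand j). W k) * ennreal (exp (c2 * n) * P powr (n * a))"
        by (intro mult_left_mono ennreal_leI fin) auto
      finally show "(\<Sum>w | \<forall>k. w k < W k. \<integral>\<^sup>+ z. (indicator {z. \<forall>j\<in>S. \<forall>k\<in>demand j.
          dec j h (\<lambda>t\<in>{..<n}. outputs enc w h z j t) k = w k} z *
          (weight P n (outputs enc w h z j) * weight P n (outputs enc w h z j'))) \<partial>noise_law S n)
        \<le> of_nat (\<Prod>k\<in>- insert i (demand j). W k) * ennreal (exp (c2 * n) * P powr (n * a))" .
    qed
    then have "(\<Sum>k\<in>insert i (demand j). R $ k) \<le> a * log 2 P + ((16 * Yc + c2) / ln 2 + 2)"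
      using n by (intro rate_sum_le[OF W(2) _ P]) auto
    then show "(\<Sum>k\<in>insert i (demand j). R $ k) \<le> CARD('m) * (1 + \<theta>) * log 2 P + ((16 * Yc + c2) / ln 2 + 2)"
      by (simp add: a_def M_def)
  qed
qed

theorem DoF_region_eq_polytope:
  fixes S :: "'r::finite set" and demand :: "'r \<Rightarrow> 'k::finite set"
  assumes \<mu>: "channel_distribution \<mu>"
  shows "DoF_region TYPE('m::finite) \<mu> S demand = dof_polytope CARD('m) S demand"
proof
  show "dof_polytope CARD('m) S demand \<subseteq> DoF_region TYPE('m) \<mu> S demand"
    using dof_polytope_achievable[OF \<mu>] by blast
  show "DoF_region TYPE('m) \<mu> S demand \<subseteq> dof_polytope CARD('m) S demand"
  proof
    fix d assume d: "d \<in> DoF_region TYPE('m) \<mu> S demand"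
    show "d \<in> dof_polytope CARD('m) S demand"
      unfolding dof_polytope_def
    proof (intro CollectI conjI allI ballI)
      show "0 \<le> d $ k" for k using d by (simp add: DoF_region_def)
      fix j assume j: "j \<in> S"
      obtain c where "\<And>P R. 1 \<le> P \<Longrightarrow> achievable TYPE('m) \<mu> S demand P R \<Longrightarrow>
          (\<Sum>k\<in>demand j. R $ k) \<le> CARD('m) * log 2 P + c"
        using achievable_rate_one[where 'm = 'm, OF \<mu> j, of demand] by blast
      from DoF_sum_le[OF d this] show "(\<Sum>k\<in>demand j. d $ k) \<le> CARD('m)" .
      fix i assume i: "i \<in> (\<Union>j\<in>S. demand j) - demand j"
      then obtain j' where j': "j' \<in> S" "i \<in> demand j'" and ni: "i \<notin> demand j" by blast
      have le: "(\<Sum>k\<in>insert i (demand j). d $ k) \<le> CARD('m) * (1 + \<theta>)" if \<theta>: "0 < \<theta>" for \<theta> :: real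
      proof -
        obtain c where "\<And>P R. 1 \<le> P \<Longrightarrow> achievable TYPE('m) \<mu> S demand P R \<Longrightarrow>
            (\<Sum>k\<in>insert i (demand j). R $ k) \<le> CARD('m) * (1 + \<theta>) * log 2 P + c"
          using achievable_rate_two[where 'm = 'm, OF \<mu> j j'(1) ni j'(2) \<theta>] by blast
        from DoF_sum_le[OF d this] show ?thesis .
      qed
      \<comment> \<open>The limit in the power has already removed the constant depending on
        \<theta>, so \<theta> may now tend to 0.\<close>
      have "(\<Sum>k\<in>insert i (demand j). d $ k) \<le> CARD('m) + e" if "0 < e" for e :: real
        using le[of "e / CARD('m)"] that by (simp add: distrib_left)
      then have "(\<Sum>k\<in>insert i (demand j). d $ k) \<le> CARD('m)" by (rule field_le_epsilon)
      then show "(\<Sum>k\<in>demand j. d $ k) + d $ i \<le> CARD('m)" using ni by simp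
    qed
  qed
qed

text \<open>Coordinates are nonnegative, so a smaller demand has a smaller sum. For a receiver
  dominated by \<open>j'\<close> and a further message \<open>i\<close>, either \<open>j'\<close>
  requests \<open>i\<close> and its plain sum bound covers the constraint, or \<open>i\<close>
  interferes at \<open>j'\<close> as well. Restricting to the dominating receivers leaves the set of
  requested messages unchanged.\<close>

lemma dof_polytope_dominated:
  fixes demand :: "'r \<Rightarrow> 'k::finite set"
  assumes sub: "S' \<subseteq> S" and dom: "\<And>j. j \<in> S \<Longrightarrow> \<exists>j'\<in>S'. demand j \<subseteq> demand j'"
  shows "dof_polytope M S demand = dof_polytope M S' demand"
proof -
  have U: "(\<Union>j\<in>S. demand j) = (\<Union>j\<in>S'. demand j)" using sub dom by blast
  have "d \<in> dof_polytope M S demand" if d: "d \<in> dof_polytope M S' demand" for d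
  proof -
    have d0: "\<And>k. 0 \<le> d $ k" and d1: "\<And>j. j \<in> S' \<Longrightarrow> (\<Sum>k\<in>demand j. d $ k) \<le> M"
      and d2: "\<And>j i. j \<in> S' \<Longrightarrow> i \<in> (\<Union>j\<in>S. demand j) \<Longrightarrow> i \<notin> demand j \<Longrightarrow> (\<Sum>k\<in>demand j. d $ k) + d $ i \<le> M"
      using d unfolding U by (auto simp: dof_polytope_def)
    have "(\<Sum>k\<in>demand j. d $ k) \<le> M \<and> (\<forall>i\<in>(\<Union>j\<in>S. demand j) - demand j. (\<Sum>k\<in>demand j. d $ k) + d $ i \<le> M)"
      if j: "j \<in> S" for j
    proof -
      obtain j' where j': "j' \<in> S'" "demand j \<subseteq> demand j'" using dom[OF j] by blast
      have le: "(\<Sum>k\<in>A. d $ k) \<le> (\<Sum>k\<in>demand j'. d $ k)" if "A \<subseteq> demand j'" for A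
        using that d0 by (intro sum_mono2) auto
      have "(\<Sum>k\<in>demand j. d $ k) + d $ i \<le> M" if i: "i \<in> (\<Union>j\<in>S. demand j)" "i \<notin> demand j" for i
      proof (cases "i \<in> demand j'")
        case True
        have "(\<Sum>k\<in>demand j. d $ k) + d $ i = (\<Sum>k\<in>insert i (demand j). d $ k)" using i(2) by simp
        also have "\<dots> \<le> M" using le[of "insert i (demand j)"] True j' d1[OF j'(1)] by force
        finally show ?thesis .
      next
        case False
        then show ?thesis using d2[OF j'(1) i(1)] le[OF j'(2)] by linarith
      qed
      then show ?thesis using le[OF j'(2)] d1[OF j'(1)] by auto
    qed
    with d0 show ?thesis by (simp add: dof_polytope_def)
  qed
  moreover have "d \<in> dof_polytope M S' demand" if "d \<in> dof_polytope M S demand" for d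
    using that sub unfolding dof_polytope_def U by blast
  ultimately show ?thesis by blast
qed

theorem corollary1:
  fixes \<mu> :: "complex measure"
    and demand grp :: "'r::finite \<Rightarrow> 'k::finite set"
    and p :: "'k set \<Rightarrow> 'r"
  assumes "channel_distribution \<mu>"
    and "receiver_grouping demand grp"
    and "prime_choice demand grp p"
  shows "DoF_region TYPE('m::finite) \<mu> UNIV demand
           = DoF_region TYPE('m) \<mu> (prime_receivers demand p) demand
       \<and> (\<forall>S. prime_receivers demand p \<subseteq> S \<longrightarrow>
            DoF_region TYPE('m) \<mu> S demand
              = DoF_region TYPE('m) \<mu> (prime_receivers demand p) demand)"
proof -
  \<comment> \<open>By \<open>prime_choice\<close>, the prime receiver of the group of
    \<open>j\<close> requests everything that \<open>j\<close> requests, so the prime receivers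
    dominate every larger set of receivers.\<close>
  have "\<exists>j'\<in>prime_receivers demand p. demand j \<subseteq> demand j'" for j
    using assms(2,3) unfolding receiver_grouping_def prime_choice_def prime_receivers_def by blast
  then have "DoF_region TYPE('m) \<mu> S demand = DoF_region TYPE('m) \<mu> (prime_receivers demand p) demand"
    if "prime_receivers demand p \<subseteq> S" for S
    unfolding DoF_region_eq_polytope[OF assms(1)] using that by (intro dof_polytope_dominated)
  then show ?thesis by blast
qed

end
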